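(* Let $\mathcal{I}\subseteq 2^N$, let $P_{\mathcal{I}}\subseteq[0,1]^N$ be a relaxation of $\mathcal{I}$, and let $b,c\in[0,1]$. There is a $(b,c)$-balanced contention resolution scheme for $P_{\mathcal{I}}$ if and only if $$\mathbb{E}_{R(\mathbf{x})}\Big[\max_{S\subseteq R(\mathbf{x}),\,S\in\mathcal{I}}\sum_{i\in S}y_i\Big]\ge c\sum_i y_ix_i\quad\text{for all }\mathbf{x}\in bP_{\mathcal{I}}\text{ and }\mathbf{y}\ge 0.$$ Moreover, if there is a polynomial-time deterministic algorithm that, given weights $\mathbf{y}\ge 0$ and $A\subseteq N$, finds a maximum $\mathbf{y}$-weight subset of $A$ belonging to $\mathcal{I}$, then for any $b$ and $\varepsilon>0$ there is a randomized efficiently implementable $(b,c^*-\varepsilon)$-balanced contention resolution scheme for $P_{\mathcal{I}}$, where $c^*$ is the largest value of $c$ such that there is a $(b,c)$-balanced contention resolution scheme for $P_{\mathcal{I}}$; the running time is polynomial in the input size and $1/\varepsilon$. In addition, if this maximum-weight independent set algorithm is monotone, the resulting contention resolution scheme is monotone.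
   Context: $R(\mathbf{x})$ is a random subset of $N$ containing each $i$ independently with probability $x_i$; $bP_{\mathcal{I}}=\{b\mathbf{x}:\mathbf{x}\in P_{\mathcal{I}}\}$. A $(b,c)$-balanced contention resolution scheme $\pi$ for $P_{\mathcal{I}}$ is a procedure that for every $\mathbf{x}\in bP_{\mathcal{I}}$ and $A\subseteq N$ returns a random set $\pi_{\mathbf{x}}(A)\subseteq A\cap\{i:x_i>0\}$ with $\pi_{\mathbf{x}}(A)\in\mathcal{I}$ with probability 1, such that $\Pr[i\in\pi_{\mathbf{x}}(R(\mathbf{x}))\mid i\in R(\mathbf{x})]\ge c$ for all $i$ with $x_i>0$. It is monotone if $\Pr[i\in\pi_{\mathbf{x}}(A_1)]\ge\Pr[i\in\pi_{\mathbf{x}}(A_2)]$ whenever $i\in A_1\subseteq A_2$; efficiently implementable if a polynomial-time algorithm given $\mathbf{x},A$ outputs $\pi_{\mathbf{x}}(A)$. A deterministic algorithm mapping $A$ (for fixed weights) to a subset $\phi(A)\subseteq A$ is monotone if $i\in\phi(A)$ implies $i\in\phi(A')$ for all $A'$ with $i\in A'\subseteq A$. *)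

theory Defs
  imports
    "HOL-Probability.Probability"
    "HOL-Probability.Product_PMF"
    "HOL-Library.Log_Nat"
    "HOL-Computational_Algebra.Polynomial"
begin

section \<open>Relaxations and contention resolution schemes\<close>

text \<open>A vector in \<open>\<real>\<^sup>N\<close> is a function that vanishes outside \<open>N\<close>.\<close>

definition unit_cube :: "'a set \<Rightarrow> ('a \<Rightarrow> real) set" where
  "unit_cube N = {x. (\<forall>i\<in>N. 0 \<le> x i \<and> x i \<le> 1) \<and> (\<forall>i. i \<notin> N \<longrightarrow> x i = 0)}"

text \<open>Neither convexity of \<open>P\<close> nor downward closedness of the family is required.\<close>

definition relaxation :: "'a set \<Rightarrow> 'a set set \<Rightarrow> ('a \<Rightarrow> real) set \<Rightarrow> bool" where
  "relaxation N \<I> P \<longleftrightarrow> P \<subseteq> unit_cube N \<and> (\<forall>S\<in>\<I>. indicator S \<in> P)"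

definition scaled :: "real \<Rightarrow> ('a \<Rightarrow> real) set \<Rightarrow> ('a \<Rightarrow> real) set" where
  "scaled b P = (\<lambda>x i. b * x i) ` P"

definition random_subset :: "'a set \<Rightarrow> ('a \<Rightarrow> real) \<Rightarrow> 'a set pmf" where
  "random_subset N x =
     map_pmf (\<lambda>f. {i\<in>N. f i}) (Pi_pmf N False (\<lambda>i. bernoulli_pmf (x i)))"

text \<open>
  A scheme maps \<open>x\<close> and \<open>A\<close> to the distribution of the random set \<open>\<pi>\<^sub>x(A)\<close>; its randomness is
  independent of that of \<open>R(x)\<close>. The function below gives the joint distribution of \<open>R(x)\<close> and
  \<open>\<pi>\<^sub>x(R(x))\<close>.
\<close>

type_synonym 'a scheme = "('a \<Rightarrow> real) \<Rightarrow> 'a set \<Rightarrow> 'a set pmf"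

definition resolve :: "'a set \<Rightarrow> 'a scheme \<Rightarrow> ('a \<Rightarrow> real) \<Rightarrow> ('a set \<times> 'a set) pmf" where
  "resolve N \<pi> x =
     bind_pmf (random_subset N x) (\<lambda>R. map_pmf (\<lambda>S. (R, S)) (\<pi> x R))"

definition balanced_crs ::
  "'a set \<Rightarrow> 'a set set \<Rightarrow> ('a \<Rightarrow> real) set \<Rightarrow> real \<Rightarrow> real \<Rightarrow> 'a scheme \<Rightarrow> bool" where
  "balanced_crs N \<I> P b c \<pi> \<longleftrightarrow>
     (\<forall>x\<in>scaled b P.
        (\<forall>A. A \<subseteq> N \<longrightarrow> (\<forall>S\<in>set_pmf (\<pi> x A). S \<subseteq> A \<inter> {i\<in>N. x i > 0} \<and> S \<in> \<I>)) \<and>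
        (\<forall>i\<in>N. x i > 0 \<longrightarrow>
           cond_prob (measure_pmf (resolve N \<pi> x)) (\<lambda>(R, S). i \<in> S) (\<lambda>(R, S). i \<in> R) \<ge> c))"

definition monotone_crs :: "'a set \<Rightarrow> ('a \<Rightarrow> real) set \<Rightarrow> real \<Rightarrow> 'a scheme \<Rightarrow> bool" where
  "monotone_crs N P b \<pi> \<longleftrightarrow>
     (\<forall>x\<in>scaled b P. \<forall>A\<^sub>1 A\<^sub>2. \<forall>i\<in>A\<^sub>1. A\<^sub>1 \<subseteq> A\<^sub>2 \<and> A\<^sub>2 \<subseteq> N \<longrightarrow>
        measure_pmf.prob (\<pi> x A\<^sub>1) {S. i \<in> S} \<ge> measure_pmf.prob (\<pi> x A\<^sub>2) {S. i \<in> S})"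

definition largest_balance ::
  "'a set \<Rightarrow> 'a set set \<Rightarrow> ('a \<Rightarrow> real) set \<Rightarrow> real \<Rightarrow> real \<Rightarrow> bool" where
  "largest_balance N \<I> P b c \<longleftrightarrow>
     c \<in> {0..1} \<and> (\<exists>\<pi>. balanced_crs N \<I> P b c \<pi>) \<and>
     (\<forall>c'\<in>{0..1}. (\<exists>\<pi>. balanced_crs N \<I> P b c' \<pi>) \<longrightarrow> c' \<le> c)"


section \<open>A machine model with bit costs\<close>

text \<open>
  Data are binary trees whose leaves are natural numbers in binary. A program maps a datum to a
  datum. Every primitive is computable by a Turing machine in time polynomial in the size of its
  argument and its result, and it is charged for both sizes. Hence the cost of a run bounds the
  size of every intermediate value, so costs agree with Turing machine time up to a polynomial.
\<close>

datatype data = Atom nat | Cell data data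

fun dsize :: "data \<Rightarrow> nat" where
  "dsize (Atom m) = 1 + floorlog 2 m"
| "dsize (Cell u v) = 1 + dsize u + dsize v"

datatype prim = Ident | Const data | First | Second | IsCell | Plus | Minus | Times | Quot | Less

text \<open>Primitives applied to arguments of the wrong shape return \<^term>\<open>Atom 0\<close>.\<close>

fun apply_prim :: "prim \<Rightarrow> data \<Rightarrow> data" where
  "apply_prim Ident v = v"
| "apply_prim (Const u) v = u"
| "apply_prim First (Cell u v) = u"
| "apply_prim Second (Cell u v) = v"
| "apply_prim IsCell (Cell u v) = Atom 1"
| "apply_prim Plus (Cell (Atom m) (Atom k)) = Atom (m + k)"
| "apply_prim Minus (Cell (Atom m) (Atom k)) = Atom (m - k)"
| "apply_prim Times (Cell (Atom m) (Atom k)) = Atom (m * k)"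
| "apply_prim Quot (Cell (Atom m) (Atom k)) = Atom (m div k)"
| "apply_prim Less (Cell (Atom m) (Atom k)) = Atom (if m < k then 1 else 0)"
| "apply_prim _ _ = Atom 0"

datatype prog =
    Prim prim
  | Seq prog prog
  | Fork prog prog
  | Cond prog prog prog
  | Loop prog prog

text \<open>
  \<open>run p v t w\<close>: on input \<open>v\<close> the program \<open>p\<close> halts with output \<open>w\<close> at cost \<open>t\<close>. The test value
  \<^term>\<open>Atom 0\<close> stands for false, every other one for true.
\<close>

inductive run :: "prog \<Rightarrow> data \<Rightarrow> nat \<Rightarrow> data \<Rightarrow> bool" where
  prim: "run (Prim f) v (1 + dsize v + dsize (apply_prim f v)) (apply_prim f v)"
| seq: "run p u s v \<Longrightarrow> run q v t w \<Longrightarrow> run (Seq p q) u (1 + s + t) w"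
| fork: "run p u s v \<Longrightarrow> run q u t w \<Longrightarrow> run (Fork p q) u (1 + s + t) (Cell v w)"
| cond_true: "run c u s v \<Longrightarrow> v \<noteq> Atom 0 \<Longrightarrow> run p u t w \<Longrightarrow> run (Cond c p q) u (1 + s + t) w"
| cond_false: "run c u s (Atom 0) \<Longrightarrow> run q u t w \<Longrightarrow> run (Cond c p q) u (1 + s + t) w"
| loop_exit: "run c u s (Atom 0) \<Longrightarrow> run (Loop c p) u (1 + s) u"
| loop_step: "run c u r v \<Longrightarrow> v \<noteq> Atom 0 \<Longrightarrow> run p u s u' \<Longrightarrow> run (Loop c p) u' t w
    \<Longrightarrow> run (Loop c p) u (1 + r + s + t) w"

definition enc_list :: "data list \<Rightarrow> data" where
  "enc_list us = foldr Cell us (Atom 0)"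

text \<open>Only used for nonnegative rationals; numerator and denominator are coprime.\<close>

definition enc_rat :: "rat \<Rightarrow> data" where
  "enc_rat q = (case quotient_of q of (m, k) \<Rightarrow> Cell (Atom (nat m)) (Atom (nat k)))"

definition enc_vec :: "nat \<Rightarrow> (nat \<Rightarrow> rat) \<Rightarrow> data" where
  "enc_vec n y = enc_list (map (\<lambda>i. enc_rat (y i)) [0..<n])"

definition enc_set :: "nat \<Rightarrow> nat set \<Rightarrow> data" where
  "enc_set n A = enc_list (map (\<lambda>i. Atom (if i \<in> A then 1 else 0)) [0..<n])"

definition enc_bits :: "bool list \<Rightarrow> data" where
  "enc_bits r = enc_list (map (\<lambda>c. Atom (if c then 1 else 0)) r)"


section \<open>Polynomial-time algorithms on families of instances\<close>

text \<open>
  Polynomial running time only makes sense over a family of instances: \<open>W\<close> is the set of codes of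
  the instances, and the instance with code \<open>w\<close> has ground set \<open>{..<n w}\<close> and feasible family
  \<open>\<I> w\<close>. The code, the weights (or the point \<open>x\<close>) and the set \<open>A\<close> together form the input.
\<close>

definition query :: "nat \<Rightarrow> data \<Rightarrow> (nat \<Rightarrow> rat) \<Rightarrow> nat set \<Rightarrow> data" where
  "query n w y A = Cell w (Cell (enc_vec n y) (enc_set n A))"

definition max_weight_subset ::
  "'a set set \<Rightarrow> ('a \<Rightarrow> 'b::linordered_field) \<Rightarrow> 'a set \<Rightarrow> 'a set \<Rightarrow> bool" where
  "max_weight_subset \<I> y A S \<longleftrightarrow>
     S \<subseteq> A \<and> S \<in> \<I> \<and> (\<forall>T. T \<subseteq> A \<and> T \<in> \<I> \<longrightarrow> (\<Sum>i\<in>T. y i) \<le> (\<Sum>i\<in>S. y i))"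

definition poly_time_max_weight ::
  "data set \<Rightarrow> (data \<Rightarrow> nat) \<Rightarrow> (data \<Rightarrow> nat set set) \<Rightarrow>
   (data \<Rightarrow> (nat \<Rightarrow> rat) \<Rightarrow> nat set \<Rightarrow> nat set) \<Rightarrow> bool" where
  "poly_time_max_weight W n \<I> \<phi> \<longleftrightarrow>
     (\<forall>w\<in>W. \<forall>y A. (\<forall>i<n w. 0 \<le> y i) \<and> A \<subseteq> {..<n w} \<longrightarrow>
        max_weight_subset (\<I> w) y A (\<phi> w y A)) \<and>
     (\<exists>p. \<exists>time :: nat poly. \<forall>w\<in>W. \<forall>y A. (\<forall>i<n w. 0 \<le> y i) \<and> A \<subseteq> {..<n w} \<longrightarrow>
        (\<exists>t \<le> poly time (dsize (query (n w) w y A)).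
           run p (query (n w) w y A) t (enc_set (n w) (\<phi> w y A))))"

definition monotone_algorithm ::
  "data set \<Rightarrow> (data \<Rightarrow> nat) \<Rightarrow> (data \<Rightarrow> (nat \<Rightarrow> rat) \<Rightarrow> nat set \<Rightarrow> nat set) \<Rightarrow> bool" where
  "monotone_algorithm W n \<phi> \<longleftrightarrow>
     (\<forall>w\<in>W. \<forall>y A A'. (\<forall>i<n w. 0 \<le> y i) \<and> A' \<subseteq> A \<and> A \<subseteq> {..<n w} \<longrightarrow>
        (\<forall>i\<in>A'. i \<in> \<phi> w y A \<longrightarrow> i \<in> \<phi> w y A'))"

text \<open>
  A randomized algorithm is a program that, besides its input \<open>v\<close> and the accuracy parameter \<open>k\<close>,
  receives uniformly random bits. Both their number and the running time, for every outcome of the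
  bits, are bounded by polynomials in the size of \<open>v\<close> and the value (not the bit length) of \<open>k\<close>;
  since \<open>dsize v \<ge> 1\<close>, evaluating a univariate polynomial at \<open>dsize v + k\<close> loses no generality.
\<close>

definition outputs_distribution ::
  "prog \<Rightarrow> nat poly \<Rightarrow> nat poly \<Rightarrow> nat \<Rightarrow> data \<Rightarrow> data pmf \<Rightarrow> bool" where
  "outputs_distribution p bits time k v D \<longleftrightarrow>
     (\<exists>out.
        (\<forall>r. length r = poly bits (dsize v + k) \<longrightarrow>
           (\<exists>t \<le> poly time (dsize v + k). run p (Cell (Atom k) (Cell v (enc_bits r))) t (out r))) \<and>
        D = map_pmf out (pmf_of_set {r :: bool list. length r = poly bits (dsize v + k)}))"

text \<open>
  The scheme itself is defined at all real points of \<open>bP\<close>; the algorithm is given the rational ones.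
\<close>

definition implements_crs ::
  "prog \<Rightarrow> nat poly \<Rightarrow> nat poly \<Rightarrow> nat \<Rightarrow> data \<Rightarrow> nat \<Rightarrow> (nat \<Rightarrow> real) set \<Rightarrow> real \<Rightarrow>
   nat scheme \<Rightarrow> bool" where
  "implements_crs p bits time k w n P b \<pi> \<longleftrightarrow>
     (\<forall>x :: nat \<Rightarrow> rat. \<forall>A. (\<lambda>i. of_rat (x i)) \<in> scaled b P \<and> A \<subseteq> {..<n} \<longrightarrow>
        outputs_distribution p bits time k (query n w x A)
          (map_pmf (enc_set n) (\<pi> (\<lambda>i. of_rat (x i)) A)))"

end

(*
Contention resolution is a zero-sum game: one player picks a map A -> f(A) with f(A) in I, the other
an element i with x_i > 0, and the payoff is Pr[i in f(R(x)) | i in R(x)]. A scheme is a mixed strategy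
of the first player, its balance is its guaranteed payoff, and the best response to the mixed strategy p
of the second player is a maximum-weight independent set for the weights y_i = p_i / x_i. So the
characterization is the minimax theorem.

The algorithm runs multiplicative weights for the second player. Computing the payoffs exactly is not
possible, but one sample of R(x) per round (conditioned on i by adding i) already gives an unbiased
estimate up to rounding, and the regret bound holds in expectation. The output is the best response to
the weights of a uniformly random round. These weights do not depend on A, and neither does the number
of random bits that are used, so monotonicity of the oracle carries over to the scheme.
*)
theory Submission
  imports Defs
begin

section \<open>Polynomial-time computability relative to a context\<close>

text \<open>One regret bound, \<open>multiplicative_weights\<close>, serves both halves. Run
  deterministically with exact payoffs it yields \<open>minimax_approx\<close>, and from it
  \<open>minimax\<close>; run on sampled payoffs it yields the guarantee of the algorithm. This is
  why its states form a Markov chain over an arbitrary type. The obstacle on the algorithmic side is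
  uniformity: one program and one polynomial have to cover all instances, points, sets, accuracies,
  rounds and elements. Computability is therefore a relation between functions on an index set, with
  sizes measured by a function on it. Loop counters become further coordinates of the index that
  this measure ignores, so a bound for a loop body cannot depend on them. A second obstacle is that
  the scheme must exist, and be monotone, at irrational points too, which no program receives. There
  it is again a mixture of solver answers for rational weights rather than of arbitrary maps, so
  that monotonicity of the solver passes to it in the same way.\<close>

definition pbd :: "'x set \<Rightarrow> ('x \<Rightarrow> nat) \<Rightarrow> ('x \<Rightarrow> nat) \<Rightarrow> bool" where
  "pbd X \<sigma> f \<longleftrightarrow> (\<exists>q. \<forall>x\<in>X. f x \<le> poly q (\<sigma> x))"

lemma pbd_poly: "pbd X \<sigma> (\<lambda>x. poly q (\<sigma> x))"
  unfolding pbd_def by blast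

lemma pbd_mono: "pbd X \<sigma> g \<Longrightarrow> (\<And>x. x \<in> X \<Longrightarrow> f x \<le> g x) \<Longrightarrow> pbd X \<sigma> f"
  unfolding pbd_def by (meson order_trans)

lemma pbd_size: "pbd X \<sigma> \<sigma>"
  using pbd_poly[of X \<sigma> "[:0, 1:]"] by simp

lemma pbd_const: "pbd X \<sigma> (\<lambda>_. c)"
  using pbd_poly[of X \<sigma> "[:c:]"] by simp

lemma pbd_add:
  assumes "pbd X \<sigma> f" "pbd X \<sigma> g" shows "pbd X \<sigma> (\<lambda>x. f x + g x)"
proof -
  obtain p q where "\<forall>x\<in>X. f x \<le> poly p (\<sigma> x)" "\<forall>x\<in>X. g x \<le> poly q (\<sigma> x)"
    using assms by (auto simp: pbd_def)
  then show ?thesis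
    unfolding pbd_def by (intro exI[of _ "p + q"]) (auto intro: add_mono)
qed

lemma pbd_mult:
  assumes "pbd X \<sigma> f" "pbd X \<sigma> g" shows "pbd X \<sigma> (\<lambda>x. f x * g x)"
proof -
  obtain p q where "\<forall>x\<in>X. f x \<le> poly p (\<sigma> x)" "\<forall>x\<in>X. g x \<le> poly q (\<sigma> x)"
    using assms by (auto simp: pbd_def)
  then show ?thesis
    unfolding pbd_def by (intro exI[of _ "p * q"]) (auto intro: mult_mono)
qed

lemma pbd_Suc: "pbd X \<sigma> f \<Longrightarrow> pbd X \<sigma> (\<lambda>x. Suc (f x))"
  using pbd_add[OF _ pbd_const, of X \<sigma> f 1] by simp

lemmas pbd_arith = pbd_size pbd_const pbd_Suc pbd_add pbd_mult

text \<open>Used for the solver, whose time is a polynomial in the size of a query that is itself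
  only known to be polynomially bounded.\<close>

lemma pbd_compose:
  assumes "pbd X \<sigma> f" shows "pbd X \<sigma> (\<lambda>x. poly p (f x))"
proof (induction p)
  case 0
  then show ?case by (simp add: pbd_const)
next
  case (pCons a p)
  then show ?case by (simp add: pbd_arith assms)
qed

lemma pbd_reparam:
  assumes "pbd X \<sigma> f" "\<And>y. y \<in> Y \<Longrightarrow> h y \<in> X" "\<And>y. y \<in> Y \<Longrightarrow> \<sigma> (h y) = \<tau> y"
  shows "pbd Y \<tau> (\<lambda>y. f (h y))"
  using assms unfolding pbd_def by metis

text \<open>
  \<open>x\<close> is the mathematical object the computation depends on and \<open>\<sigma> x\<close> the size in which all
  bounds are polynomial; the program is given the datum \<open>e x\<close> and returns \<open>f x\<close>.
\<close>

definition ptime :: "'x set \<Rightarrow> ('x \<Rightarrow> nat) \<Rightarrow> ('x \<Rightarrow> data) \<Rightarrow> ('x \<Rightarrow> data) \<Rightarrow> bool" where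
  "ptime X \<sigma> e f \<longleftrightarrow> (\<exists>p T. pbd X \<sigma> T \<and> (\<forall>x\<in>X. run p (e x) (T x) (f x)))"

lemma ptimeI:
  assumes "pbd X \<sigma> T" "\<And>x. x \<in> X \<Longrightarrow> \<exists>t\<le>T x. run p (e x) t (f x)"
  shows "ptime X \<sigma> e f"
proof -
  obtain T' where T': "\<And>x. x \<in> X \<Longrightarrow> T' x \<le> T x \<and> run p (e x) (T' x) (f x)"
    using assms(2) by metis
  with pbd_mono[OF assms(1)] have "pbd X \<sigma> T'" by blast
  with T' show ?thesis
    unfolding ptime_def by blast
qed

lemma ptimeE:
  assumes "ptime X \<sigma> e f"
  obtains p T where "pbd X \<sigma> T" "\<And>x. x \<in> X \<Longrightarrow> run p (e x) (T x) (f x)"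
  using assms unfolding ptime_def by blast

lemma run_size: "run p v t w \<Longrightarrow> dsize v \<le> t \<and> dsize w \<le> t"
  by (induction rule: run.induct) auto

lemma ptime_size:
  assumes "ptime X \<sigma> e f"
  shows "pbd X \<sigma> (\<lambda>x. dsize (e x))" "pbd X \<sigma> (\<lambda>x. dsize (f x))"
proof -
  obtain p T where T: "pbd X \<sigma> T" "\<And>x. x \<in> X \<Longrightarrow> run p (e x) (T x) (f x)"
    using assms unfolding ptime_def by blast
  show "pbd X \<sigma> (\<lambda>x. dsize (e x))" "pbd X \<sigma> (\<lambda>x. dsize (f x))"
    using T(2)[THEN run_size] by (auto intro: pbd_mono[OF T(1)])
qed

lemma ptime_cong:
  assumes "ptime X \<sigma> e f" "\<And>x. x \<in> X \<Longrightarrow> f x = g x"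
  shows "ptime X \<sigma> e g"
  using assms unfolding ptime_def by (metis (mono_tags))

text \<open>Moves a program between contexts without changing it. Typically \<open>h\<close>
  projects away a loop counter or restricts the index set.\<close>

lemma ptime_reparam:
  assumes "ptime X \<sigma> e f" "\<And>y. y \<in> Y \<Longrightarrow> h y \<in> X" "\<And>y. y \<in> Y \<Longrightarrow> \<sigma> (h y) = \<tau> y"
  shows "ptime Y \<tau> (\<lambda>y. e (h y)) (\<lambda>y. f (h y))"
  using assms(1)
proof (rule ptimeE)
  fix p T assume T: "pbd X \<sigma> T" and "\<And>x. x \<in> X \<Longrightarrow> run p (e x) (T x) (f x)"
  then show ?thesis
    using assms(2) pbd_reparam[of X \<sigma> T Y h \<tau>, OF T assms(2,3)] unfolding ptime_def
    by (intro exI[of _ p] exI[of _ "\<lambda>y. T (h y)"]) auto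
qed

lemma ptime_prim:
  assumes "pbd X \<sigma> (\<lambda>x. dsize (e x))" "pbd X \<sigma> (\<lambda>x. dsize (apply_prim f (e x)))"
  shows "ptime X \<sigma> e (\<lambda>x. apply_prim f (e x))"
proof -
  have "pbd X \<sigma> (\<lambda>x. 1 + dsize (e x) + dsize (apply_prim f (e x)))"
    by (intro pbd_arith assms)
  then show ?thesis
    unfolding ptime_def by (blast intro: run.prim)
qed

lemma ptime_seq:
  assumes "ptime X \<sigma> e f" "ptime X \<sigma> f g" shows "ptime X \<sigma> e g"
  using assms
proof (elim ptimeE)
  fix p T p' T'
  assume T: "pbd X \<sigma> T" "pbd X \<sigma> T'"
    and run: "\<And>x. x \<in> X \<Longrightarrow> run p (e x) (T x) (f x)" "\<And>x. x \<in> X \<Longrightarrow> run p' (f x) (T' x) (g x)"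
  have "pbd X \<sigma> (\<lambda>x. 1 + T x + T' x)"
    by (intro pbd_arith T)
  with run show ?thesis
    unfolding ptime_def by (blast intro: run.seq)
qed

lemma ptime_pair:
  assumes "ptime X \<sigma> e f" "ptime X \<sigma> e g" shows "ptime X \<sigma> e (\<lambda>x. Cell (f x) (g x))"
  using assms
proof (elim ptimeE)
  fix p T p' T'
  assume T: "pbd X \<sigma> T" "pbd X \<sigma> T'"
    and run: "\<And>x. x \<in> X \<Longrightarrow> run p (e x) (T x) (f x)" "\<And>x. x \<in> X \<Longrightarrow> run p' (e x) (T' x) (g x)"
  have "pbd X \<sigma> (\<lambda>x. 1 + T x + T' x)"
    by (intro pbd_arith T)
  with run show ?thesis
    unfolding ptime_def by (blast intro: run.fork)
qed

lemma ptime_id: "pbd X \<sigma> (\<lambda>x. dsize (e x)) \<Longrightarrow> ptime X \<sigma> e e"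
  using ptime_prim[of X \<sigma> e Ident] by simp

text \<open>The premise supplies the bound on the size of \<open>e x\<close>: a primitive is charged
  for its argument even when it ignores it.\<close>

lemma ptime_const: 
  assumes "ptime X \<sigma> e f" shows "ptime X \<sigma> e (\<lambda>_. u)"
  using ptime_prim[of X \<sigma> e "Const u"] ptime_size[OF assms] by (simp add: pbd_const)

lemma ptime_fst:
  assumes "ptime X \<sigma> e (\<lambda>x. Cell (f x) (g x))" shows "ptime X \<sigma> e f"
proof (rule ptime_seq[OF assms])
  have "pbd X \<sigma> (\<lambda>x. dsize (f x))"
    by (rule pbd_mono[OF ptime_size(2)[OF assms]]) simp
  then show "ptime X \<sigma> (\<lambda>x. Cell (f x) (g x)) f"
    using ptime_prim[OF ptime_size(2)[OF assms], of First] by simp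
qed

lemma ptime_snd:
  assumes "ptime X \<sigma> e (\<lambda>x. Cell (f x) (g x))" shows "ptime X \<sigma> e g"
proof (rule ptime_seq[OF assms])
  have "pbd X \<sigma> (\<lambda>x. dsize (g x))"
    by (rule pbd_mono[OF ptime_size(2)[OF assms]]) simp
  then show "ptime X \<sigma> (\<lambda>x. Cell (f x) (g x)) g"
    using ptime_prim[OF ptime_size(2)[OF assms], of Second] by simp
qed

section \<open>Arithmetic and Boolean operations\<close>

lemma floorlog2_le: "floorlog 2 m \<le> k \<longleftrightarrow> m < 2 ^ k"
  by (simp add: floorlog_le_iff)

lemma less_two_power_floorlog: "m < 2 ^ floorlog 2 m"
  using floorlog2_le[of m "floorlog 2 m"] by simp

lemma floorlog2_add: "floorlog 2 (m + k) \<le> 1 + (floorlog 2 m + floorlog 2 k)"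
proof -
  have "m + k < 2 ^ floorlog 2 m + 2 ^ floorlog 2 k"
    by (intro add_strict_mono less_two_power_floorlog)
  also have "\<dots> \<le> 2 ^ (floorlog 2 m + floorlog 2 k) + 2 ^ (floorlog 2 m + floorlog 2 k)"
    by (intro add_mono power_increasing) auto
  finally show ?thesis by (subst floorlog2_le) simp
qed

lemma floorlog2_mult: "floorlog 2 (m * k) \<le> floorlog 2 m + floorlog 2 k"
  unfolding floorlog2_le power_add
  by (intro mult_strict_mono less_two_power_floorlog) auto

text \<open>By \<open>size\<close> the result is no larger than the pair of arguments, whose size is
  already polynomially bounded.\<close>

lemma ptime_binop:
  assumes "ptime X \<sigma> e (\<lambda>x. Atom (f x))" "ptime X \<sigma> e (\<lambda>x. Atom (g x))"
    and op: "\<And>m k. apply_prim q (Cell (Atom m) (Atom k)) = Atom (op m k)"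
    and size: "\<And>m k. floorlog 2 (op m k) \<le> 1 + (floorlog 2 m + floorlog 2 k)"
  shows "ptime X \<sigma> e (\<lambda>x. Atom (op (f x) (g x)))"
proof -
  have 1: "ptime X \<sigma> e (\<lambda>x. Cell (Atom (f x)) (Atom (g x)))"
    by (intro ptime_pair assms)
  have "pbd X \<sigma> (\<lambda>x. dsize (Atom (op (f x) (g x))))"
    by (rule pbd_mono[OF ptime_size(2)[OF 1]]) (use size in \<open>simp add: le_SucI\<close>)
  then have "ptime X \<sigma> (\<lambda>x. Cell (Atom (f x)) (Atom (g x))) (\<lambda>x. Atom (op (f x) (g x)))"
    using ptime_prim[OF ptime_size(2)[OF 1], of q] by (simp add: op)
  with 1 show ?thesis by (rule ptime_seq)
qed

lemma ptime_plus:
  "ptime X \<sigma> e (\<lambda>x. Atom (f x)) \<Longrightarrow> ptime X \<sigma> e (\<lambda>x. Atom (g x)) \<Longrightarrow>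
   ptime X \<sigma> e (\<lambda>x. Atom (f x + g x))"
  by (rule ptime_binop[where op = "(+)" and q = Plus]) (use floorlog2_add in auto)

lemma ptime_minus:
  "ptime X \<sigma> e (\<lambda>x. Atom (f x)) \<Longrightarrow> ptime X \<sigma> e (\<lambda>x. Atom (g x)) \<Longrightarrow>
   ptime X \<sigma> e (\<lambda>x. Atom (f x - g x))"
  by (rule ptime_binop[where op = "(-)" and q = Minus])
     (auto intro!: order_trans[OF floorlog_mono[OF diff_le_self]])

lemma ptime_times:
  "ptime X \<sigma> e (\<lambda>x. Atom (f x)) \<Longrightarrow> ptime X \<sigma> e (\<lambda>x. Atom (g x)) \<Longrightarrow>
   ptime X \<sigma> e (\<lambda>x. Atom (f x * g x))"
  by (rule ptime_binop[where op = "(*)" and q = Times]) (use floorlog2_mult in \<open>auto intro: le_SucI\<close>)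

lemma ptime_div:
  "ptime X \<sigma> e (\<lambda>x. Atom (f x)) \<Longrightarrow> ptime X \<sigma> e (\<lambda>x. Atom (g x)) \<Longrightarrow>
   ptime X \<sigma> e (\<lambda>x. Atom (f x div g x))"
  by (rule ptime_binop[where op = "(div)" and q = Quot])
     (auto intro!: order_trans[OF floorlog_mono[OF div_le_dividend]])

lemma ptime_less:
  "ptime X \<sigma> e (\<lambda>x. Atom (f x)) \<Longrightarrow> ptime X \<sigma> e (\<lambda>x. Atom (g x)) \<Longrightarrow>
   ptime X \<sigma> e (\<lambda>x. Atom (if f x < g x then 1 else 0))"
  by (rule ptime_binop[where op = "\<lambda>m k. if m < k then 1 else 0" and q = Less])
     (auto simp: floorlog_def)

lemma ptime_Suc: "ptime X \<sigma> e (\<lambda>x. Atom (f x)) \<Longrightarrow> ptime X \<sigma> e (\<lambda>x. Atom (Suc (f x)))"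
  using ptime_plus[OF _ ptime_const, of X \<sigma> e f _ 1] by simp

lemma ptime_and:
  assumes "ptime X \<sigma> e (\<lambda>x. Atom (if P x then 1 else 0))"
    "ptime X \<sigma> e (\<lambda>x. Atom (if Q x then 1 else 0))"
  shows "ptime X \<sigma> e (\<lambda>x. Atom (if P x \<and> Q x then 1 else 0))"
  by (rule ptime_cong[OF ptime_times[OF assms]]) auto

lemma ptime_not:
  assumes "ptime X \<sigma> e (\<lambda>x. Atom (if P x then 1 else 0))"
  shows "ptime X \<sigma> e (\<lambda>x. Atom (if \<not> P x then 1 else 0))"
  by (rule ptime_cong[OF ptime_minus[OF ptime_const[of _ _ _ _ "Atom 1"]]], rule assms, rule assms) auto

lemma ptime_or:
  assumes "ptime X \<sigma> e (\<lambda>x. Atom (if P x then 1 else 0))"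
    "ptime X \<sigma> e (\<lambda>x. Atom (if Q x then 1 else 0))"
  shows "ptime X \<sigma> e (\<lambda>x. Atom (if P x \<or> Q x then 1 else 0))"
  using ptime_not[OF ptime_and[OF ptime_not ptime_not, OF assms]] by simp

lemma ptime_eq:
  assumes "ptime X \<sigma> e (\<lambda>x. Atom (f x))" "ptime X \<sigma> e (\<lambda>x. Atom (g x))"
  shows "ptime X \<sigma> e (\<lambda>x. Atom (if f x = g x then 1 else 0))"
  by (rule ptime_cong[OF ptime_not[OF ptime_or[OF ptime_less ptime_less]], OF assms assms(2,1)]) auto

text \<open>Test and body are bounded by polynomials in \<open>\<sigma> x\<close> that hold in every
  round, so polynomially many rounds stay polynomial. The number \<open>m x\<close> occurs only in
  the analysis, while the program sees just the states and the test; hence the loop can also serve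
  to find \<open>m x\<close>.\<close>

lemma ptime_loop:
  assumes c: "ptime (Sigma X (\<lambda>x. {..m x})) (\<lambda>z. \<sigma> (fst z)) (\<lambda>z. S (fst z) (snd z)) c"
    and c_iff: "\<And>x j. x \<in> X \<Longrightarrow> j \<le> m x \<Longrightarrow> c (x, j) \<noteq> Atom 0 \<longleftrightarrow> j < m x"
    and p: "ptime (Sigma X (\<lambda>x. {..<m x})) (\<lambda>z. \<sigma> (fst z)) (\<lambda>z. S (fst z) (snd z))
              (\<lambda>z. S (fst z) (Suc (snd z)))"
    and m: "pbd X \<sigma> m"
  shows "ptime X \<sigma> (\<lambda>x. S x 0) (\<lambda>x. S x (m x))"
proof -
  obtain pc Tc where Tc: "pbd (Sigma X (\<lambda>x. {..m x})) (\<lambda>z. \<sigma> (fst z)) Tc"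
    and pc: "\<And>x j. x \<in> X \<Longrightarrow> j \<le> m x \<Longrightarrow> run pc (S x j) (Tc (x, j)) (c (x, j))"
    using c by (auto simp: ptime_def)
  obtain pb Tb where Tb: "pbd (Sigma X (\<lambda>x. {..<m x})) (\<lambda>z. \<sigma> (fst z)) Tb"
    and pb: "\<And>x j. x \<in> X \<Longrightarrow> j < m x \<Longrightarrow> run pb (S x j) (Tb (x, j)) (S x (Suc j))"
    using p by (auto simp: ptime_def)
  obtain qc where qc: "\<And>x j. x \<in> X \<Longrightarrow> j \<le> m x \<Longrightarrow> Tc (x, j) \<le> poly qc (\<sigma> x)"
    using Tc by (fastforce simp: pbd_def)
  obtain qb where qb: "\<And>x j. x \<in> X \<Longrightarrow> j < m x \<Longrightarrow> Tb (x, j) \<le> poly qb (\<sigma> x)"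
    using Tb by (fastforce simp: pbd_def)
  define C where "C x = 1 + poly qc (\<sigma> x) + poly qb (\<sigma> x)" for x
  \<comment> \<open>Induction on the number \<open>d\<close> of remaining rounds. Each costs at most
    \<open>C x\<close>, and the \<open>Suc\<close> pays for the failing test at the end.\<close>
  have "\<exists>t\<le>Suc d * C x. run (Loop pc pb) (S x (m x - d)) t (S x (m x))" if "x \<in> X" "d \<le> m x" for x d
    using that(2)
  proof (induction d)
    case 0
    have "run pc (S x (m x)) (Tc (x, m x)) (Atom 0)"
      using pc[of x "m x"] c_iff[of x "m x"] that by simp
    from run.loop_exit[OF this, of pb] show ?case
      using qc[of x "m x"] that by (intro exI[of _ "1 + Tc (x, m x)"]) (auto simp: C_def)
  next
    case (Suc d)
    let ?j = "m x - Suc d"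
    obtain t where t: "t \<le> Suc d * C x" "run (Loop pc pb) (S x (m x - d)) t (S x (m x))"
      using Suc by auto
    have j: "?j < m x" "Suc ?j = m x - d" using Suc by auto
    have "run (Loop pc pb) (S x ?j) (1 + Tc (x, ?j) + Tb (x, ?j) + t) (S x (m x))"
      using j t(2) pb[of x ?j] by (intro run.loop_step[OF pc]) (use that c_iff in auto)
    moreover have "1 + Tc (x, ?j) + Tb (x, ?j) + t \<le> Suc (Suc d) * C x"
      using t(1) qc[of x ?j] qb[of x ?j] that j by (simp add: C_def)
    ultimately show ?case by blast
  qed
  from this[of _ "m _"] have run: "\<exists>t\<le>Suc (m x) * C x. run (Loop pc pb) (S x 0) t (S x (m x))"
    if "x \<in> X" for x using that by force
  show ?thesis
    by (rule ptimeI[OF _ run]) (auto simp only: C_def intro!: pbd_arith m pbd_poly)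
qed

text \<open>
  \<open>acc x j\<close> is the accumulator after \<open>j\<close> rounds. The body is verified for an abstract environment
  \<open>E\<close> that provides the round number, the accumulator and everything computable from \<open>e\<close>. As the
  round number is part of the context, its time bound is automatically uniform in the rounds.
\<close>

lemma ptime_iter:
  fixes acc :: "'x \<Rightarrow> nat \<Rightarrow> data"
  assumes n: "ptime X \<sigma> e (\<lambda>x. Atom (m x))" and m: "pbd X \<sigma> m"
    and init: "ptime X \<sigma> e (\<lambda>x. acc x 0)"
    and size: "pbd (Sigma X (\<lambda>x. {..m x})) (\<lambda>z. \<sigma> (fst z)) (\<lambda>z. dsize (acc (fst z) (snd z)))"
    and step: "\<And>E. ptime (Sigma X (\<lambda>x. {..<m x})) (\<lambda>z. \<sigma> (fst z)) E (\<lambda>z. Atom (snd z)) \<Longrightarrow>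
       ptime (Sigma X (\<lambda>x. {..<m x})) (\<lambda>z. \<sigma> (fst z)) E (\<lambda>z. acc (fst z) (snd z)) \<Longrightarrow>
       (\<And>f. ptime X \<sigma> e f \<Longrightarrow> ptime (Sigma X (\<lambda>x. {..<m x})) (\<lambda>z. \<sigma> (fst z)) E (\<lambda>z. f (fst z))) \<Longrightarrow>
       ptime (Sigma X (\<lambda>x. {..<m x})) (\<lambda>z. \<sigma> (fst z)) E (\<lambda>z. acc (fst z) (Suc (snd z)))"
  shows "ptime X \<sigma> e (\<lambda>x. acc x (m x))"
proof -
  let ?Z = "Sigma X (\<lambda>x. {..<m x})" and ?Z' = "Sigma X (\<lambda>x. {..m x})" and ?\<sigma> = "\<lambda>z. \<sigma> (fst z)"
  \<comment> \<open>The state keeps the original input next to the counter and the accumulator, so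
    whatever is computable from \<open>e x\<close> stays available in every round.\<close>
  define S where "S x j = Cell (Atom j) (Cell (acc x j) (e x))" for x j
  have e: "pbd X \<sigma> (\<lambda>x. dsize (e x))" by (rule ptime_size(1)[OF n])
  have "pbd ?Z' ?\<sigma> (\<lambda>z. 1 + (1 + m (fst z)) + (1 + dsize (acc (fst z) (snd z)) + dsize (e (fst z))))"
    by (intro pbd_arith size pbd_reparam[OF m] pbd_reparam[OF e]) auto
  then have "pbd ?Z' ?\<sigma> (\<lambda>z. dsize (S (fst z) (snd z)))"
  proof (rule pbd_mono)
    fix z assume "z \<in> ?Z'"
    then have "snd z \<le> m (fst z)" by auto
    moreover have "floorlog 2 (snd z) \<le> snd z" by (simp add: floorlog2_le)
    ultimately show "dsize (S (fst z) (snd z))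
      \<le> 1 + (1 + m (fst z)) + (1 + dsize (acc (fst z) (snd z)) + dsize (e (fst z)))"
      by (simp add: S_def)
  qed
  then have id': "ptime ?Z' ?\<sigma> (\<lambda>z. S (fst z) (snd z)) (\<lambda>z. S (fst z) (snd z))"
    by (rule ptime_id)
  have id: "ptime ?Z ?\<sigma> (\<lambda>z. S (fst z) (snd z)) (\<lambda>z. S (fst z) (snd z))"
    by (rule ptime_reparam[OF id', where h = "\<lambda>z. z"]) auto
  have lift': "ptime ?Z' ?\<sigma> (\<lambda>z. S (fst z) (snd z)) (\<lambda>z. f (fst z))" if "ptime X \<sigma> e f" for f
    by (rule ptime_seq[OF _ ptime_reparam[OF that, where h = fst]])
       (use id'[unfolded S_def] in \<open>auto simp: S_def dest: ptime_snd\<close>)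
  have lift: "ptime ?Z ?\<sigma> (\<lambda>z. S (fst z) (snd z)) (\<lambda>z. f (fst z))" if "ptime X \<sigma> e f" for f
    by (rule ptime_reparam[OF lift'[OF that], where h = "\<lambda>z. z"]) auto
  have idx': "ptime ?Z' ?\<sigma> (\<lambda>z. S (fst z) (snd z)) (\<lambda>z. Atom (snd z))"
    by (rule ptime_fst[OF id'[unfolded S_def], folded S_def])
  have idx: "ptime ?Z ?\<sigma> (\<lambda>z. S (fst z) (snd z)) (\<lambda>z. Atom (snd z))"
    by (rule ptime_fst[OF id[unfolded S_def], folded S_def])
  have acc: "ptime ?Z ?\<sigma> (\<lambda>z. S (fst z) (snd z)) (\<lambda>z. acc (fst z) (snd z))"
    by (rule ptime_fst[OF ptime_snd[OF id[unfolded S_def], folded S_def]])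
  have "ptime X \<sigma> (\<lambda>x. S x 0) (\<lambda>x. S x (m x))"
  proof (rule ptime_loop[OF _ _ _ m])
    show "ptime ?Z' ?\<sigma> (\<lambda>z. S (fst z) (snd z)) (\<lambda>z. Atom (if snd z < m (fst z) then 1 else 0))"
      by (intro ptime_less idx' lift' n)
    show "ptime ?Z ?\<sigma> (\<lambda>z. S (fst z) (snd z)) (\<lambda>z. S (fst z) (Suc (snd z)))"
      unfolding S_def[of _ "Suc _"] by (intro ptime_pair ptime_Suc idx step acc lift ptime_id e)
  qed auto
  moreover have "ptime X \<sigma> e (\<lambda>x. S x 0)"
    unfolding S_def by (intro ptime_pair init ptime_id e ptime_const[OF n])
  ultimately have "ptime X \<sigma> e (\<lambda>x. S x (m x))" by (rule ptime_seq[rotated])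
  then show ?thesis unfolding S_def by (rule ptime_fst[OF ptime_snd])
qed

section \<open>Lists: size, construction, lookup and length\<close>

lemma enc_list_Nil [simp]: "enc_list [] = Atom 0"
  and enc_list_Cons [simp]: "enc_list (u # us) = Cell u (enc_list us)"
  by (simp_all add: enc_list_def)

lemma length_le_dsize: "length us \<le> dsize (enc_list us)"
  by (induction us) auto

lemma dsize_enc_list_le:
  "(\<And>u. u \<in> set us \<Longrightarrow> dsize u \<le> B) \<Longrightarrow> dsize (enc_list us) \<le> 1 + length us * (1 + B)"
proof (induction us)
  case Nil
  show ?case by (simp add: floorlog_def)
next
  case (Cons u us)
  have "dsize u \<le> B" "dsize (enc_list us) \<le> 1 + length us * (1 + B)"
    by (rule Cons.prems, simp, rule Cons.IH, rule Cons.prems) simp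
  then show ?case by simp
qed

lemma dsize_enc_list_drop: "dsize (enc_list (drop j us)) \<le> dsize (enc_list us)"
proof (induction us arbitrary: j)
  case (Cons u us)
  then show ?case by (cases j) (auto intro: le_trans[OF Cons] le_SucI trans_le_add2)
qed simp

lemma pbd_length: "ptime X \<sigma> e (\<lambda>x. enc_list (l x)) \<Longrightarrow> pbd X \<sigma> (\<lambda>x. length (l x))"
  by (rule pbd_mono[OF ptime_size(2)]) (auto intro: length_le_dsize)

text \<open>\<open>Cell\<close> prepends, so the list is built from its last entry: after
  \<open>j\<close> rounds the accumulator holds the last \<open>j\<close> entries, and the next one
  has index \<open>m x - Suc j\<close>. The premise \<open>f\<close> is used once, for a fixed pair
  of index and input, and then reindexed to that entry.\<close>

lemma ptime_map_upt:
  fixes f :: "'x \<Rightarrow> nat \<Rightarrow> data"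
  assumes n: "ptime X \<sigma> e (\<lambda>x. Atom (m x))" and m: "pbd X \<sigma> m"
    and f: "\<And>E. ptime (Sigma X (\<lambda>x. {..<m x})) (\<lambda>z. \<sigma> (fst z)) E (\<lambda>z. Atom (snd z)) \<Longrightarrow>
       (\<And>f. ptime X \<sigma> e f \<Longrightarrow> ptime (Sigma X (\<lambda>x. {..<m x})) (\<lambda>z. \<sigma> (fst z)) E (\<lambda>z. f (fst z))) \<Longrightarrow>
       ptime (Sigma X (\<lambda>x. {..<m x})) (\<lambda>z. \<sigma> (fst z)) E (\<lambda>z. f (fst z) (snd z))"
  shows "ptime X \<sigma> e (\<lambda>x. enc_list (map (f x) [0..<m x]))"
proof -
  let ?Z = "Sigma X (\<lambda>x. {..<m x})" and ?\<sigma> = "\<lambda>z. \<sigma> (fst z)"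
  let ?E = "\<lambda>z. Cell (Atom (snd z)) (e (fst z))"
  have e: "pbd X \<sigma> (\<lambda>x. dsize (e x))" by (rule ptime_size(1)[OF n])
  have "pbd ?Z ?\<sigma> (\<lambda>z. 1 + (1 + m (fst z)) + dsize (e (fst z)))"
    by (intro pbd_arith pbd_reparam[OF m] pbd_reparam[OF e]) auto
  then have "pbd ?Z ?\<sigma> (\<lambda>z. dsize (?E z))"
  proof (rule pbd_mono)
    fix z assume "z \<in> ?Z"
    then have "snd z \<le> m (fst z)" by auto
    moreover have "floorlog 2 (snd z) \<le> snd z" by (simp add: floorlog2_le)
    ultimately show "dsize (?E z) \<le> 1 + (1 + m (fst z)) + dsize (e (fst z))" by simp
  qed
  note id = ptime_id[OF this]
  have f': "ptime ?Z ?\<sigma> ?E (\<lambda>z. f (fst z) (snd z))"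
  proof (rule f)
    show "ptime ?Z ?\<sigma> ?E (\<lambda>z. Atom (snd z))"
      by (rule ptime_fst[OF id])
    show "ptime ?Z ?\<sigma> ?E (\<lambda>z. g (fst z))" if "ptime X \<sigma> e g" for g
      by (rule ptime_seq[OF ptime_snd[OF id] ptime_reparam[OF that]]) auto
  qed
  obtain q where q: "\<And>x j. x \<in> X \<Longrightarrow> j < m x \<Longrightarrow> dsize (f x j) \<le> poly q (\<sigma> x)"
    using ptime_size(2)[OF f'] by (fastforce simp: pbd_def)
  define acc where "acc x j = enc_list (map (f x) [m x - j..<m x])" for x j
  have "ptime X \<sigma> e (\<lambda>x. acc x (m x))"
  proof (rule ptime_iter[OF n m])
    show "ptime X \<sigma> e (\<lambda>x. acc x 0)"
      unfolding acc_def by (simp add: ptime_const[OF n])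
    have "pbd (Sigma X (\<lambda>x. {..m x})) ?\<sigma> (\<lambda>z. 1 + m (fst z) * (1 + poly q (\<sigma> (fst z))))"
      by (intro pbd_arith pbd_poly pbd_reparam[OF m]) auto
    then show "pbd (Sigma X (\<lambda>x. {..m x})) ?\<sigma> (\<lambda>z. dsize (acc (fst z) (snd z)))"
    proof (rule pbd_mono)
      fix z assume z: "z \<in> Sigma X (\<lambda>x. {..m x})"
      have "dsize (acc (fst z) (snd z)) \<le> 1 + length (map (f (fst z)) [m (fst z) - snd z..<m (fst z)]) * (1 + poly q (\<sigma> (fst z)))"
        unfolding acc_def by (rule dsize_enc_list_le) (use z q in auto)
      also have "\<dots> \<le> 1 + m (fst z) * (1 + poly q (\<sigma> (fst z)))"
        by (intro add_mono mult_mono) auto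
      finally show "dsize (acc (fst z) (snd z)) \<le> 1 + m (fst z) * (1 + poly q (\<sigma> (fst z)))" .
    qed
    fix E
    assume idx: "ptime ?Z ?\<sigma> E (\<lambda>z. Atom (snd z))"
      and acc: "ptime ?Z ?\<sigma> E (\<lambda>z. acc (fst z) (snd z))"
      and lift: "\<And>f. ptime X \<sigma> e f \<Longrightarrow> ptime ?Z ?\<sigma> E (\<lambda>z. f (fst z))"
    have "ptime ?Z ?\<sigma> E (\<lambda>z. f (fst z) (m (fst z) - Suc (snd z)))"
    proof (rule ptime_seq)
      show "ptime ?Z ?\<sigma> E (\<lambda>z. Cell (Atom (m (fst z) - Suc (snd z))) (e (fst z)))"
        by (intro ptime_pair ptime_minus ptime_Suc idx lift n ptime_id e)
      show "ptime ?Z ?\<sigma> (\<lambda>z. Cell (Atom (m (fst z) - Suc (snd z))) (e (fst z)))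
              (\<lambda>z. f (fst z) (m (fst z) - Suc (snd z)))"
        using ptime_reparam[OF f', of ?Z "\<lambda>z. (fst z, m (fst z) - Suc (snd z))" ?\<sigma>] by auto
    qed
    from ptime_pair[OF this acc] show "ptime ?Z ?\<sigma> E (\<lambda>z. acc (fst z) (Suc (snd z)))"
    proof (rule ptime_cong)
      fix z assume z: "z \<in> ?Z"
      then have "[m (fst z) - Suc (snd z)..<m (fst z)] = (m (fst z) - Suc (snd z)) # [m (fst z) - snd z..<m (fst z)]"
        by (subst upt_conv_Cons) (auto simp: Suc_diff_Suc)
      then show "Cell (f (fst z) (m (fst z) - Suc (snd z))) (acc (fst z) (snd z)) = acc (fst z) (Suc (snd z))"
        by (simp add: acc_def)
    qed
  qed
  then show ?thesis by (simp add: acc_def)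
qed

lemma ptime_nth:
  assumes l: "ptime X \<sigma> e (\<lambda>x. enc_list (l x))" and i: "ptime X \<sigma> e (\<lambda>x. Atom (i x))"
    and less: "\<And>x. x \<in> X \<Longrightarrow> i x < length (l x)"
  shows "ptime X \<sigma> e (\<lambda>x. l x ! i x)"
proof -
  have "ptime X \<sigma> e (\<lambda>x. enc_list (drop (i x) (l x)))"
  proof (rule ptime_iter[OF i])
    show "pbd X \<sigma> i"
      by (rule pbd_mono[OF pbd_length[OF l]]) (use less in \<open>simp add: less_imp_le\<close>)
    show "ptime X \<sigma> e (\<lambda>x. enc_list (drop 0 (l x)))" using l by simp
    show "pbd (Sigma X (\<lambda>x. {..i x})) (\<lambda>z. \<sigma> (fst z)) (\<lambda>z. dsize (enc_list (drop (snd z) (l (fst z)))))"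
      by (rule pbd_mono[OF pbd_reparam[OF ptime_size(2)[OF l], where h = fst]])
         (auto simp: dsize_enc_list_drop)
    fix E assume "ptime (Sigma X (\<lambda>x. {..<i x})) (\<lambda>z. \<sigma> (fst z)) E (\<lambda>z. enc_list (drop (snd z) (l (fst z))))"
    then have "ptime (Sigma X (\<lambda>x. {..<i x})) (\<lambda>z. \<sigma> (fst z)) E
       (\<lambda>z. Cell (l (fst z) ! snd z) (enc_list (drop (Suc (snd z)) (l (fst z)))))"
      by (rule ptime_cong) (use less in \<open>auto simp: less_trans simp flip: Cons_nth_drop_Suc\<close>)
    then show "ptime (Sigma X (\<lambda>x. {..<i x})) (\<lambda>z. \<sigma> (fst z)) E (\<lambda>z. enc_list (drop (Suc (snd z)) (l (fst z))))"
      by (rule ptime_snd)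
  qed
  then have "ptime X \<sigma> e (\<lambda>x. Cell (l x ! i x) (enc_list (drop (Suc (i x)) (l x))))"
    by (rule ptime_cong) (use less in \<open>simp flip: Cons_nth_drop_Suc\<close>)
  then show ?thesis by (rule ptime_fst)
qed

lemma ptime_nth_upt:
  assumes "ptime X \<sigma> e (\<lambda>x. enc_list (map (f x) [0..<m x]))" "ptime X \<sigma> e (\<lambda>x. Atom (i x))"
    and "\<And>x. x \<in> X \<Longrightarrow> i x < m x"
  shows "ptime X \<sigma> e (\<lambda>x. f x (i x))"
  by (rule ptime_cong[OF ptime_nth[OF assms(1,2)]]) (use assms(3) in auto)

text \<open>The number of rounds is the unknown here, which rules out \<open>ptime_iter\<close>.
  Instead \<open>IsCell\<close> tests whether anything is left, and a counter is carried
  along.\<close>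

lemma ptime_length:
  assumes l: "ptime X \<sigma> e (\<lambda>x. enc_list (l x))"
  shows "ptime X \<sigma> e (\<lambda>x. Atom (length (l x)))"
proof -
  let ?Z = "Sigma X (\<lambda>x. {..<length (l x)})" and ?Z' = "Sigma X (\<lambda>x. {..length (l x)})"
  let ?\<sigma> = "\<lambda>z. \<sigma> (fst z)"
  let ?S = "\<lambda>x j. Cell (Atom j) (enc_list (drop j (l x)))"
  have len: "pbd X \<sigma> (\<lambda>x. length (l x))" by (rule pbd_length[OF l])
  have "pbd ?Z' ?\<sigma> (\<lambda>z. 1 + (1 + length (l (fst z))) + dsize (enc_list (l (fst z))))"
    by (intro pbd_arith pbd_reparam[OF len] pbd_reparam[OF ptime_size(2)[OF l]]) auto
  then have "pbd ?Z' ?\<sigma> (\<lambda>z. dsize (?S (fst z) (snd z)))"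
  proof (rule pbd_mono)
    fix z assume "z \<in> ?Z'"
    then have "snd z \<le> length (l (fst z))" by auto
    moreover have "floorlog 2 (snd z) \<le> snd z" by (simp add: floorlog2_le)
    ultimately show "dsize (?S (fst z) (snd z)) \<le> 1 + (1 + length (l (fst z))) + dsize (enc_list (l (fst z)))"
      by (simp add: add_mono dsize_enc_list_drop)
  qed
  note id' = ptime_id[OF this]
  have id: "ptime ?Z ?\<sigma> (\<lambda>z. ?S (fst z) (snd z)) (\<lambda>z. ?S (fst z) (snd z))"
    by (rule ptime_reparam[OF id', where h = "\<lambda>z. z"]) auto
  have "ptime X \<sigma> (\<lambda>x. ?S x 0) (\<lambda>x. ?S x (length (l x)))"
  proof (rule ptime_loop[OF _ _ _ len])
    have *: "apply_prim IsCell (enc_list us) = (if us = [] then Atom 0 else Atom 1)" for us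
      by (cases us) auto
    have "ptime ?Z' ?\<sigma> (\<lambda>z. enc_list (drop (snd z) (l (fst z))))
       (\<lambda>z. apply_prim IsCell (enc_list (drop (snd z) (l (fst z)))))"
      by (rule ptime_prim[OF ptime_size(2)[OF ptime_snd[OF id']]]) (rule pbd_mono[OF pbd_const[of _ _ 5]], simp add: * floorlog_def)
    then show "ptime ?Z' ?\<sigma> (\<lambda>z. ?S (fst z) (snd z)) (\<lambda>z. apply_prim IsCell (enc_list (drop (snd z) (l (fst z)))))"
      by (rule ptime_seq[OF ptime_snd[OF id']])
    show "apply_prim IsCell (enc_list (drop (snd (x, j)) (l (fst (x, j))))) \<noteq> Atom 0 \<longleftrightarrow> j < length (l x)" for x j
      by (simp add: *)
    have "ptime ?Z ?\<sigma> (\<lambda>z. ?S (fst z) (snd z)) (\<lambda>z. Cell (l (fst z) ! snd z) (enc_list (drop (Suc (snd z)) (l (fst z)))))"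
      by (rule ptime_cong[OF ptime_snd[OF id]]) (auto simp flip: Cons_nth_drop_Suc)
    then show "ptime ?Z ?\<sigma> (\<lambda>z. ?S (fst z) (snd z)) (\<lambda>z. ?S (fst z) (Suc (snd z)))"
      by (intro ptime_pair ptime_Suc ptime_fst[OF id]) (rule ptime_snd)
  qed
  then have "ptime X \<sigma> (\<lambda>x. ?S x 0) (\<lambda>x. Atom (length (l x)))" by (rule ptime_fst)
  moreover have "ptime X \<sigma> e (\<lambda>x. ?S x 0)" using ptime_pair[OF ptime_const[OF l] l] by simp
  ultimately show ?thesis by (rule ptime_seq[rotated])
qed

section \<open>Products, powers of two, binary length and bit strings\<close>

lemma ptime_prod:
  fixes f :: "'x \<Rightarrow> nat \<Rightarrow> nat"
  assumes n: "ptime X \<sigma> e (\<lambda>x. Atom (m x))" and m: "pbd X \<sigma> m"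
    and f: "\<And>E. ptime (Sigma X (\<lambda>x. {..<m x})) (\<lambda>z. \<sigma> (fst z)) E (\<lambda>z. Atom (snd z)) \<Longrightarrow>
       (\<And>f. ptime X \<sigma> e f \<Longrightarrow> ptime (Sigma X (\<lambda>x. {..<m x})) (\<lambda>z. \<sigma> (fst z)) E (\<lambda>z. f (fst z))) \<Longrightarrow>
       ptime (Sigma X (\<lambda>x. {..<m x})) (\<lambda>z. \<sigma> (fst z)) E (\<lambda>z. Atom (f (fst z) (snd z)))"
  shows "ptime X \<sigma> e (\<lambda>x. Atom (\<Prod>j<m x. f x j))"
proof -
  let ?Z = "Sigma X (\<lambda>x. {..<m x})" and ?\<sigma> = "\<lambda>z. \<sigma> (fst z)"
  \<comment> \<open>The list of all factors is built only for its size, which bounds every factor by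
    the same polynomial \<open>q\<close>. The bit lengths of the partial products then grow at most
    linearly with the round.\<close>
  have l: "ptime X \<sigma> e (\<lambda>x. enc_list (map (\<lambda>j. Atom (f x j)) [0..<m x]))"
    by (rule ptime_map_upt[OF n m f])
  obtain q where q: "\<And>x. x \<in> X \<Longrightarrow> dsize (enc_list (map (\<lambda>j. Atom (f x j)) [0..<m x])) \<le> poly q (\<sigma> x)"
    using ptime_size(2)[OF l] by (auto simp: pbd_def)
  have mem: "dsize u \<le> dsize (enc_list us)" if "u \<in> set us" for u us
    using that by (induction us) auto
  show ?thesis
  proof (rule ptime_iter[OF n m])
    show "ptime X \<sigma> e (\<lambda>x. Atom (\<Prod>j<0. f x j))" by (simp add: ptime_const[OF n])
    have "pbd (Sigma X (\<lambda>x. {..m x})) ?\<sigma> (\<lambda>z. 2 + m (fst z) * poly q (\<sigma> (fst z)))"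
      by (intro pbd_arith pbd_poly pbd_reparam[OF m]) auto
    then show "pbd (Sigma X (\<lambda>x. {..m x})) ?\<sigma> (\<lambda>z. dsize (Atom (\<Prod>j<snd z. f (fst z) j)))"
    proof (rule pbd_mono)
      fix z assume "z \<in> Sigma X (\<lambda>x. {..m x})"
      then have z: "fst z \<in> X" "snd z \<le> m (fst z)" by auto
      have "floorlog 2 (f (fst z) j) \<le> poly q (\<sigma> (fst z))" if "j < m (fst z)" for j
        using q[OF z(1)] mem[of "Atom (f (fst z) j)" "map (\<lambda>j. Atom (f (fst z) j)) [0..<m (fst z)]"] that
        by auto
      then have "i \<le> m (fst z) \<Longrightarrow> floorlog 2 (\<Prod>j<i. f (fst z) j) \<le> 1 + i * poly q (\<sigma> (fst z))" for i
      proof (induction i)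
        case (Suc i)
        then have "floorlog 2 (\<Prod>j<i. f (fst z) j) \<le> 1 + i * poly q (\<sigma> (fst z))"
          "floorlog 2 (f (fst z) i) \<le> poly q (\<sigma> (fst z))"
          using \<open>\<And>j. j < m (fst z) \<Longrightarrow> _\<close> by auto
        then show ?case
          using floorlog2_mult[of "\<Prod>j<i. f (fst z) j" "f (fst z) i"] by simp
      qed (simp add: floorlog_def)
      then have "floorlog 2 (\<Prod>j<snd z. f (fst z) j) \<le> 1 + snd z * poly q (\<sigma> (fst z))" using z by auto
      also have "\<dots> \<le> 1 + m (fst z) * poly q (\<sigma> (fst z))" using z by auto
      finally show "dsize (Atom (\<Prod>j<snd z. f (fst z) j)) \<le> 2 + m (fst z) * poly q (\<sigma> (fst z))" by simp
    qed
    fix E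
    assume "ptime ?Z ?\<sigma> E (\<lambda>z. Atom (snd z))"
      and acc: "ptime ?Z ?\<sigma> E (\<lambda>z. Atom (\<Prod>j<snd z. f (fst z) j))"
      and lift: "\<And>f. ptime X \<sigma> e f \<Longrightarrow> ptime ?Z ?\<sigma> E (\<lambda>z. f (fst z))"
    then have "ptime ?Z ?\<sigma> E (\<lambda>z. Atom (f (fst z) (snd z)))" by (intro f)
    from ptime_times[OF acc this] show "ptime ?Z ?\<sigma> E (\<lambda>z. Atom (\<Prod>j<Suc (snd z). f (fst z) j))"
      by simp
  qed
qed

lemma ptime_two_power:
  assumes n: "ptime X \<sigma> e (\<lambda>x. Atom (m x))" and m: "pbd X \<sigma> m"
  shows "ptime X \<sigma> e (\<lambda>x. Atom (2 ^ m x))"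
proof -
  have "ptime X \<sigma> e (\<lambda>x. Atom (\<Prod>j<m x. 2))"
    by (rule ptime_prod[OF n m]) (rule ptime_const)
  then show ?thesis by simp
qed

text \<open>\<open>floorlog 2 a\<close> is the least \<open>j\<close> with \<open>a < 2 ^ j\<close>,
  so the answer is the number of rounds of a doubling loop that keeps \<open>2 ^ j\<close> in its
  state.\<close>

lemma ptime_floorlog:
  assumes a: "ptime X \<sigma> e (\<lambda>x. Atom (a x))"
  shows "ptime X \<sigma> e (\<lambda>x. Atom (floorlog 2 (a x)))"
proof -
  let ?m = "\<lambda>x. floorlog 2 (a x)"
  let ?Z = "Sigma X (\<lambda>x. {..<?m x})" and ?Z' = "Sigma X (\<lambda>x. {..?m x})"
  let ?\<sigma> = "\<lambda>z. \<sigma> (fst z)"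
  let ?S = "\<lambda>x j. Cell (Atom j) (Cell (Atom (2 ^ j)) (Atom (a x)))"
  have m: "pbd X \<sigma> ?m" by (rule pbd_mono[OF ptime_size(2)[OF a]]) auto
  have "pbd ?Z' ?\<sigma> (\<lambda>z. 1 + (1 + ?m (fst z)) + (1 + (2 + ?m (fst z)) + dsize (Atom (a (fst z)))))"
    by (intro pbd_arith pbd_reparam[OF m] pbd_reparam[OF ptime_size(2)[OF a]]) auto
  then have "pbd ?Z' ?\<sigma> (\<lambda>z. dsize (?S (fst z) (snd z)))"
  proof (rule pbd_mono)
    fix z assume "z \<in> ?Z'"
    then have "snd z \<le> ?m (fst z)" by auto
    moreover have "floorlog 2 (snd z) \<le> snd z" by (simp add: floorlog2_le)
    moreover have "floorlog 2 (2 ^ snd z) \<le> Suc (snd z)" by (simp add: floorlog2_le)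
    ultimately show "dsize (?S (fst z) (snd z)) \<le> 1 + (1 + ?m (fst z)) + (1 + (2 + ?m (fst z)) + dsize (Atom (a (fst z))))"
      by simp
  qed
  note id' = ptime_id[OF this]
  have id: "ptime ?Z ?\<sigma> (\<lambda>z. ?S (fst z) (snd z)) (\<lambda>z. ?S (fst z) (snd z))"
    by (rule ptime_reparam[OF id', where h = "\<lambda>z. z"]) auto
  have "ptime X \<sigma> (\<lambda>x. ?S x 0) (\<lambda>x. ?S x (?m x))"
  proof (rule ptime_loop[OF _ _ _ m])
    show "ptime ?Z' ?\<sigma> (\<lambda>z. ?S (fst z) (snd z)) (\<lambda>z. Atom (if \<not> a (fst z) < 2 ^ snd z then 1 else 0))"
      by (intro ptime_not ptime_less ptime_fst[OF ptime_snd[OF id']] ptime_snd[OF ptime_snd[OF id']])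
    show "Atom (if \<not> a (fst (x, j)) < 2 ^ snd (x, j) then 1 else 0) \<noteq> Atom 0 \<longleftrightarrow> j < ?m x" for x j
      using floorlog2_le[of "a x" j] by auto
    have 2: "ptime ?Z ?\<sigma> (\<lambda>z. ?S (fst z) (snd z)) (\<lambda>z. Atom (2 ^ snd z))"
      by (rule ptime_fst[OF ptime_snd[OF id]])
    have "ptime ?Z ?\<sigma> (\<lambda>z. ?S (fst z) (snd z)) (\<lambda>z. Atom (2 ^ Suc (snd z)))"
      using ptime_plus[OF 2 2] by (simp add: mult_2)
    then show "ptime ?Z ?\<sigma> (\<lambda>z. ?S (fst z) (snd z)) (\<lambda>z. ?S (fst z) (Suc (snd z)))"
      by (intro ptime_pair ptime_Suc ptime_fst[OF id] ptime_snd[OF ptime_snd[OF id]])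
  qed
  then have "ptime X \<sigma> (\<lambda>x. ?S x 0) (\<lambda>x. Atom (?m x))" by (rule ptime_fst)
  moreover have "ptime X \<sigma> e (\<lambda>x. ?S x 0)" by (intro ptime_pair ptime_const[OF a] a)
  ultimately show ?thesis by (rule ptime_seq[rotated])
qed

text \<open>Most significant bit first, in Horner form: one more bit at the end is one more round of
  a loop.\<close>

definition bval :: "bool list \<Rightarrow> nat" where
  "bval = foldl (\<lambda>a c. 2 * a + (if c then 1 else 0)) 0"

lemma bval_Nil [simp]: "bval [] = 0"
  and bval_snoc [simp]: "bval (r @ [c]) = 2 * bval r + (if c then 1 else 0)"
  by (simp_all add: bval_def)

lemma bval_less: "bval r < 2 ^ length r"
  by (induction r rule: rev_induct) auto

lemma ptime_bval:
  assumes r: "ptime X \<sigma> e (\<lambda>x. enc_bits (r x))" and off: "ptime X \<sigma> e (\<lambda>x. Atom (off x))"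
    and n: "ptime X \<sigma> e (\<lambda>x. Atom (m x))"
    and len: "\<And>x. x \<in> X \<Longrightarrow> off x + m x \<le> length (r x)"
  shows "ptime X \<sigma> e (\<lambda>x. Atom (bval (take (m x) (drop (off x) (r x)))))"
proof (rule ptime_iter[OF n])
  show m: "pbd X \<sigma> m"
    by (rule pbd_mono[OF pbd_length[OF r[unfolded enc_bits_def]]]) (use len in force)
  show "ptime X \<sigma> e (\<lambda>x. Atom (bval (take 0 (drop (off x) (r x)))))"
    by (simp add: ptime_const[OF n])
  have "pbd (Sigma X (\<lambda>x. {..m x})) (\<lambda>z. \<sigma> (fst z)) (\<lambda>z. 1 + m (fst z))"
    by (intro pbd_arith pbd_reparam[OF m]) auto
  then show "pbd (Sigma X (\<lambda>x. {..m x})) (\<lambda>z. \<sigma> (fst z))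
    (\<lambda>z. dsize (Atom (bval (take (snd z) (drop (off (fst z)) (r (fst z)))))))"
  proof (rule pbd_mono)
    fix z assume z: "z \<in> Sigma X (\<lambda>x. {..m x})"
    have "floorlog 2 (bval (take (snd z) (drop (off (fst z)) (r (fst z))))) \<le> snd z"
      unfolding floorlog2_le 
      by (rule less_le_trans[OF bval_less power_increasing]) auto
    then show "dsize (Atom (bval (take (snd z) (drop (off (fst z)) (r (fst z)))))) \<le> 1 + m (fst z)"
      using z by auto
  qed
  fix E
  let ?Z = "Sigma X (\<lambda>x. {..<m x})" and ?\<sigma> = "\<lambda>z. \<sigma> (fst z)"
  let ?B = "\<lambda>z. bval (take (snd z) (drop (off (fst z)) (r (fst z))))"
  assume idx: "ptime ?Z ?\<sigma> E (\<lambda>z. Atom (snd z))"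
    and acc: "ptime ?Z ?\<sigma> E (\<lambda>z. Atom (?B z))"
    and lift: "\<And>f. ptime X \<sigma> e f \<Longrightarrow> ptime ?Z ?\<sigma> E (\<lambda>z. f (fst z))"
  have "ptime ?Z ?\<sigma> E (\<lambda>z. map (\<lambda>c. Atom (if c then 1 else 0)) (r (fst z)) ! (off (fst z) + snd z))"
    by (rule ptime_nth) (use len in \<open>force intro: lift[OF r, unfolded enc_bits_def] ptime_plus lift[OF off] idx\<close>)+
  then have "ptime ?Z ?\<sigma> E (\<lambda>z. Atom (if r (fst z) ! (off (fst z) + snd z) then 1 else 0))"
    by (rule ptime_cong) (use len in force)
  from ptime_plus[OF ptime_plus[OF acc acc] this]
  show "ptime ?Z ?\<sigma> E (\<lambda>z. Atom (bval (take (Suc (snd z)) (drop (off (fst z)) (r (fst z))))))"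
  proof (rule ptime_cong)
    fix z assume "z \<in> ?Z"
    then have z: "fst z \<in> X" "snd z < m (fst z)" by auto
    with len[of "fst z"] show "Atom (?B z + ?B z + (if r (fst z) ! (off (fst z) + snd z) then 1 else 0)) =
      Atom (bval (take (Suc (snd z)) (drop (off (fst z)) (r (fst z)))))"
      by (subst take_Suc_conv_app_nth) (auto simp: mult_2)
  qed
qed

section \<open>The algorithm\<close>

definition num :: "rat \<Rightarrow> nat" where "num q = nat (fst (quotient_of q))"
definition den :: "rat \<Rightarrow> nat" where "den q = nat (snd (quotient_of q))"

lemma enc_rat_eq: "enc_rat q = Cell (Atom (num q)) (Atom (den q))"
  by (simp add: enc_rat_def num_def den_def case_prod_unfold)

lemma enc_rat_of_nat: "enc_rat (of_nat m) = Cell (Atom m) (Atom 1)"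
  using quotient_of_int[of "int m"] by (simp add: enc_rat_def)

text \<open>
  The weights \<open>\<omega> i / x i\<close>, scaled by the product of the positive numerators of \<open>x\<close> so that they
  are integers; they vanish where \<open>x i = 0\<close> because \<open>m div 0 = 0\<close>.
\<close>

definition weight :: "nat \<Rightarrow> (nat \<Rightarrow> rat) \<Rightarrow> (nat \<Rightarrow> nat) \<Rightarrow> nat \<Rightarrow> rat" where
  "weight n x \<omega> i = (if i < n
     then of_nat (\<omega> i * den (x i) * ((\<Prod>j<n. num (x j) + (1 - num (x j))) div num (x i))) else 0)"

text \<open>
  Constants of the algorithm: each \<open>x j\<close> is rounded to \<open>precision k n\<close> bits, which costs at most
  \<open>n / 2 ^ precision k n \<le> 1 / (8 k)\<close> per estimate; the step size is \<open>1 / (4 k + 1)\<close>; the number of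
  rounds \<open>2 ^ horizon_bits k n > 10 k\<^sup>2 n\<close> is a power of two so that a uniformly random round can be
  drawn exactly.
\<close>

definition precision :: "nat \<Rightarrow> nat \<Rightarrow> nat" where "precision k n = n + k + 3"

definition horizon_bits :: "nat \<Rightarrow> nat \<Rightarrow> nat" where "horizon_bits k n = floorlog 2 (10 * k * k * n)"

text \<open>Element \<open>j\<close> compares the number in its own block of \<open>l\<close> bits
  with a threshold, so on fair bits its inclusion probability is exactly \<open>x j\<close> rounded
  down to a multiple of \<open>1 / 2 ^ l\<close> (this is \<open>rounded l x j\<close>). Disjoint
  blocks give independence.\<close>

definition sample :: "nat \<Rightarrow> nat \<Rightarrow> (nat \<Rightarrow> rat) \<Rightarrow> bool list \<Rightarrow> nat set" where
  "sample l n x r = {j. j < n \<and> bval (take l (drop (j * l) r)) < num (x j) * 2 ^ l div den (x j)}"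

text \<open>The factor is \<open>1 - h / (4 * k + 1)\<close>, where \<open>h\<close> is the sampled
  payoff, multiplied by \<open>4 * k + 1\<close> to keep the weights integral; a factor common to
  all elements does not affect the mixed strategy. One sample \<open>R\<close> serves all elements,
  but each needs its own solver call, on \<open>insert i R\<close>.\<close>

definition update ::
  "((nat \<Rightarrow> rat) \<Rightarrow> nat set \<Rightarrow> nat set) \<Rightarrow> nat \<Rightarrow> nat \<Rightarrow> (nat \<Rightarrow> rat) \<Rightarrow> (nat \<Rightarrow> nat) \<Rightarrow> nat set \<Rightarrow> nat \<Rightarrow> nat" where
  "update f k n x \<omega> R i = \<omega> i * (4 * k + 1 - (if i \<in> f (weight n x \<omega>) (insert i R) then 1 else 0))"

text \<open>Every round reads a fresh block of bits, so its sample is independent of the weights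
  being updated.\<close>

primrec iterate ::
  "((nat \<Rightarrow> rat) \<Rightarrow> nat set \<Rightarrow> nat set) \<Rightarrow> nat \<Rightarrow> nat \<Rightarrow> (nat \<Rightarrow> rat) \<Rightarrow> bool list \<Rightarrow> nat \<Rightarrow> nat \<Rightarrow> nat" where
  "iterate f k n x r 0 = (\<lambda>_. 1)"
| "iterate f k n x r (Suc t) = update f k n x (iterate f k n x r t)
     (sample (precision k n) n x (drop (t * (n * precision k n)) r))"

text \<open>The leading bits draw the round to be output, and only the rounds before it are
  simulated on the remaining bits.\<close>

definition final_weight ::
  "((nat \<Rightarrow> rat) \<Rightarrow> nat set \<Rightarrow> nat set) \<Rightarrow> nat \<Rightarrow> nat \<Rightarrow> (nat \<Rightarrow> rat) \<Rightarrow> bool list \<Rightarrow> nat \<Rightarrow> rat" where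
  "final_weight f k n x r = weight n x
     (iterate f k n x (drop (horizon_bits k n) r) (bval (take (horizon_bits k n) r)))"

text \<open>Provides for the latest round that can be drawn, because the number of random bits has
  to be fixed before any of them is read.\<close>

definition bits_used :: "nat \<Rightarrow> nat \<Rightarrow> nat" where
  "bits_used k n = horizon_bits k n + 2 ^ horizon_bits k n * (n * precision k n)"

definition support :: "nat \<Rightarrow> (nat \<Rightarrow> rat) \<Rightarrow> nat set" where
  "support n x = {i. i < n \<and> 0 < num (x i)}"

section \<open>Size bounds and running time of the algorithm\<close>

lemma weight_nonneg: "0 \<le> weight n x \<omega> i"
  by (simp add: weight_def)

text \<open>The weights may become exponentially large, but after polynomially many rounds their bit
  length is still polynomial.\<close>

lemma iterate_le: "iterate f k n x r t i \<le> (4 * k + 1) ^ t"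
proof (induction t)
  case (Suc t)
  have "iterate f k n x r (Suc t) i \<le> iterate f k n x r t i * (4 * k + 1)"
    by (simp add: update_def)
  also have "\<dots> \<le> (4 * k + 1) ^ t * (4 * k + 1)" using Suc by (rule mult_right_mono) simp
  finally show ?case by (simp add: mult.commute)
qed simp

text \<open>Passing to the next power of two at most doubles the horizon; the summand 1 covers the
  case that the product is 0.\<close>

lemma two_power_horizon_bits_le: "2 ^ horizon_bits k n \<le> 20 * k * k * n + 1"
proof (cases "10 * k * k * n = 0")
  case True
  then show ?thesis by (simp only: horizon_bits_def True) (simp add: floorlog_def)
next
  case False
  then show ?thesis
    using floorlog_bounds[of "10 * k * k * n" 2] unfolding horizon_bits_def
    by (cases "floorlog 2 (10 * k * k * n)") auto
qed

text \<open>The layout of the input stays abstract: the environment only has to yield the instance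
  code, the accuracy, the point, the set and the bits. \<open>k_bound\<close> is about the value of
  \<open>k\<close>, because the number of rounds grows with its square.\<close>

locale solver_context =
  fixes W :: "data set" and n :: "data \<Rightarrow> nat" and \<I> \<phi>
    and X :: "'x set" and \<sigma> :: "'x \<Rightarrow> nat" and e :: "'x \<Rightarrow> data" and w :: "'x \<Rightarrow> data"
    and k :: "'x \<Rightarrow> nat" and y :: "'x \<Rightarrow> nat \<Rightarrow> rat" and A :: "'x \<Rightarrow> nat set" and r :: "'x \<Rightarrow> bool list"
  assumes solver: "poly_time_max_weight W n \<I> \<phi>"
    and w: "ptime X \<sigma> e w" and W: "\<And>x. x \<in> X \<Longrightarrow> w x \<in> W"
    and k: "ptime X \<sigma> e (\<lambda>x. Atom (k x))" and k_bound: "pbd X \<sigma> k"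
    and y: "ptime X \<sigma> e (\<lambda>x. enc_vec (n (w x)) (y x))"
    and A: "ptime X \<sigma> e (\<lambda>x. enc_set (n (w x)) (A x))" and A_sub: "\<And>x. x \<in> X \<Longrightarrow> A x \<subseteq> {..<n (w x)}"
    and r: "ptime X \<sigma> e (\<lambda>x. enc_bits (r x))"
    and r_len: "\<And>x. x \<in> X \<Longrightarrow> bits_used (k x) (n (w x)) \<le> length (r x)"
begin

abbreviation "nn x \<equiv> n (w x)"

text \<open>Stated for an arbitrary index set and environment, since the solver is called inside the
  loops over rounds and elements as well as once at the end.\<close>

lemma ptime_solver:
  assumes "ptime Y \<tau> E w'" "ptime Y \<tau> E (\<lambda>z. enc_vec (n (w' z)) (c z))"
    "ptime Y \<tau> E (\<lambda>z. enc_set (n (w' z)) (B z))"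
    and dom: "\<And>z. z \<in> Y \<Longrightarrow> w' z \<in> W \<and> (\<forall>i<n (w' z). 0 \<le> c z i) \<and> B z \<subseteq> {..<n (w' z)}"
  shows "ptime Y \<tau> E (\<lambda>z. enc_set (n (w' z)) (\<phi> (w' z) (c z) (B z)))"
proof (rule ptime_seq)
  obtain p T where run: "\<forall>w\<in>W. \<forall>y A. (\<forall>i<n w. 0 \<le> y i) \<and> A \<subseteq> {..<n w} \<longrightarrow>
      (\<exists>t \<le> poly T (dsize (query (n w) w y A)). run p (query (n w) w y A) t (enc_set (n w) (\<phi> w y A)))"
    using solver by (auto simp: poly_time_max_weight_def)
  show query: "ptime Y \<tau> E (\<lambda>z. query (n (w' z)) (w' z) (c z) (B z))"
    unfolding query_def by (intro ptime_pair assms)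
  show "ptime Y \<tau> (\<lambda>z. query (n (w' z)) (w' z) (c z) (B z)) (\<lambda>z. enc_set (n (w' z)) (\<phi> (w' z) (c z) (B z)))"
  proof (rule ptimeI[OF pbd_compose[OF ptime_size(2)[OF query]]])
    fix z assume "z \<in> Y"
    from dom[OF this] show "\<exists>t\<le>poly T (dsize (query (n (w' z)) (w' z) (c z) (B z))).
      run p (query (n (w' z)) (w' z) (c z) (B z)) t (enc_set (n (w' z)) (\<phi> (w' z) (c z) (B z)))"
      using run by blast
  qed
qed

lemma nn: "ptime X \<sigma> e (\<lambda>x. Atom (nn x))"
  using ptime_length[OF y[unfolded enc_vec_def]] by simp

lemma nn_bound: "pbd X \<sigma> nn"
  using pbd_length[OF y[unfolded enc_vec_def]] by simp

lemma precision: "ptime X \<sigma> e (\<lambda>x. Atom (precision (k x) (nn x)))"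
  and precision_bound: "pbd X \<sigma> (\<lambda>x. precision (k x) (nn x))"
  unfolding precision_def by (intro ptime_plus nn k ptime_const[OF k] pbd_arith nn_bound k_bound)+

lemma horizon: "ptime X \<sigma> e (\<lambda>x. Atom (horizon_bits (k x) (nn x)))"
  unfolding horizon_bits_def by (intro ptime_floorlog ptime_times nn k ptime_const[OF k])

lemma horizon_bound: "pbd X \<sigma> (\<lambda>x. 2 ^ horizon_bits (k x) (nn x))"
  by (rule pbd_mono[OF _ two_power_horizon_bits_le]) (intro pbd_arith nn_bound k_bound)

definition steps :: "'x \<Rightarrow> nat" where "steps x = bval (take (horizon_bits (k x) (nn x)) (r x))"

lemma steps_less: "steps x < 2 ^ horizon_bits (k x) (nn x)"
  unfolding steps_def by (rule less_le_trans[OF bval_less power_increasing]) auto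

lemma steps: "ptime X \<sigma> e (\<lambda>x. Atom (steps x))"
proof -
  have "0 + horizon_bits (k x) (nn x) \<le> length (r x)" if "x \<in> X" for x
    using r_len[OF that] by (simp add: bits_used_def)
  from ptime_bval[OF r ptime_const[OF k] horizon this] show ?thesis
    by (simp add: steps_def)
qed

lemma steps_bound: "pbd X \<sigma> steps"
  by (rule pbd_mono[OF horizon_bound]) (simp add: steps_less less_imp_le)

abbreviation "iter x t \<equiv> iterate (\<phi> (w x)) (k x) (nn x) (y x) (drop (horizon_bits (k x) (nn x)) (r x)) t"

lemma ptime_num_den:
  assumes y': "ptime Y \<tau> E (\<lambda>z. enc_vec (m z) (y' z))" and i: "ptime Y \<tau> E (\<lambda>z. Atom (i z))"
    and less: "\<And>z. z \<in> Y \<Longrightarrow> i z < m z"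
  shows "ptime Y \<tau> E (\<lambda>z. Atom (num (y' z (i z))))" "ptime Y \<tau> E (\<lambda>z. Atom (den (y' z (i z))))"
proof -
  have "ptime Y \<tau> E (\<lambda>z. enc_rat (y' z (i z)))"
    by (rule ptime_nth_upt[OF y'[unfolded enc_vec_def] i less])
  then show "ptime Y \<tau> E (\<lambda>z. Atom (num (y' z (i z))))" "ptime Y \<tau> E (\<lambda>z. Atom (den (y' z (i z))))"
    unfolding enc_rat_eq by (rule ptime_fst, rule ptime_snd)
qed

lemma ptime_mem:
  assumes B: "ptime Y \<tau> E (\<lambda>z. enc_set (m z) (B z))" and i: "ptime Y \<tau> E (\<lambda>z. Atom (i z))"
    and less: "\<And>z. z \<in> Y \<Longrightarrow> i z < m z"
  shows "ptime Y \<tau> E (\<lambda>z. Atom (if i z \<in> B z then 1 else 0))"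
  by (rule ptime_nth_upt[OF B[unfolded enc_set_def] i less])

lemma ptime_weight:
  assumes n: "ptime Y \<tau> E (\<lambda>z. Atom (m z))" and m: "pbd Y \<tau> m"
    and y': "ptime Y \<tau> E (\<lambda>z. enc_vec (m z) (y' z))"
    and \<omega>: "ptime Y \<tau> E (\<lambda>z. enc_list (map (\<lambda>i. Atom (\<omega> z i)) [0..<m z]))"
  shows "ptime Y \<tau> E (\<lambda>z. enc_vec (m z) (weight (m z) (y' z) (\<omega> z)))"
proof -
  have M: "ptime Y \<tau> E (\<lambda>z. Atom (\<Prod>j<m z. num (y' z j) + (1 - num (y' z j))))"
    by (intro ptime_prod[OF n m] ptime_plus ptime_minus ptime_num_den[where m = "\<lambda>z. m (fst z)"])
       (auto intro: ptime_const y')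
  have "ptime Y \<tau> E (\<lambda>z. enc_list (map (\<lambda>i. Cell (Atom (\<omega> z i * den (y' z i) *
      ((\<Prod>j<m z. num (y' z j) + (1 - num (y' z j))) div num (y' z i)))) (Atom 1)) [0..<m z]))"
  proof (rule ptime_map_upt[OF n m])
    fix E'
    let ?Z = "Sigma Y (\<lambda>z. {..<m z})" and ?\<tau> = "\<lambda>z. \<tau> (fst z)"
    assume idx: "ptime ?Z ?\<tau> E' (\<lambda>z. Atom (snd z))"
      and lift: "\<And>f. ptime Y \<tau> E f \<Longrightarrow> ptime ?Z ?\<tau> E' (\<lambda>z. f (fst z))"
    have less: "\<And>z. z \<in> ?Z \<Longrightarrow> snd z < m (fst z)" by auto
    note nd = ptime_num_den[OF lift[OF y'] idx less]
    show "ptime ?Z ?\<tau> E' (\<lambda>z. Cell (Atom (\<omega> (fst z) (snd z) * den (y' (fst z) (snd z)) *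
      ((\<Prod>j<m (fst z). num (y' (fst z) j) + (1 - num (y' (fst z) j))) div num (y' (fst z) (snd z))))) (Atom 1))"
      by (intro ptime_pair ptime_times ptime_div nd lift[OF M] ptime_const[OF idx]
          ptime_nth_upt[OF lift[OF \<omega>] idx less])
  qed
  then show ?thesis
    by (rule ptime_cong)
      (auto simp: enc_vec_def weight_def enc_rat_of_nat simp del: of_nat_mult of_nat_prod of_nat_add
        intro!: arg_cong[of _ _ enc_list])
qed

text \<open>Three nested loops, over rounds, over the elements to be updated, and over the
  membership bits of the set handed to the solver. Their index sets \<open>?Z\<close>,
  \<open>?ZZ\<close> and \<open>?ZZZ\<close> each add one coordinate, and all bounds remain
  polynomials in \<open>\<sigma>\<close> of the innermost first component.\<close>

lemma ptime_iterate: "ptime X \<sigma> e (\<lambda>x. enc_list (map (\<lambda>i. Atom (iter x (steps x) i)) [0..<nn x]))"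
proof (rule ptime_iter[OF steps steps_bound])
  show "ptime X \<sigma> e (\<lambda>x. enc_list (map (\<lambda>i. Atom (iter x 0 i)) [0..<nn x]))"
    by (rule ptime_map_upt[OF nn nn_bound]) (simp add: ptime_const)
  let ?Z = "Sigma X (\<lambda>x. {..<steps x})" and ?\<sigma> = "\<lambda>z. \<sigma> (fst z)"
  let ?B = "\<lambda>x. 1 + nn x * (1 + (1 + (1 + (4 * k x + 1) * 2 ^ horizon_bits (k x) (nn x))))"
  have "pbd X \<sigma> ?B" by (intro pbd_arith nn_bound k_bound horizon_bound)
  then have "pbd (Sigma X (\<lambda>x. {..steps x})) ?\<sigma> (\<lambda>z. ?B (fst z))"
    by (rule pbd_reparam) auto
  then show "pbd (Sigma X (\<lambda>x. {..steps x})) ?\<sigma>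
     (\<lambda>z. dsize (enc_list (map (\<lambda>i. Atom (iter (fst z) (snd z) i)) [0..<nn (fst z)])))"
  proof (rule pbd_mono)
    fix z assume "z \<in> Sigma X (\<lambda>x. {..steps x})"
    then have z: "snd z \<le> 2 ^ horizon_bits (k (fst z)) (nn (fst z))"
      using steps_less[of "fst z"] by auto
    let ?K = "4 * k (fst z) + 1"
    have "dsize (enc_list (map (\<lambda>i. Atom (iter (fst z) (snd z) i)) [0..<nn (fst z)]))
      \<le> 1 + length (map (\<lambda>i. Atom (iter (fst z) (snd z) i)) [0..<nn (fst z)]) *
          (1 + (1 + (1 + ?K * 2 ^ horizon_bits (k (fst z)) (nn (fst z)))))"
    proof (rule dsize_enc_list_le)
      fix u assume "u \<in> set (map (\<lambda>i. Atom (iter (fst z) (snd z) i)) [0..<nn (fst z)])"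
      then obtain i where u: "u = Atom (iter (fst z) (snd z) i)" by auto
      have "iter (fst z) (snd z) i \<le> ?K ^ snd z" by (rule iterate_le)
      \<comment> \<open>Replacing the base \<open>?K\<close> by \<open>2 ^ ?K\<close> is crude, but
        it leaves a power of two whose exponent is polynomial.\<close>
      also have "\<dots> \<le> (2 ^ ?K) ^ snd z" by (intro power_mono less_imp_le less_exp) auto
      also have "\<dots> < 2 ^ (1 + ?K * snd z)" by (simp only: flip: power_mult) simp
      finally have "floorlog 2 (iter (fst z) (snd z) i) \<le> 1 + ?K * snd z" by (simp only: floorlog2_le)
      also have "\<dots> \<le> 1 + ?K * 2 ^ horizon_bits (k (fst z)) (nn (fst z))"
        by (intro add_left_mono mult_left_mono z) auto
      finally show "dsize u \<le> 1 + (1 + ?K * 2 ^ horizon_bits (k (fst z)) (nn (fst z)))" by (simp add: u)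
    qed
    then show "dsize (enc_list (map (\<lambda>i. Atom (iter (fst z) (snd z) i)) [0..<nn (fst z)])) \<le> ?B (fst z)"
      by simp
  qed
  fix E
  assume idx: "ptime ?Z ?\<sigma> E (\<lambda>z. Atom (snd z))"
    and acc: "ptime ?Z ?\<sigma> E (\<lambda>z. enc_list (map (\<lambda>i. Atom (iter (fst z) (snd z) i)) [0..<nn (fst z)]))"
    and lift: "\<And>f. ptime X \<sigma> e f \<Longrightarrow> ptime ?Z ?\<sigma> E (\<lambda>z. f (fst z))"
  let ?l = "\<lambda>z. precision (k (fst z)) (nn (fst z))"
  let ?off = "\<lambda>z. horizon_bits (k (fst z)) (nn (fst z)) + snd z * (nn (fst z) * ?l z)"
  let ?R = "\<lambda>z. sample (?l z) (nn (fst z)) (y (fst z)) (drop (?off z) (r (fst z)))"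
  have mZ: "pbd ?Z ?\<sigma> (\<lambda>z. nn (fst z))" by (rule pbd_reparam[OF nn_bound]) auto
  have lZ: "pbd ?Z ?\<sigma> ?l" by (rule pbd_reparam[OF precision_bound]) auto
  have weight: "ptime ?Z ?\<sigma> E (\<lambda>z. enc_vec (nn (fst z)) (weight (nn (fst z)) (y (fst z)) (iter (fst z) (snd z))))"
    by (rule ptime_weight[OF lift[OF nn] mZ lift[OF y] acc])
  let ?ZZ = "Sigma ?Z (\<lambda>z. {..<nn (fst z)})" and ?\<sigma>\<sigma> = "\<lambda>z. \<sigma> (fst (fst z))"
  have sample: "ptime ?Z ?\<sigma> E (\<lambda>z. enc_set (nn (fst z)) (?R z))"
  proof -
    have "ptime ?Z ?\<sigma> E (\<lambda>z. enc_list (map (\<lambda>j. Atom (if bval (take (?l z) (drop (?off z + j * ?l z) (r (fst z))))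
      < num (y (fst z) j) * 2 ^ ?l z div den (y (fst z) j) then 1 else 0)) [0..<nn (fst z)]))"
    proof (rule ptime_map_upt[OF lift[OF nn] mZ])
      fix F
      assume idx2: "ptime ?ZZ ?\<sigma>\<sigma> F (\<lambda>z. Atom (snd z))"
        and lift2: "\<And>f. ptime ?Z ?\<sigma> E f \<Longrightarrow> ptime ?ZZ ?\<sigma>\<sigma> F (\<lambda>z. f (fst z))"
      have less: "\<And>z. z \<in> ?ZZ \<Longrightarrow> snd z < nn (fst (fst z))" by auto
      \<comment> \<open>The block of the last element in the last simulated round still lies within
        \<open>r\<close>, as \<open>bits_used\<close> reserves bits for all rounds below the
        horizon.\<close>
      have len: "?off (fst z) + snd z * ?l (fst z) + ?l (fst z) \<le> length (r (fst (fst z)))" if "z \<in> ?ZZ" for z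
      proof -
        let ?n = "nn (fst (fst z))"
        have z: "fst (fst z) \<in> X" "snd (fst z) < steps (fst (fst z))" "snd z < ?n"
          using that by auto
        have "?off (fst z) + snd z * ?l (fst z) + ?l (fst z)
          = horizon_bits (k (fst (fst z))) ?n + (snd (fst z) * (?n * ?l (fst z)) + Suc (snd z) * ?l (fst z))"
          by simp
        also have "Suc (snd z) * ?l (fst z) \<le> ?n * ?l (fst z)"
          by (rule mult_right_mono) (use z in auto)
        also have "snd (fst z) * (?n * ?l (fst z)) + ?n * ?l (fst z) = Suc (snd (fst z)) * (?n * ?l (fst z))" by simp
        also have "\<dots> \<le> 2 ^ horizon_bits (k (fst (fst z))) ?n * (?n * ?l (fst z))"
          by (rule mult_right_mono) (use z steps_less[of "fst (fst z)"] in auto)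
        finally show ?thesis
          using r_len[OF z(1)] by (simp add: bits_used_def)
      qed
      note nd = ptime_num_den[OF lift2[OF lift[OF y]] idx2 less]
      show "ptime ?ZZ ?\<sigma>\<sigma> F (\<lambda>z. Atom (if bval (take (?l (fst z)) (drop (?off (fst z) + snd z * ?l (fst z)) (r (fst (fst z)))))
         < num (y (fst (fst z)) (snd z)) * 2 ^ ?l (fst z) div den (y (fst (fst z)) (snd z)) then 1 else 0))"
        by (intro ptime_less ptime_bval ptime_div ptime_times nd ptime_two_power ptime_plus 
            lift2[OF lift[OF precision]] lift2[OF lift[OF nn]] lift2[OF idx] idx2
            lift2[OF lift[OF horizon]] lift2[OF lift[OF r]] len pbd_reparam[OF lZ]) auto
    qed
    then show ?thesis
      by (rule ptime_cong) (auto simp: enc_set_def sample_def add.commute intro!: arg_cong[of _ _ enc_list])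
  qed
  have "ptime ?Z ?\<sigma> E (\<lambda>z. enc_list (map (\<lambda>i. Atom (update (\<phi> (w (fst z))) (k (fst z)) (nn (fst z)) (y (fst z))
      (iter (fst z) (snd z)) (?R z) i)) [0..<nn (fst z)]))"
  proof (rule ptime_map_upt[OF lift[OF nn] mZ])
    fix F
    assume idx2: "ptime ?ZZ ?\<sigma>\<sigma> F (\<lambda>z. Atom (snd z))"
      and lift2: "\<And>f. ptime ?Z ?\<sigma> E f \<Longrightarrow> ptime ?ZZ ?\<sigma>\<sigma> F (\<lambda>z. f (fst z))"
    have less: "\<And>z. z \<in> ?ZZ \<Longrightarrow> snd z < nn (fst (fst z))" by auto
    let ?ZZZ = "Sigma ?ZZ (\<lambda>z. {..<nn (fst (fst z))})" and ?\<sigma>3 = "\<lambda>z. \<sigma> (fst (fst (fst z)))"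
    have "ptime ?ZZ ?\<sigma>\<sigma> F (\<lambda>z. enc_list (map (\<lambda>j. Atom (if j = snd z \<or> j \<in> ?R (fst z) then 1 else 0)) [0..<nn (fst (fst z))]))"
    proof (rule ptime_map_upt[OF lift2[OF lift[OF nn]]])
      show "pbd ?ZZ ?\<sigma>\<sigma> (\<lambda>z. nn (fst (fst z)))" by (rule pbd_reparam[OF mZ]) auto
      fix G
      assume idx3: "ptime ?ZZZ ?\<sigma>3 G (\<lambda>z. Atom (snd z))"
        and lift3: "\<And>f. ptime ?ZZ ?\<sigma>\<sigma> F f \<Longrightarrow> ptime ?ZZZ ?\<sigma>3 G (\<lambda>z. f (fst z))"
      show "ptime ?ZZZ ?\<sigma>3 G (\<lambda>z. Atom (if snd z = snd (fst z) \<or> snd z \<in> ?R (fst (fst z)) then 1 else 0))"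
        by (intro ptime_or ptime_eq idx3 lift3[OF idx2] ptime_mem[OF lift3[OF lift2[OF sample]] idx3]) auto
    qed
    then have insert: "ptime ?ZZ ?\<sigma>\<sigma> F (\<lambda>z. enc_set (nn (fst (fst z))) (insert (snd z) (?R (fst z))))"
      by (rule ptime_cong) (simp add: enc_set_def)
    have "ptime ?ZZ ?\<sigma>\<sigma> F (\<lambda>z. enc_set (nn (fst (fst z))) (\<phi> (w (fst (fst z)))
      (weight (nn (fst (fst z))) (y (fst (fst z))) (iter (fst (fst z)) (snd (fst z)))) (insert (snd z) (?R (fst z)))))"
      by (rule ptime_solver[OF lift2[OF lift[OF w]] lift2[OF weight] insert])
         (auto simp: W weight_nonneg sample_def)
    from ptime_mem[OF this idx2 less]
    show "ptime ?ZZ ?\<sigma>\<sigma> F (\<lambda>z. Atom (update (\<phi> (w (fst (fst z)))) (k (fst (fst z))) (nn (fst (fst z))) (y (fst (fst z)))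
      (iter (fst (fst z)) (snd (fst z))) (?R (fst z)) (snd z)))"
      unfolding update_def
      by (intro ptime_times ptime_minus ptime_plus ptime_const[OF idx2] lift2[OF lift[OF k]]
          ptime_nth_upt[OF lift2[OF acc] idx2 less])
  qed
  then show "ptime ?Z ?\<sigma> E (\<lambda>z. enc_list (map (\<lambda>i. Atom (iter (fst z) (Suc (snd z)) i)) [0..<nn (fst z)]))"
    by (rule ptime_cong) (simp add: add.commute)
qed

lemma ptime_output:
  "ptime X \<sigma> e (\<lambda>x. enc_set (nn x) (\<phi> (w x) (final_weight (\<phi> (w x)) (k x) (nn x) (y x) (r x))
     (A x \<inter> support (nn x) (y x))))"
proof (rule ptime_solver[OF w])
  show "ptime X \<sigma> e (\<lambda>x. enc_vec (nn x) (final_weight (\<phi> (w x)) (k x) (nn x) (y x) (r x)))"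
    unfolding final_weight_def steps_def[symmetric]
    by (rule ptime_weight[OF nn nn_bound y ptime_iterate])
  let ?Z = "Sigma X (\<lambda>x. {..<nn x})" and ?\<sigma> = "\<lambda>z. \<sigma> (fst z)"
  have "ptime X \<sigma> e (\<lambda>x. enc_list (map (\<lambda>j. Atom (if j \<in> A x \<and> 0 < num (y x j) then 1 else 0)) [0..<nn x]))"
  proof (rule ptime_map_upt[OF nn nn_bound])
    fix E
    assume idx: "ptime ?Z ?\<sigma> E (\<lambda>z. Atom (snd z))"
      and lift: "\<And>f. ptime X \<sigma> e f \<Longrightarrow> ptime ?Z ?\<sigma> E (\<lambda>z. f (fst z))"
    have less: "\<And>z. z \<in> ?Z \<Longrightarrow> snd z < nn (fst z)" by auto
    show "ptime ?Z ?\<sigma> E (\<lambda>z. Atom (if snd z \<in> A (fst z) \<and> 0 < num (y (fst z) (snd z)) then 1 else 0))"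
      by (intro ptime_and ptime_less ptime_mem[OF lift[OF A] idx less] ptime_const[OF idx]
          ptime_num_den(1)[OF lift[OF y] idx less])
  qed
  then show "ptime X \<sigma> e (\<lambda>x. enc_set (nn x) (A x \<inter> support (nn x) (y x)))"
    by (rule ptime_cong) (auto simp: enc_set_def support_def intro!: arg_cong[of _ _ enc_list])
qed (use W A_sub in \<open>auto simp: final_weight_def weight_nonneg\<close>)

end

section \<open>Expectations over finitely supported distributions\<close>

lemma expectation_bind_finite:
  fixes h :: "'b \<Rightarrow> real"
  assumes "finite (set_pmf p)" "\<And>x. x \<in> set_pmf p \<Longrightarrow> finite (set_pmf (f x))"
  shows "measure_pmf.expectation (bind_pmf p f) h =
    measure_pmf.expectation p (\<lambda>x. measure_pmf.expectation (f x) h)"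
  using assms by (simp add: pmf_expectation_bind[where A = "set_pmf p"] integral_measure_pmf[where A = "set_pmf p"])

lemma expectation_mono_finite:
  fixes f g :: "'b \<Rightarrow> real"
  assumes "finite (set_pmf p)" "\<And>x. x \<in> set_pmf p \<Longrightarrow> f x \<le> g x"
  shows "measure_pmf.expectation p f \<le> measure_pmf.expectation p g"
  using assms by (intro integral_mono_AE) (auto simp: AE_measure_pmf_iff intro: integrable_measure_pmf_finite)

lemma expectation_cong_pmf:
  fixes f g :: "'b \<Rightarrow> real"
  assumes "\<And>x. x \<in> set_pmf p \<Longrightarrow> f x = g x"
  shows "measure_pmf.expectation p f = measure_pmf.expectation p g"
  using assms by (intro integral_cong_AE) (auto simp: AE_measure_pmf_iff)

section \<open>Multiplicative weights in expectation\<close>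

text \<open>
  The potential \<open>ln (\<Sum>i. wt i)\<close> drops (relative to \<open>T ln (K + 1)\<close>) by at least \<open>c / (K + 1)\<close> per
  step in expectation, while \<open>ln (wt i)\<close> drops by at most \<open>h / K\<close>. Since only expected gains enter, a
  single random sample per step is enough and no concentration inequality is needed.
\<close>

lemma multiplicative_weights:
  fixes \<Omega> :: "nat \<Rightarrow> 's pmf" and D :: "'b pmf" and wt :: "'s \<Rightarrow> 'a \<Rightarrow> real"
    and h :: "'s \<Rightarrow> 'b \<Rightarrow> 'a \<Rightarrow> real" and K c :: real
  assumes I: "finite I" and i: "i \<in> I" and D: "finite (set_pmf D)" and K: "K > 0"
    and start: "\<Omega> 0 = return_pmf s" "\<And>j. j \<in> I \<Longrightarrow> wt s j = 1"
    and step: "\<And>t. \<Omega> (Suc t) = bind_pmf (\<Omega> t) (\<lambda>s. map_pmf (up s) D)"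
    and up: "\<And>s b j. b \<in> set_pmf D \<Longrightarrow> j \<in> I \<Longrightarrow> wt (up s b) j = wt s j * (K + 1 - h s b j)"
    and h: "\<And>s b j. b \<in> set_pmf D \<Longrightarrow> j \<in> I \<Longrightarrow> 0 \<le> h s b j \<and> h s b j \<le> 1"
    and best: "\<And>s. (\<And>j. j \<in> I \<Longrightarrow> 0 < wt s j) \<Longrightarrow>
       c * (\<Sum>j\<in>I. wt s j) \<le> (\<Sum>j\<in>I. wt s j * measure_pmf.expectation D (\<lambda>b. h s b j))"
  shows "c * T \<le> (1 + 1 / K) * (\<Sum>t<T. measure_pmf.expectation (\<Omega> t) (\<lambda>s. measure_pmf.expectation D (\<lambda>b. h s b i)))
    + (K + 1) * ln (card I)"
proof -
  have fin: "finite (set_pmf (\<Omega> t))" for t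
    by (induction t) (auto simp: start step D)
  have int: "integrable (measure_pmf D) f" "integrable (measure_pmf (\<Omega> t)) g" for f :: "'b \<Rightarrow> real" and t and g :: "'s \<Rightarrow> real"
    using D fin by (auto intro: integrable_measure_pmf_finite)
  have pos: "0 < wt s j" if "s \<in> set_pmf (\<Omega> t)" "j \<in> I" for s t j
    using that
  proof (induction t arbitrary: s)
    case (Suc t)
    then obtain s' b where "s' \<in> set_pmf (\<Omega> t)" "b \<in> set_pmf D" "s = up s' b"
      by (auto simp: step)
    moreover have "0 < K + 1 - h s' b j"
      using h[of b j s'] K \<open>b \<in> set_pmf D\<close> Suc.prems by auto
    ultimately show ?case
      using Suc by (simp add: up)
  qed (auto simp: start)
  define \<Phi> where "\<Phi> s = (\<Sum>j\<in>I. wt s j)" for s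
  define a where "a t = measure_pmf.expectation (\<Omega> t) (\<lambda>s. ln (\<Phi> s))" for t
  define l where "l t = measure_pmf.expectation (\<Omega> t) (\<lambda>s. ln (wt s i))" for t
  define H where "H t = measure_pmf.expectation (\<Omega> t) (\<lambda>s. measure_pmf.expectation D (\<lambda>b. h s b i))" for t
  have \<Phi>_pos: "0 < \<Phi> s" if "s \<in> set_pmf (\<Omega> t)" for s t
    unfolding \<Phi>_def using I i pos[OF that] by (intro sum_pos) auto
  have E_step: "measure_pmf.expectation (\<Omega> (Suc t)) f =
      measure_pmf.expectation (\<Omega> t) (\<lambda>s. measure_pmf.expectation D (\<lambda>b. f (up s b)))" for t and f :: "'s \<Rightarrow> real"
    unfolding step by (subst expectation_bind_finite) (use fin D in auto)
  have a_step: "a (Suc t) \<le> a t + (ln (K + 1) - c / (K + 1))" for t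
  proof -
    have "measure_pmf.expectation D (\<lambda>b. ln (\<Phi> (up s b))) \<le> ln (\<Phi> s) + (ln (K + 1) - c / (K + 1))"
      if s: "s \<in> set_pmf (\<Omega> t)" for s
    proof -
      have "ln (\<Phi> (up s b)) \<le> ln (\<Phi> s) + ln (K + 1) - (\<Sum>j\<in>I. wt s j * h s b j) / (\<Phi> s * (K + 1))"
        if b: "b \<in> set_pmf D" for b
      proof -
        have eq: "\<Phi> (up s b) = \<Phi> s * (K + 1) - (\<Sum>j\<in>I. wt s j * h s b j)"
          unfolding \<Phi>_def sum_distrib_right sum_subtractf[symmetric]
          by (intro sum.cong refl) (simp add: up[OF b] right_diff_distrib)
        have "up s b \<in> set_pmf (\<Omega> (Suc t))" using s b by (auto simp: step)
        \<comment> \<open>The tangent bound ln u - ln v <= (u - v) / v makes the drop linear in the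
          payoffs \<open>h\<close>, so that taking expectations brings it into the form of
          \<open>best\<close>.\<close>
        then have "ln (\<Phi> (up s b)) - ln (\<Phi> s * (K + 1)) \<le> (\<Phi> (up s b) - \<Phi> s * (K + 1)) / (\<Phi> s * (K + 1))"
          using \<Phi>_pos[OF s] K by (intro ln_diff_le \<Phi>_pos) auto
        moreover have "(\<Phi> (up s b) - \<Phi> s * (K + 1)) / (\<Phi> s * (K + 1)) = - ((\<Sum>j\<in>I. wt s j * h s b j) / (\<Phi> s * (K + 1)))"
          by (simp only: eq) simp
        moreover have "ln (\<Phi> s * (K + 1)) = ln (\<Phi> s) + ln (K + 1)"
          using \<Phi>_pos[OF s] K by (simp add: ln_mult)
        ultimately show ?thesis by linarith
      qed
      then have "measure_pmf.expectation D (\<lambda>b. ln (\<Phi> (up s b))) \<le>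
         measure_pmf.expectation D (\<lambda>b. ln (\<Phi> s) + ln (K + 1) - (\<Sum>j\<in>I. wt s j * h s b j) / (\<Phi> s * (K + 1)))"
        by (intro expectation_mono_finite D)
      also have "\<dots> = ln (\<Phi> s) + ln (K + 1) - (\<Sum>j\<in>I. wt s j * measure_pmf.expectation D (\<lambda>b. h s b j)) / (\<Phi> s * (K + 1))"
      proof -
        have "measure_pmf.expectation D (\<lambda>b. \<Sum>j\<in>I. wt s j * h s b j)
          = (\<Sum>j\<in>I. wt s j * measure_pmf.expectation D (\<lambda>b. h s b j))"
          by (subst Bochner_Integration.integral_sum) (simp_all add: int)
        then show ?thesis
          by (subst Bochner_Integration.integral_diff) (simp_all add: int)
      qed
      also have "\<dots> \<le> ln (\<Phi> s) + (ln (K + 1) - c / (K + 1))"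
      proof -
        have "c / (K + 1) = c * \<Phi> s / (\<Phi> s * (K + 1))"
          using \<Phi>_pos[OF s] by simp
        also have "\<dots> \<le> (\<Sum>j\<in>I. wt s j * measure_pmf.expectation D (\<lambda>b. h s b j)) / (\<Phi> s * (K + 1))"
          using best[of s] pos[OF s] \<Phi>_pos[OF s] K by (intro divide_right_mono) (auto simp: \<Phi>_def)
        finally show ?thesis by simp
      qed
      finally show ?thesis .
    qed
    then have "a (Suc t) \<le> measure_pmf.expectation (\<Omega> t) (\<lambda>s. ln (\<Phi> s) + (ln (K + 1) - c / (K + 1)))"
      unfolding a_def E_step by (intro expectation_mono_finite fin)
    then show ?thesis by (simp add: int a_def)
  qed
  have l_step: "l t + ln (K + 1) - H t / K \<le> l (Suc t)" for t
  proof -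
    have "ln (wt s i) + ln (K + 1) - measure_pmf.expectation D (\<lambda>b. h s b i) / K
      \<le> measure_pmf.expectation D (\<lambda>b. ln (wt (up s b) i))" if s: "s \<in> set_pmf (\<Omega> t)" for s
    proof -
      have "ln (wt s i) + ln (K + 1) - h s b i / K \<le> ln (wt (up s b) i)" if b: "b \<in> set_pmf D" for b
      proof -
        let ?h = "h s b i"
        have h': "0 \<le> ?h" "K \<le> K + 1 - ?h" using h[OF b i] by auto
        \<comment> \<open>The same tangent bound with the roles exchanged. It leaves the denominator
          \<open>K\<close> where the potential has \<open>K + 1\<close>; this mismatch is the factor
          \<open>1 + 1 / K\<close> of the regret bound.\<close>
        have "ln (K + 1) - ln (K + 1 - ?h) \<le> (K + 1 - (K + 1 - ?h)) / (K + 1 - ?h)"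
          using h' K by (intro ln_diff_le) auto
        also have "\<dots> \<le> ?h / K" using h' K by (simp add: frac_le)
        finally show ?thesis
          using pos[OF s i] h' K by (simp add: up[OF b i] ln_mult)
      qed
      then have "measure_pmf.expectation D (\<lambda>b. ln (wt s i) + ln (K + 1) - h s b i / K)
        \<le> measure_pmf.expectation D (\<lambda>b. ln (wt (up s b) i))"
        by (intro expectation_mono_finite D)
      then show ?thesis by (simp add: int)
    qed
    then have "measure_pmf.expectation (\<Omega> t) (\<lambda>s. ln (wt s i) + ln (K + 1) - measure_pmf.expectation D (\<lambda>b. h s b i) / K)
       \<le> l (Suc t)"
      unfolding l_def E_step by (intro expectation_mono_finite fin)
    then show ?thesis by (simp add: int l_def H_def)
  qed
  have "l T \<le> a T"
    unfolding l_def a_def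
  proof (intro expectation_mono_finite fin)
    fix s assume s: "s \<in> set_pmf (\<Omega> T)"
    have "wt s i \<le> \<Phi> s"
      unfolding \<Phi>_def using pos[OF s] by (intro member_le_sum i I) (auto intro: less_imp_le)
    then show "ln (wt s i) \<le> ln (\<Phi> s)" using pos[OF s i] by simp
  qed
  moreover have "a T \<le> ln (card I) + T * (ln (K + 1) - c / (K + 1))"
  proof (induction T)
    case 0
    show ?case by (simp add: a_def \<Phi>_def start)
  next
    case (Suc T)
    then show ?case using a_step[of T] by (simp add: algebra_simps add_divide_distrib)
  qed
  moreover have "T * ln (K + 1) - (\<Sum>t<T. H t) / K \<le> l T"
  proof (induction T)
    case 0
    show ?case by (simp add: l_def start i)
  next
    case (Suc T)
    then show ?case using l_step[of T] by (simp add: algebra_simps add_divide_distrib)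
  qed
  \<comment> \<open>The terms \<open>T * ln (K + 1)\<close> of the two estimates cancel.\<close>
  ultimately have "T * c / (K + 1) \<le> ln (card I) + (\<Sum>t<T. H t) / K"
    by (simp add: algebra_simps)
  then have "T * c / (K + 1) * (K + 1) \<le> (ln (card I) + (\<Sum>t<T. H t) / K) * (K + 1)"
    using K by (intro mult_right_mono) auto
  then have "T * c \<le> (ln (card I) + (\<Sum>t<T. H t) / K) * (K + 1)"
    using K by simp
  also have "\<dots> = (1 + 1 / K) * (\<Sum>t<T. H t) + (K + 1) * ln (card I)"
    using K by (simp add: field_simps)
  finally show ?thesis by (simp add: H_def mult.commute)
qed

section \<open>The minimax theorem for finite games\<close>

text \<open>The deterministic instance of \<open>multiplicative_weights\<close>: the chain is a
  point mass and the payoffs of the best responses are exact. The uniform distribution over the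
  responses of \<open>T\<close> rounds is then nearly optimal. The set \<open>F\<close> is infinite
  in the application to rational weights.\<close>

lemma minimax_approx:
  fixes g :: "'f \<Rightarrow> 'a \<Rightarrow> real"
  assumes I: "finite I" and F: "F \<noteq> {}" and g: "\<And>f i. f \<in> F \<Longrightarrow> i \<in> I \<Longrightarrow> 0 \<le> g f i \<and> g f i \<le> 1"
    and best: "\<And>y. (\<And>i. i \<in> I \<Longrightarrow> 0 < y i) \<Longrightarrow> \<exists>f\<in>F. c * (\<Sum>i\<in>I. y i) \<le> (\<Sum>i\<in>I. y i * g f i)"
    and \<epsilon>: "\<epsilon> > 0"
  shows "\<exists>q. finite (set_pmf q) \<and> set_pmf q \<subseteq> F \<and> (\<forall>i\<in>I. c - \<epsilon> \<le> measure_pmf.expectation q (\<lambda>f. g f i))"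
proof (cases "I = {}")
  case True
  obtain f where "f \<in> F" using F by blast
  then show ?thesis
    by (intro exI[of _ "return_pmf f"]) (use True in auto)
next
  case False
  \<comment> \<open>Payoffs are at most 1, so the factor \<open>1 + 1 / K\<close> costs at most
    \<open>\<epsilon> / 2\<close> per round; the other half pays for the logarithmic term through
    the choice of \<open>T\<close>.\<close>
  define K where "K = 2 / \<epsilon>"
  have K: "K > 0" using \<epsilon> by (simp add: K_def)
  \<comment> \<open>Positivity guards the inequality but not membership in \<open>F\<close>, so
    every response is a legal strategy and only the regret argument has to track positivity.\<close>
  define br where "br y = (SOME f. f \<in> F \<and> ((\<forall>i\<in>I. 0 < y i) \<longrightarrow> c * (\<Sum>i\<in>I. y i) \<le> (\<Sum>i\<in>I. y i * g f i)))" for y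
  have br: "br y \<in> F \<and> ((\<forall>i\<in>I. 0 < y i) \<longrightarrow> c * (\<Sum>i\<in>I. y i) \<le> (\<Sum>i\<in>I. y i * g (br y) i))" for y
    unfolding br_def by (rule someI_ex) (use best[of y] F in blast)
  define up where "up y = (\<lambda>i. y i * (K + 1 - g (br y) i))" for y
  define Y where "Y t = (up ^^ t) (\<lambda>_. 1)" for t
  have Y: "c * T \<le> (1 + 1 / K) * (\<Sum>t<T. g (br (Y t)) i) + (K + 1) * ln (card I)" if "i \<in> I" for T :: nat and i
    using multiplicative_weights[OF I that, of "return_pmf ()" K "\<lambda>t. return_pmf (Y t)" "\<lambda>_. 1" "\<lambda>y. y"
        "\<lambda>y _. up y" "\<lambda>y _. g (br y)" c T] g br K
    by (auto simp: Y_def up_def bind_return_pmf)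
  obtain T :: nat where T: "2 * (K + 1) * ln (card I) / \<epsilon> < T" using reals_Archimedean2 by blast
  have lnI: "0 \<le> ln (card I)" using False I by (simp add: Suc_le_eq card_gt_0_iff)
  then have "0 \<le> 2 * (K + 1) * ln (card I) / \<epsilon>" using K \<epsilon> by simp
  then have T0: "T > 0" using T by linarith
  define q where "q = map_pmf (\<lambda>t. br (Y t)) (pmf_of_set {..<T})"
  have set: "set_pmf (pmf_of_set {..<T}) = {..<T}" using T0 by (subst set_pmf_of_set) auto
  have "c - \<epsilon> \<le> measure_pmf.expectation q (\<lambda>f. g f i)" if i: "i \<in> I" for i
  proof -
    let ?S = "\<Sum>t<T. g (br (Y t)) i"
    have "?S \<le> (\<Sum>t<T. 1)" using g br i by (intro sum_mono) auto
    then have "?S / K \<le> T / K" using K by (intro divide_right_mono) auto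
    also have "T / K = T * (\<epsilon> / 2)" using \<epsilon> by (simp add: K_def)
    finally have "c * T \<le> ?S + T * (\<epsilon> / 2) + (K + 1) * ln (card I)"
      using Y[OF i, of T] by (simp add: algebra_simps)
    also have "(K + 1) * ln (card I) \<le> T * (\<epsilon> / 2)"
      using T \<epsilon> by (simp add: field_simps)
    finally have "(c - \<epsilon>) * T \<le> ?S" by (simp add: algebra_simps)
    then have "c - \<epsilon> \<le> ?S / T" using T0 by (simp add: field_simps)
    also have "?S / T = measure_pmf.expectation q (\<lambda>f. g f i)"
      using T0 unfolding q_def by (simp add: integral_pmf_of_set lessThan_empty_iff)
    finally show ?thesis .
  qed
  then show ?thesis
    by (intro exI[of _ q]) (use br in \<open>auto simp: q_def set\<close>)
qed

text \<open>Bolzano-Weierstrass, one coordinate after the other.\<close>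

lemma bounded_functions_convergent_subsequence:
  fixes u :: "nat \<Rightarrow> 'f \<Rightarrow> real"
  assumes "finite F" "\<And>m f. f \<in> F \<Longrightarrow> \<bar>u m f\<bar> \<le> B"
  shows "\<exists>r l. strict_mono (r :: nat \<Rightarrow> nat) \<and> (\<forall>f\<in>F. (\<lambda>m. u (r m) f) \<longlonglongrightarrow> l f)"
  using assms
proof (induction F)
  case empty
  show ?case by (auto intro!: exI[of _ id] strict_mono_id[unfolded id_def[symmetric]] simp: strict_mono_def)
next
  case (insert a F)
  then obtain r l where r: "strict_mono (r :: nat \<Rightarrow> nat)" "\<forall>f\<in>F. (\<lambda>m. u (r m) f) \<longlonglongrightarrow> l f"
    by auto
  have "bounded (range (\<lambda>m. u (r m) a))"
    using insert.prems by (auto simp: bounded_iff)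
  then obtain l' r' where r': "strict_mono (r' :: nat \<Rightarrow> nat)" "((\<lambda>m. u (r m) a) \<circ> r') \<longlonglongrightarrow> l'"
    using bounded_imp_convergent_subsequence by blast
  have "(\<lambda>m. u (r (r' m)) f) \<longlonglongrightarrow> (l(a := l')) f" if "f \<in> insert a F" for f
  proof (cases "f = a")
    case True
    then show ?thesis using r'(2) by (simp add: o_def)
  next
    case False
    then show ?thesis
      using LIMSEQ_subseq_LIMSEQ[OF _ r'(1), of "\<lambda>m. u (r m) f" "l f"] r(2) that by (simp add: o_def)
  qed
  then show ?case
    using strict_mono_o[OF r(1) r'(1)] by (intro exI[of _ "r \<circ> r'"] exI[of _ "l(a := l')"]) (simp add: o_def)
qed

text \<open>For finite \<open>F\<close> the mixed strategies form a compact simplex, so strategies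
  with error \<open>1 / Suc m\<close> have a limit point. Expected payoffs are finite sums, hence
  pass to the limit, and the error vanishes.\<close>

lemma minimax:
  fixes g :: "'f \<Rightarrow> 'a \<Rightarrow> real"
  assumes I: "finite I" and F: "F \<noteq> {}" "finite F"
    and g: "\<And>f i. f \<in> F \<Longrightarrow> i \<in> I \<Longrightarrow> 0 \<le> g f i \<and> g f i \<le> 1"
    and best: "\<And>y. (\<And>i. i \<in> I \<Longrightarrow> 0 < y i) \<Longrightarrow> \<exists>f\<in>F. c * (\<Sum>i\<in>I. y i) \<le> (\<Sum>i\<in>I. y i * g f i)"
  shows "\<exists>q. set_pmf q \<subseteq> F \<and> (\<forall>i\<in>I. c \<le> measure_pmf.expectation q (\<lambda>f. g f i))"
proof -
  have "\<exists>q. finite (set_pmf q) \<and> set_pmf q \<subseteq> F \<and>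
      (\<forall>i\<in>I. c - 1 / real (Suc m) \<le> measure_pmf.expectation q (\<lambda>f. g f i))" for m
    by (rule minimax_approx[OF I F(1) g best]) auto
  then obtain q where q: "\<And>m. set_pmf (q m) \<subseteq> F"
    and q_ge: "\<And>m i. i \<in> I \<Longrightarrow> c - 1 / real (Suc m) \<le> measure_pmf.expectation (q m) (\<lambda>f. g f i)"
    by metis
  obtain r l where r: "strict_mono (r :: nat \<Rightarrow> nat)" and l: "\<And>f. f \<in> F \<Longrightarrow> (\<lambda>m. pmf (q (r m)) f) \<longlonglongrightarrow> l f"
    using bounded_functions_convergent_subsequence[OF F(2), of "\<lambda>m. pmf (q m)" 1] pmf_le_1 by fastforce
  define l' where "l' f = (if f \<in> F then l f else 0)" for f
  have nonneg: "0 \<le> l' f" for f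
    using LIMSEQ_le_const[OF l, of f 0] by (auto simp: l'_def)
  have "(\<Sum>f\<in>F. pmf (q (r m)) f) = 1" for m
    using sum_pmf_eq_1[OF F(2) q] .
  moreover have "(\<lambda>m. \<Sum>f\<in>F. pmf (q (r m)) f) \<longlonglongrightarrow> (\<Sum>f\<in>F. l f)"
    by (intro tendsto_sum l)
  ultimately have one: "(\<Sum>f\<in>F. l f) = 1"
    by (simp add: LIMSEQ_const_iff)
  have "(\<integral>\<^sup>+ f. ennreal (l' f) \<partial>count_space UNIV) = (\<Sum>f\<in>F. ennreal (l' f))"
    by (subst nn_integral_count_space'[of F]) (use F in \<open>auto simp: l'_def\<close>)
  also have "\<dots> = ennreal (\<Sum>f\<in>F. l' f)"
    using nonneg by (intro sum_ennreal)
  also have "(\<Sum>f\<in>F. l' f) = 1"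
    using one by (simp add: l'_def)
  finally have pmf: "pmf (embed_pmf l') f = l' f" for f
    using nonneg by (intro pmf_embed_pmf) simp_all
  then have set: "set_pmf (embed_pmf l') \<subseteq> F"
    by (auto simp: set_pmf_eq l'_def)
  have "c \<le> measure_pmf.expectation (embed_pmf l') (\<lambda>f. g f i)" if i: "i \<in> I" for i
  proof -
    have eq: "measure_pmf.expectation p (\<lambda>f. g f i) = (\<Sum>f\<in>F. pmf p f * g f i)" if "set_pmf p \<subseteq> F" for p
      using integral_measure_pmf[OF F(2), of p "\<lambda>f. g f i"] that by auto
    have "(\<lambda>m. c - 1 / real (Suc m)) \<longlonglongrightarrow> c - 0"
      by (intro tendsto_diff tendsto_const LIMSEQ_inverse_real_of_nat[unfolded inverse_eq_divide])
    from LIMSEQ_subseq_LIMSEQ[OF this r] have 1: "(\<lambda>m. c - 1 / real (Suc (r m))) \<longlonglongrightarrow> c"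
      by (simp add: o_def)
    have "(\<lambda>m. \<Sum>f\<in>F. pmf (q (r m)) f * g f i) \<longlonglongrightarrow> (\<Sum>f\<in>F. l f * g f i)"
      by (intro tendsto_sum tendsto_mult tendsto_const l)
    from LIMSEQ_le[OF 1 this] have "c \<le> (\<Sum>f\<in>F. l f * g f i)"
      using q_ge[OF i] by (simp add: eq[OF q])
    then show ?thesis by (simp add: eq[OF set] pmf l'_def)
  qed
  with set show ?thesis by blast
qed

section \<open>Random subsets\<close>

lemma expectation_swap_finite:
  fixes h :: "'a \<Rightarrow> 'b \<Rightarrow> real"
  assumes "finite (set_pmf p)" "finite (set_pmf q)"
  shows "measure_pmf.expectation p (\<lambda>x. measure_pmf.expectation q (h x)) =
    measure_pmf.expectation q (\<lambda>y. measure_pmf.expectation p (\<lambda>x. h x y))"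
  using assms
  by (simp add: integral_measure_pmf[of "set_pmf p"] integral_measure_pmf[of "set_pmf q"] sum_distrib_left
      sum.swap[of _ "set_pmf p"] mult.left_commute)

lemma random_subset_empty: "random_subset {} x = return_pmf {}"
  by (simp add: random_subset_def)

lemma random_subset_insert:
  assumes "finite N" "a \<notin> N"
  shows "random_subset (insert a N) x =
    bind_pmf (bernoulli_pmf (x a)) (\<lambda>c. map_pmf (\<lambda>R. if c then insert a R else R) (random_subset N x))"
proof -
  have "{i \<in> insert a N. (f(a := c)) i} = (if c then insert a {i \<in> N. f i} else {i \<in> N. f i})" for f c
    using assms(2) by auto
  then show ?thesis
    unfolding random_subset_def Pi_pmf_insert'[OF assms]
    by (simp add: map_bind_pmf map_pmf_def bind_assoc_pmf bind_return_pmf)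
qed

lemma set_random_subset:
  assumes "finite N" "R \<in> set_pmf (random_subset N x)"
  shows "R \<subseteq> {i\<in>N. x i \<noteq> 0}"
  using assms
proof (induction N arbitrary: R)
  case empty
  then show ?case by (simp add: random_subset_empty)
next
  case (insert a N)
  have "c = False" if "c \<in> set_pmf (bernoulli_pmf 0)" for c
    using that by (auto simp: set_pmf_eq split: if_splits)
  with insert show ?case
    by (fastforce simp: random_subset_insert split: if_splits)
qed

lemma finite_set_random_subset: "finite N \<Longrightarrow> finite (set_pmf (random_subset N x))"
  by (rule finite_subset[of _ "Pow N"]) (auto dest!: set_random_subset)

lemma expectation_random_subset_insert:
  fixes f :: "'a set \<Rightarrow> real"
  assumes "finite N" "a \<notin> N" "0 \<le> x a" "x a \<le> 1"
  shows "measure_pmf.expectation (random_subset (insert a N) x) f =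
    x a * measure_pmf.expectation (random_subset N x) (\<lambda>R. f (insert a R)) +
    (1 - x a) * measure_pmf.expectation (random_subset N x) f"
proof -
  have "finite (set_pmf (bernoulli_pmf p))" for p by (rule finite_subset[of _ UNIV]) auto
  then show ?thesis
    unfolding random_subset_insert[OF assms(1,2)]
    by (subst expectation_bind_finite)
       (use assms in \<open>auto simp: finite_set_random_subset integral_measure_pmf[of "UNIV :: bool set"] UNIV_bool\<close>)
qed

text \<open>Since \<open>f R \<subseteq> R\<close>, the event forces \<open>i\<close> into
  \<open>R\<close>, and whether it is there is independent of the other coordinates. Adding
  \<open>i\<close> to an unconditioned sample therefore has the same effect as conditioning on
  it.\<close>

lemma expectation_random_subset_coordinate:
  fixes f :: "'a set \<Rightarrow> 'a set"
  assumes N: "finite N" and i: "i \<in> N" "0 \<le> x i" "x i \<le> 1" and f: "\<And>R. R \<subseteq> N \<Longrightarrow> f R \<subseteq> R"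
  shows "measure_pmf.expectation (random_subset N x) (\<lambda>R. of_bool (i \<in> f R) :: real) =
    x i * measure_pmf.expectation (random_subset N x) (\<lambda>R. of_bool (i \<in> f (insert i R)))"
proof -
  define M where "M = N - {i}"
  have M: "N = insert i M" "finite M" "i \<notin> M" using N i by (auto simp: M_def)
  have "measure_pmf.expectation (random_subset M x) (\<lambda>R. of_bool (i \<in> f R)) =
    measure_pmf.expectation (random_subset M x) (\<lambda>R. 0 :: real)"
  proof (rule expectation_cong_pmf)
    fix R assume "R \<in> set_pmf (random_subset M x)"
    then have "R \<subseteq> M" using set_random_subset[OF M(2)] by blast
    then show "of_bool (i \<in> f R) = (0 :: real)" using f[of R] M by auto
  qed
  then show ?thesis
    unfolding M(1) using M i by (simp add: expectation_random_subset_insert algebra_simps)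
qed

lemma expectation_mem_random_subset:
  assumes "finite N" "i \<in> N" "0 \<le> x i" "x i \<le> 1"
  shows "measure_pmf.expectation (random_subset N x) (\<lambda>R. of_bool (i \<in> R) :: real) = x i"
  using expectation_random_subset_coordinate[of N i x "\<lambda>R. R"] assms by simp

lemma expectation_between_0_1:
  fixes f :: "'a \<Rightarrow> real"
  assumes "finite (set_pmf p)" "\<And>a. a \<in> set_pmf p \<Longrightarrow> 0 \<le> f a \<and> f a \<le> 1"
  shows "0 \<le> measure_pmf.expectation p f \<and> measure_pmf.expectation p f \<le> 1"
  using expectation_mono_finite[OF assms(1), of "\<lambda>_. 0" f] expectation_mono_finite[OF assms(1), of f "\<lambda>_. 1"] assms(2)
  by auto

text \<open>A total variation bound for product measures, proved by exchanging one coordinate at a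
  time; the difference splits into two inductive terms, weighted by \<open>x a\<close> and
  \<open>1 - x a\<close>, and one term for the change at \<open>a\<close>.\<close>

lemma expectation_random_subset_perturb:
  fixes f :: "'a set \<Rightarrow> real"
  assumes "finite N" "\<And>i. i \<in> N \<Longrightarrow> x i \<in> {0..1} \<and> x' i \<in> {0..1}" "\<And>R. 0 \<le> f R \<and> f R \<le> 1"
  shows "\<bar>measure_pmf.expectation (random_subset N x) f - measure_pmf.expectation (random_subset N x') f\<bar>
    \<le> (\<Sum>i\<in>N. \<bar>x i - x' i\<bar>)"
  using assms
proof (induction N arbitrary: f)
  case empty
  show ?case by (simp add: random_subset_empty)
next
  case (insert a N)
  let ?E = "\<lambda>x. measure_pmf.expectation (random_subset N x)"
  let ?f = "\<lambda>R. f (insert a R)"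
  have xa: "0 \<le> x a" "x a \<le> 1" "0 \<le> x' a" "x' a \<le> 1" using insert.prems by auto
  have IH: "\<bar>?E x f - ?E x' f\<bar> \<le> (\<Sum>i\<in>N. \<bar>x i - x' i\<bar>)" "\<bar>?E x ?f - ?E x' ?f\<bar> \<le> (\<Sum>i\<in>N. \<bar>x i - x' i\<bar>)"
    using insert.prems by (auto intro!: insert.IH)
  have bounds: "0 \<le> ?E x' f \<and> ?E x' f \<le> 1" "0 \<le> ?E x' ?f \<and> ?E x' ?f \<le> 1"
    by (rule expectation_between_0_1, simp add: finite_set_random_subset insert.hyps, rule insert.prems)+
  have "\<bar>x a * (?E x ?f - ?E x' ?f)\<bar> \<le> x a * (\<Sum>i\<in>N. \<bar>x i - x' i\<bar>)"
    using IH xa by (simp add: abs_mult mult_left_mono)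
  moreover have "\<bar>(1 - x a) * (?E x f - ?E x' f)\<bar> \<le> (1 - x a) * (\<Sum>i\<in>N. \<bar>x i - x' i\<bar>)"
    using IH xa by (simp add: abs_mult mult_left_mono)
  moreover have "\<bar>(x a - x' a) * (?E x' ?f - ?E x' f)\<bar> \<le> \<bar>x a - x' a\<bar> * 1"
    unfolding abs_mult using bounds by (intro mult_left_mono) auto
  moreover have "measure_pmf.expectation (random_subset (insert a N) x) f - measure_pmf.expectation (random_subset (insert a N) x') f
    = x a * (?E x ?f - ?E x' ?f) + (1 - x a) * (?E x f - ?E x' f) + (x a - x' a) * (?E x' ?f - ?E x' f)"
    using insert.hyps xa by (simp add: expectation_random_subset_insert algebra_simps)
  moreover have "x a * (\<Sum>i\<in>N. \<bar>x i - x' i\<bar>) + (1 - x a) * (\<Sum>i\<in>N. \<bar>x i - x' i\<bar>) = (\<Sum>i\<in>N. \<bar>x i - x' i\<bar>)"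
    by (simp add: algebra_simps)
  moreover have "(\<Sum>i\<in>insert a N. \<bar>x i - x' i\<bar>) = \<bar>x a - x' a\<bar> + (\<Sum>i\<in>N. \<bar>x i - x' i\<bar>)"
    using insert.hyps by simp
  moreover have "\<bar>u + v + w\<bar> \<le> u' + v' + w'" if "\<bar>u\<bar> \<le> u'" "\<bar>v\<bar> \<le> v'" "\<bar>w\<bar> \<le> w'" for u v w u' v' w' :: real
    using that by linarith
  ultimately show ?case by (metis (no_types, lifting) add.commute mult.right_neutral)
qed

section \<open>Schemes as mixtures\<close>

lemma scaled_in_unit_cube:
  assumes "relaxation N \<I> P" "b \<in> {0..1}" "x \<in> scaled b P"
  shows "x \<in> unit_cube N"
proof -
  obtain z where z: "z \<in> unit_cube N" "x = (\<lambda>i. b * z i)"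
    using assms by (auto simp: relaxation_def scaled_def)
  then show ?thesis using assms(2) by (auto simp: unit_cube_def mult_le_one)
qed

text \<open>Because the output is contained in \<open>R\<close>, the event \<open>i \<in> S\<close>
  implies the condition, so it only remains to divide by the probability \<open>x i\<close> of the
  condition.\<close>

lemma cond_prob_resolve:
  assumes N: "finite N" and x: "x \<in> unit_cube N" and i: "i \<in> N" "x i > 0"
    and \<pi>: "\<And>R S. R \<subseteq> N \<Longrightarrow> S \<in> set_pmf (\<pi> x R) \<Longrightarrow> S \<subseteq> R"
  shows "cond_prob (measure_pmf (resolve N \<pi> x)) (\<lambda>(R, S). i \<in> S) (\<lambda>(R, S). i \<in> R) =
    measure_pmf.expectation (random_subset N x) (\<lambda>R. measure_pmf.expectation (\<pi> x R) (\<lambda>S. of_bool (i \<in> S))) / x i"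
proof -
  have sub: "R \<subseteq> N" if "R \<in> set_pmf (random_subset N x)" for R
    using set_random_subset[OF N that] by auto
  have fin: "finite (set_pmf (\<pi> x R))" if "R \<in> set_pmf (random_subset N x)" for R
    by (rule finite_subset[of _ "Pow N"]) (use \<pi> sub[OF that] N in auto)
  have prob: "measure_pmf.prob (resolve N \<pi> x) {z. Q z} = measure_pmf.expectation (random_subset N x)
     (\<lambda>R. measure_pmf.expectation (\<pi> x R) (\<lambda>S. of_bool (Q (R, S))))" for Q
  proof -
    have "measure_pmf.prob (resolve N \<pi> x) {z. Q z} = measure_pmf.expectation (resolve N \<pi> x) (indicator {z. Q z})"
      by simp
    also have "indicator {z. Q z} = (\<lambda>z. of_bool (Q z) :: real)"
      by (simp add: indicator_def fun_eq_iff)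
    finally have "measure_pmf.prob (resolve N \<pi> x) {z. Q z} = measure_pmf.expectation (resolve N \<pi> x) (\<lambda>z. of_bool (Q z))" .
    then show ?thesis
      unfolding resolve_def by (subst (asm) expectation_bind_finite) (use fin N in \<open>auto simp: finite_set_random_subset\<close>)
  qed
  have "measure_pmf.prob (resolve N \<pi> x) {z. i \<in> fst z} = x i"
    unfolding prob using x i N by (simp add: expectation_mem_random_subset unit_cube_def)
  moreover have "measure_pmf.prob (resolve N \<pi> x) {z. i \<in> snd z \<and> i \<in> fst z} =
     measure_pmf.expectation (random_subset N x) (\<lambda>R. measure_pmf.expectation (\<pi> x R) (\<lambda>S. of_bool (i \<in> S)))"
    unfolding prob
  proof (intro expectation_cong_pmf)
    fix R S assume "R \<in> set_pmf (random_subset N x)" "S \<in> set_pmf (\<pi> x R)"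
    then have "S \<subseteq> R" using \<pi> sub by blast
    then show "of_bool (i \<in> snd (R, S) \<and> i \<in> fst (R, S)) = (of_bool (i \<in> S) :: real)" by auto
  qed
  ultimately show ?thesis
    by (simp add: cond_prob_def case_prod_unfold)
qed

text \<open>The payoff of the pure strategy \<open>f\<close> against \<open>i\<close>: for
  \<open>f\<close> that shrinks its argument, this is the probability of \<open>i \<in> f R\<close>
  given \<open>i \<in> R\<close>.\<close>

definition inclusion :: "'a set \<Rightarrow> ('a \<Rightarrow> real) \<Rightarrow> ('a set \<Rightarrow> 'a set) \<Rightarrow> 'a \<Rightarrow> real" where
  "inclusion N x f i = measure_pmf.expectation (random_subset N x) (\<lambda>R. of_bool (i \<in> f R)) / x i"

lemma inclusion_eq:
  assumes "finite N" "x \<in> unit_cube N" "i \<in> N" "x i > 0" "\<And>R. R \<subseteq> N \<Longrightarrow> f R \<subseteq> R"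
  shows "inclusion N x f i = measure_pmf.expectation (random_subset N x) (\<lambda>R. of_bool (i \<in> f (insert i R)))"
  using assms by (simp add: inclusion_def expectation_random_subset_coordinate unit_cube_def)

lemma inclusion_between_0_1:
  assumes "finite N" "x \<in> unit_cube N" "i \<in> N" "x i > 0" "\<And>R. R \<subseteq> N \<Longrightarrow> f R \<subseteq> R"
  shows "0 \<le> inclusion N x f i \<and> inclusion N x f i \<le> 1"
proof -
  have "inclusion N x f i = measure_pmf.expectation (random_subset N x) (\<lambda>R. of_bool (i \<in> f (insert i R)))"
    by (rule inclusion_eq[OF assms(1-4)]) (rule assms(5))
  then show ?thesis
    using expectation_between_0_1[OF finite_set_random_subset[OF assms(1)], of x "\<lambda>R. of_bool (i \<in> f (insert i R))"]
    by simp
qed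

text \<open>The law of \<open>s\<close> does not depend on \<open>A\<close>, which is what lets
  monotonicity pass from the single strategies to the mixture. Intersecting with the support meets
  the requirement on outputs and almost surely leaves the random set of a point of the unit cube
  unchanged.\<close>

definition mixture :: "'a set \<Rightarrow> ('a \<Rightarrow> real) \<Rightarrow> 's pmf \<Rightarrow> ('s \<Rightarrow> 'a set \<Rightarrow> 'a set) \<Rightarrow> 'a set \<Rightarrow> 'a set pmf" where
  "mixture N x q f A = map_pmf (\<lambda>s. f s (A \<inter> {i\<in>N. x i > 0})) q"

text \<open>The strategy and the random set are independent, so the two expectations can be
  exchanged and the balance becomes an average of pure payoffs.\<close>

lemma cond_prob_resolve_mixture:
  assumes N: "finite N" and x: "x \<in> unit_cube N" and i: "i \<in> N" "x i > 0"
    and q: "finite (set_pmf q)" and f: "\<And>s R. s \<in> set_pmf q \<Longrightarrow> R \<subseteq> N \<Longrightarrow> f s R \<subseteq> R"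
    and \<pi>: "\<And>A. A \<subseteq> N \<Longrightarrow> \<pi> x A = mixture N x q f A"
  shows "cond_prob (measure_pmf (resolve N \<pi> x)) (\<lambda>(R, S). i \<in> S) (\<lambda>(R, S). i \<in> R) =
    measure_pmf.expectation q (\<lambda>s. inclusion N x (f s) i)"
proof -
  have "S \<subseteq> R" if R: "R \<subseteq> N" and S: "S \<in> set_pmf (\<pi> x R)" for R S
  proof -
    obtain s where s: "s \<in> set_pmf q" "S = f s (R \<inter> {i\<in>N. x i > 0})"
      using S by (auto simp: \<pi>[OF R] mixture_def)
    then show ?thesis using f[of s "R \<inter> {i\<in>N. x i > 0}"] R by auto
  qed
  then have "cond_prob (measure_pmf (resolve N \<pi> x)) (\<lambda>(R, S). i \<in> S) (\<lambda>(R, S). i \<in> R) =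
    measure_pmf.expectation (random_subset N x) (\<lambda>R. measure_pmf.expectation (\<pi> x R) (\<lambda>S. of_bool (i \<in> S))) / x i"
    by (intro cond_prob_resolve N x i)
  also have "measure_pmf.expectation (random_subset N x) (\<lambda>R. measure_pmf.expectation (\<pi> x R) (\<lambda>S. of_bool (i \<in> S))) =
    measure_pmf.expectation (random_subset N x) (\<lambda>R. measure_pmf.expectation q (\<lambda>s. of_bool (i \<in> f s R) :: real))"
  proof (rule expectation_cong_pmf)
    fix R assume "R \<in> set_pmf (random_subset N x)"
    then have "R \<subseteq> N" "R \<inter> {i\<in>N. x i > 0} = R"
      using set_random_subset[OF N, of R x] x by (fastforce simp: unit_cube_def)+
    then show "measure_pmf.expectation (\<pi> x R) (\<lambda>S. of_bool (i \<in> S)) =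
      (measure_pmf.expectation q (\<lambda>s. of_bool (i \<in> f s R)) :: real)"
      by (simp add: \<pi> mixture_def)
  qed
  also have "\<dots> = measure_pmf.expectation q (\<lambda>s. measure_pmf.expectation (random_subset N x) (\<lambda>R. of_bool (i \<in> f s R)))"
    by (intro expectation_swap_finite finite_set_random_subset N q)
  finally show ?thesis by (simp add: inclusion_def)
qed

lemma balanced_mixture:
  assumes N: "finite N" and P: "relaxation N \<I> P" "b \<in> {0..1}"
    and q: "\<And>x. x \<in> scaled b P \<Longrightarrow> finite (set_pmf (q x))"
    and f: "\<And>x s A. x \<in> scaled b P \<Longrightarrow> s \<in> set_pmf (q x) \<Longrightarrow> A \<subseteq> N \<Longrightarrow> f x s A \<subseteq> A \<and> f x s A \<in> \<I>"
    and c: "\<And>x i. x \<in> scaled b P \<Longrightarrow> i \<in> N \<Longrightarrow> x i > 0 \<Longrightarrow>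
      c \<le> measure_pmf.expectation (q x) (\<lambda>s. inclusion N x (f x s) i)"
  shows "balanced_crs N \<I> P b c (\<lambda>x. mixture N x (q x) (f x))"
  unfolding balanced_crs_def
proof (intro ballI conjI allI impI)
  fix x assume x: "x \<in> scaled b P"
  note cube = scaled_in_unit_cube[OF P x]
  show "S \<subseteq> A \<inter> {i\<in>N. x i > 0}" "S \<in> \<I>" if "A \<subseteq> N" "S \<in> set_pmf (mixture N x (q x) (f x) A)" for A S
    using that f[OF x, of _ "A \<inter> {i\<in>N. x i > 0}"] by (auto simp: mixture_def)
  fix i assume "i \<in> N" "x i > 0"
  then show "c \<le> cond_prob (measure_pmf (resolve N (\<lambda>x. mixture N x (q x) (f x)) x)) (\<lambda>(R, S). i \<in> S) (\<lambda>(R, S). i \<in> R)"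
    using cond_prob_resolve_mixture[OF N cube _ _ q[OF x], where \<pi> = "\<lambda>x. mixture N x (q x) (f x)" and f = "f x" and i = i]
      c[OF x] f[OF x] by auto
qed

text \<open>Linearity over the elements. It says that the maximizing map attains its payoff against
  the unnormalized mixed strategy \<open>y i * x i\<close>, and so connects the weight maximum with
  the game.\<close>

lemma expectation_max_weight:
  fixes y :: "'a \<Rightarrow> real"
  assumes N: "finite N" and f: "\<And>R. R \<subseteq> N \<Longrightarrow> max_weight_subset \<I> y R (f R)"
    and x: "x \<in> unit_cube N"
  shows "measure_pmf.expectation (random_subset N x) (\<lambda>R. Max {\<Sum>i\<in>S. y i | S. S \<subseteq> R \<and> S \<in> \<I>})
    = (\<Sum>i\<in>{i\<in>N. x i > 0}. y i * x i * inclusion N x f i)"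
proof -
  let ?J = "{i\<in>N. x i > 0}"
  have "measure_pmf.expectation (random_subset N x) (\<lambda>R. Max {\<Sum>i\<in>S. y i | S. S \<subseteq> R \<and> S \<in> \<I>})
    = measure_pmf.expectation (random_subset N x) (\<lambda>R. \<Sum>i\<in>?J. y i * of_bool (i \<in> f R))"
  proof (rule expectation_cong_pmf)
    fix R assume "R \<in> set_pmf (random_subset N x)"
    then have R: "R \<subseteq> N" "R \<subseteq> ?J"
      using set_random_subset[OF N, of R x] x by (fastforce simp: unit_cube_def)+
    have "Max {\<Sum>i\<in>S. y i | S. S \<subseteq> R \<and> S \<in> \<I>} = (\<Sum>i\<in>f R. y i)"
    proof (rule Max_eqI)
      have "{\<Sum>i\<in>S. y i | S. S \<subseteq> R \<and> S \<in> \<I>} \<subseteq> (\<lambda>S. \<Sum>i\<in>S. y i) ` Pow N" using R by auto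
      then show "finite {\<Sum>i\<in>S. y i | S. S \<subseteq> R \<and> S \<in> \<I>}" by (rule finite_subset) (use N in auto)
    qed (use f[OF R(1)] in \<open>auto simp: max_weight_subset_def\<close>)
    also have "\<dots> = (\<Sum>i\<in>?J. y i * of_bool (i \<in> f R))"
      using f[OF R(1)] R N by (intro sum.mono_neutral_cong_left) (auto simp: max_weight_subset_def)
    finally show "Max {\<Sum>i\<in>S. y i | S. S \<subseteq> R \<and> S \<in> \<I>} = (\<Sum>i\<in>?J. y i * of_bool (i \<in> f R))" .
  qed
  also have "\<dots> = (\<Sum>i\<in>?J. measure_pmf.expectation (random_subset N x) (\<lambda>R. y i * of_bool (i \<in> f R)))"
    by (intro Bochner_Integration.integral_sum integrable_measure_pmf_finite finite_set_random_subset N)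
  also have "\<dots> = (\<Sum>i\<in>?J. y i * x i * inclusion N x f i)"
    by (intro sum.cong refl) (simp add: inclusion_def)
  finally show ?thesis .
qed

lemma sum_positive_part:
  fixes x y :: "'a \<Rightarrow> real"
  assumes "finite N" "x \<in> unit_cube N"
  shows "(\<Sum>i\<in>N. y i * x i) = (\<Sum>i\<in>{i\<in>N. x i > 0}. y i * x i)"
  using assms by (intro sum.mono_neutral_right) (auto simp: unit_cube_def less_le)

section \<open>The characterization\<close>

lemma ex_max_weight_subset:
  fixes y :: "'a \<Rightarrow> 'b :: linordered_field"
  assumes "finite A" "{} \<in> \<I>"
  shows "\<exists>S. max_weight_subset \<I> y A S"
proof -
  let ?C = "{S. S \<subseteq> A \<and> S \<in> \<I>}"
  have C: "finite ?C" "?C \<noteq> {}" using assms by auto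
  then have "Max ((\<lambda>S. \<Sum>i\<in>S. y i) ` ?C) \<in> (\<lambda>S. \<Sum>i\<in>S. y i) ` ?C" by (intro Max_in) auto
  then obtain S where "S \<in> ?C" "(\<Sum>i\<in>S. y i) = Max ((\<lambda>S. \<Sum>i\<in>S. y i) ` ?C)" by auto
  then show ?thesis
    using C by (intro exI[of _ S]) (auto simp: max_weight_subset_def)
qed

text \<open>A correlation gap inequality at the single point \<open>x\<close>.\<close>

definition gap_condition :: "'a set \<Rightarrow> 'a set set \<Rightarrow> ('a \<Rightarrow> real) \<Rightarrow> real \<Rightarrow> bool" where
  "gap_condition N \<I> x c \<longleftrightarrow> (\<forall>y. (\<forall>i\<in>N. 0 \<le> y i) \<longrightarrow>
     c * (\<Sum>i\<in>N. y i * x i) \<le>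
     measure_pmf.expectation (random_subset N x) (\<lambda>R. Max {\<Sum>i\<in>S. y i | S. S \<subseteq> R \<and> S \<in> \<I>}))"

text \<open>The easy direction: each output is a feasible subset of \<open>R\<close>, so its weight
  is at most the maximum, while the balance bounds its expected weight from below, element by
  element.\<close>

lemma balanced_imp_gap_condition:
  assumes N: "finite N" and \<I>: "{} \<in> \<I>" and P: "relaxation N \<I> P" "b \<in> {0..1}"
    and \<pi>: "balanced_crs N \<I> P b c \<pi>" and x: "x \<in> scaled b P"
  shows "gap_condition N \<I> x c"
  unfolding gap_condition_def
proof (intro allI impI)
  fix y :: "'a \<Rightarrow> real" assume y: "\<forall>i\<in>N. 0 \<le> y i"
  note cube = scaled_in_unit_cube[OF P x]
  let ?J = "{i\<in>N. x i > 0}" and ?E = "measure_pmf.expectation (random_subset N x)"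
  have sub: "R \<subseteq> N" if "R \<in> set_pmf (random_subset N x)" for R
    using set_random_subset[OF N that] by auto
  have \<pi>_sub: "S \<subseteq> A \<inter> ?J" "S \<in> \<I>" if "A \<subseteq> N" "S \<in> set_pmf (\<pi> x A)" for A S
    using \<pi> x that unfolding balanced_crs_def by blast+
  have fin: "finite (set_pmf (\<pi> x R))" if "R \<subseteq> N" for R
    by (rule finite_subset[of _ "Pow N"]) (use \<pi>_sub that N in auto)
  let ?p = "\<lambda>i. ?E (\<lambda>R. measure_pmf.expectation (\<pi> x R) (\<lambda>S. of_bool (i \<in> S)))"
  have p: "c * x i \<le> ?p i" if "i \<in> ?J" for i
  proof -
    have "c \<le> cond_prob (measure_pmf (resolve N \<pi> x)) (\<lambda>(R, S). i \<in> S) (\<lambda>(R, S). i \<in> R)"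
      using \<pi> x that unfolding balanced_crs_def by blast
    also have "\<dots> = ?p i / x i"
      using that \<pi>_sub by (intro cond_prob_resolve N cube) blast+
    finally show ?thesis using that by (simp add: field_simps)
  qed
  have "c * (\<Sum>i\<in>N. y i * x i) = (\<Sum>i\<in>?J. y i * (c * x i))"
    unfolding sum_positive_part[OF N cube] by (simp add: sum_distrib_left mult.left_commute)
  also have "\<dots> \<le> (\<Sum>i\<in>?J. y i * ?p i)"
    using p y by (intro sum_mono mult_left_mono) auto
  also have "\<dots> = ?E (\<lambda>R. \<Sum>i\<in>?J. y i * measure_pmf.expectation (\<pi> x R) (\<lambda>S. of_bool (i \<in> S)))"
    by (subst Bochner_Integration.integral_sum)
       (auto intro!: integrable_measure_pmf_finite finite_set_random_subset N)
  also have "\<dots> \<le> ?E (\<lambda>R. Max {\<Sum>i\<in>S. y i | S. S \<subseteq> R \<and> S \<in> \<I>})"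
  proof (intro expectation_mono_finite finite_set_random_subset N)
    fix R assume "R \<in> set_pmf (random_subset N x)"
    note R = sub[OF this]
    have "(\<Sum>i\<in>?J. y i * measure_pmf.expectation (\<pi> x R) (\<lambda>S. of_bool (i \<in> S)))
      = measure_pmf.expectation (\<pi> x R) (\<lambda>S. \<Sum>i\<in>?J. y i * of_bool (i \<in> S))"
      by (subst Bochner_Integration.integral_sum) (auto intro!: integrable_measure_pmf_finite fin R)
    also have "\<dots> \<le> measure_pmf.expectation (\<pi> x R) (\<lambda>_. Max {\<Sum>i\<in>S. y i | S. S \<subseteq> R \<and> S \<in> \<I>})"
    proof (intro expectation_mono_finite fin R)
      fix S assume "S \<in> set_pmf (\<pi> x R)"
      note S = \<pi>_sub[OF R this]
      have "(\<Sum>i\<in>?J. y i * of_bool (i \<in> S)) = (\<Sum>i\<in>S. y i)"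
        using S N by (intro sum.mono_neutral_cong_right) auto
      also have "\<dots> \<le> Max {\<Sum>i\<in>S. y i | S. S \<subseteq> R \<and> S \<in> \<I>}"
      proof (rule Max_ge)
        have "{\<Sum>i\<in>S. y i | S. S \<subseteq> R \<and> S \<in> \<I>} \<subseteq> (\<lambda>S. \<Sum>i\<in>S. y i) ` Pow N" using R by auto
        then show "finite {\<Sum>i\<in>S. y i | S. S \<subseteq> R \<and> S \<in> \<I>}" by (rule finite_subset) (use N in auto)
      qed (use S in auto)
      finally show "(\<Sum>i\<in>?J. y i * of_bool (i \<in> S)) \<le> Max {\<Sum>i\<in>S. y i | S. S \<subseteq> R \<and> S \<in> \<I>}" .
    qed
    finally show "(\<Sum>i\<in>?J. y i * measure_pmf.expectation (\<pi> x R) (\<lambda>S. of_bool (i \<in> S)))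
      \<le> Max {\<Sum>i\<in>S. y i | S. S \<subseteq> R \<and> S \<in> \<I>}" by simp
  qed
  finally show "c * (\<Sum>i\<in>N. y i * x i) \<le> ?E (\<lambda>R. Max {\<Sum>i\<in>S. y i | S. S \<subseteq> R \<and> S \<in> \<I>})" .
qed

text \<open>The minimax direction. Pure strategies choose a feasible subset of every
  \<open>A \<subseteq> N\<close>; taking extensional functions makes their number finite. The gap
  condition for \<open>y i / x i\<close> says that the maximizing map is a good enough response to
  \<open>y\<close>.\<close>

lemma gap_condition_imp_mixture:
  assumes N: "finite N" and \<I>: "{} \<in> \<I>" and x: "x \<in> unit_cube N" and gap: "gap_condition N \<I> x c"
  shows "\<exists>q :: ('a set \<Rightarrow> 'a set) pmf. finite (set_pmf q) \<and>
    (\<forall>f\<in>set_pmf q. \<forall>A\<subseteq>N. f A \<subseteq> A \<and> f A \<in> \<I>) \<and>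
    (\<forall>i\<in>{i\<in>N. x i > 0}. c \<le> measure_pmf.expectation q (\<lambda>f. inclusion N x f i))"
proof -
  let ?J = "{i\<in>N. x i > 0}"
  define F where "F = (\<Pi>\<^sub>E A\<in>Pow N. {S. S \<subseteq> A \<and> S \<in> \<I>})"
  have "finite {S. S \<subseteq> A \<and> S \<in> \<I>}" if "A \<in> Pow N" for A
    by (rule finite_subset[of _ "Pow N"]) (use that N in auto)
  then have F: "finite F" "f \<in> F \<Longrightarrow> A \<subseteq> N \<Longrightarrow> f A \<subseteq> A \<and> f A \<in> \<I>" for f A
    unfolding F_def using N by (auto intro!: finite_PiE dest: PiE_mem)
  have "\<exists>q. set_pmf q \<subseteq> F \<and> (\<forall>i\<in>?J. c \<le> measure_pmf.expectation q (\<lambda>f. inclusion N x f i))"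
  proof (rule minimax)
    have "(\<lambda>A\<in>Pow N. {}) \<in> F" using \<I> by (auto simp: F_def)
    then show "F \<noteq> {}" by blast
    show "0 \<le> inclusion N x f i \<and> inclusion N x f i \<le> 1" if "f \<in> F" "i \<in> ?J" for f i
      using that F by (intro inclusion_between_0_1 N x) auto
    fix y :: "'a \<Rightarrow> real" assume y: "\<And>i. i \<in> ?J \<Longrightarrow> 0 < y i"
    define y' where "y' i = (if i \<in> ?J then y i / x i else 0)" for i
    define f where "f A = (SOME S. max_weight_subset \<I> y' A S)" for A
    have f: "max_weight_subset \<I> y' A (f A)" if "A \<subseteq> N" for A
      unfolding f_def by (rule someI_ex) (rule ex_max_weight_subset[OF finite_subset[OF that N] \<I>])
    let ?f = "\<lambda>A\<in>Pow N. f A"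
    have f': "A \<subseteq> N \<Longrightarrow> max_weight_subset \<I> y' A (?f A)" for A using f by simp
    have "?f \<in> F" using f by (auto simp: F_def max_weight_subset_def)
    moreover have "c * (\<Sum>i\<in>?J. y i) \<le> (\<Sum>i\<in>?J. y i * inclusion N x ?f i)"
    proof -
      have "c * (\<Sum>i\<in>?J. y i) = c * (\<Sum>i\<in>?J. y' i * x i)"
        by (intro arg_cong[of _ _ "(*) c"] sum.cong) (auto simp: y'_def)
      also have "\<dots> = c * (\<Sum>i\<in>N. y' i * x i)" by (simp only: sum_positive_part[OF N x])
      also have "\<dots> \<le> measure_pmf.expectation (random_subset N x) (\<lambda>R. Max {\<Sum>i\<in>S. y' i | S. S \<subseteq> R \<and> S \<in> \<I>})"
      proof -
        have "\<forall>i\<in>N. 0 \<le> y' i" using y by (auto simp: y'_def less_imp_le)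
        then show ?thesis using gap unfolding gap_condition_def by blast
      qed
      also have "\<dots> = (\<Sum>i\<in>?J. y' i * x i * inclusion N x ?f i)"
        by (rule expectation_max_weight[OF N f' x])
      also have "\<dots> = (\<Sum>i\<in>?J. y i * inclusion N x ?f i)"
        by (intro sum.cong) (auto simp: y'_def)
      finally show ?thesis .
    qed
    ultimately show "\<exists>f\<in>F. c * (\<Sum>i\<in>?J. y i) \<le> (\<Sum>i\<in>?J. y i * inclusion N x f i)" by blast
  qed (use N F in auto)
  then obtain q where q: "set_pmf q \<subseteq> F" "\<forall>i\<in>?J. c \<le> measure_pmf.expectation q (\<lambda>f. inclusion N x f i)" by blast
  then have "\<forall>f\<in>set_pmf q. \<forall>A\<subseteq>N. f A \<subseteq> A \<and> f A \<in> \<I>"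
    using F(2) by blast
  with q show ?thesis
    using finite_subset[OF q(1) F(1)] by blast
qed

lemma balanced_iff_gap_condition:
  assumes N: "finite N" and \<I>: "{} \<in> \<I>" and P: "relaxation N \<I> P" "b \<in> {0..1}"
  shows "(\<exists>\<pi>. balanced_crs N \<I> P b c \<pi>) \<longleftrightarrow> (\<forall>x\<in>scaled b P. gap_condition N \<I> x c)"
proof (intro iffI ballI)
  fix x assume "\<exists>\<pi>. balanced_crs N \<I> P b c \<pi>" "x \<in> scaled b P"
  then show "gap_condition N \<I> x c" using balanced_imp_gap_condition[OF N \<I> P] by blast
next
  assume gap: "\<forall>x\<in>scaled b P. gap_condition N \<I> x c"
  then have "\<forall>x\<in>scaled b P. \<exists>q :: ('a set \<Rightarrow> 'a set) pmf. finite (set_pmf q) \<and>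
    (\<forall>f\<in>set_pmf q. \<forall>A\<subseteq>N. f A \<subseteq> A \<and> f A \<in> \<I>) \<and>
    (\<forall>i\<in>{i\<in>N. x i > 0}. c \<le> measure_pmf.expectation q (\<lambda>f. inclusion N x f i))"
    using gap_condition_imp_mixture[OF N \<I> scaled_in_unit_cube[OF P]] by blast
  then obtain q :: "('a \<Rightarrow> real) \<Rightarrow> ('a set \<Rightarrow> 'a set) pmf" where
    q: "\<forall>x\<in>scaled b P. finite (set_pmf (q x)) \<and> (\<forall>f\<in>set_pmf (q x). \<forall>A\<subseteq>N. f A \<subseteq> A \<and> f A \<in> \<I>) \<and>
    (\<forall>i\<in>{i\<in>N. x i > 0}. c \<le> measure_pmf.expectation (q x) (\<lambda>f. inclusion N x f i))"
    by (auto dest!: bchoice)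
  have "balanced_crs N \<I> P b c (\<lambda>x. mixture N x (q x) (\<lambda>f. f))"
    by (rule balanced_mixture[OF N P]) (use q in auto)
  then show "\<exists>\<pi>. balanced_crs N \<I> P b c \<pi>" by blast
qed

text \<open>Every pair of \<open>x\<close> and \<open>y\<close> imposes a closed condition on
  \<open>c\<close>, so the admissible values in the unit interval form a compact set. It contains 0
  because of the scheme that always returns the empty set.\<close>

lemma ex_largest_balance:
  assumes N: "finite N" and \<I>: "{} \<in> \<I>" and P: "relaxation N \<I> P" "b \<in> {0..1}"
  shows "\<exists>c. largest_balance N \<I> P b c"
proof -
  define C where "C = {c\<in>{0..1}. \<forall>x\<in>scaled b P. gap_condition N \<I> x c}"
  let ?E = "\<lambda>x y. measure_pmf.expectation (random_subset N x) (\<lambda>R. Max {\<Sum>i\<in>S. y i | S. S \<subseteq> R \<and> S \<in> \<I>})"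
  have "closed {c. c * (\<Sum>i\<in>N. y i * x i) \<le> ?E x y}" for x y
    by (intro closed_Collect_le continuous_intros)
  moreover have "C = {0..1} \<inter> (\<Inter>x\<in>scaled b P. \<Inter>y\<in>{y. \<forall>i\<in>N. 0 \<le> y i}. {c. c * (\<Sum>i\<in>N. y i * x i) \<le> ?E x y})"
    by (auto simp: C_def gap_condition_def)
  ultimately have "closed C" by (auto intro!: closed_Int closed_INT)
  moreover have "C \<subseteq> {0..1}" by (auto simp: C_def)
  ultimately have "compact C"
    using compact_Int_closed[of "{0..1 :: real}" C] by (simp add: Int_absorb1)
  moreover have "0 \<in> C"
  proof -
    have "balanced_crs N \<I> P b 0 (\<lambda>x. mixture N x (return_pmf ()) (\<lambda>_ _. {}))"
      by (rule balanced_mixture[OF N P]) (use \<I> in \<open>auto simp: inclusion_def\<close>)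
    then show ?thesis using balanced_iff_gap_condition[OF N \<I> P, of 0] by (auto simp: C_def)
  qed
  ultimately obtain c where c: "c \<in> C" "\<forall>c'\<in>C. c' \<le> c"
    using compact_attains_sup[of C] by blast
  then show ?thesis
    unfolding largest_balance_def balanced_iff_gap_condition[OF N \<I> P]
    by (intro exI[of _ c]) (auto simp: C_def)
qed

section \<open>The distribution of the random bits\<close>

abbreviation coins :: "nat \<Rightarrow> bool list pmf" where
  "coins m \<equiv> pmf_of_set {r. length r = m}"

lemma finite_bool_lists: "finite {r :: bool list. length r = m}"
  using finite_lists_length_eq[of "UNIV :: bool set" m] by simp

lemma card_bool_lists: "card {r :: bool list. length r = m} = 2 ^ m"
  using card_lists_length_eq[of "UNIV :: bool set" m] by simp

lemma bool_lists_nonempty: "{r :: bool list. length r = m} \<noteq> {}"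
  using length_replicate[of m True] by blast

lemma set_coins [simp]: "set_pmf (coins m) = {r. length r = m}"
  by (rule set_pmf_of_set[OF bool_lists_nonempty finite_bool_lists])

text \<open>Fair bits split into independent blocks; the independence of elements, of rounds and of
  the drawn round all comes from here.\<close>

lemma coins_add: "coins (a + b) = bind_pmf (coins a) (\<lambda>u. map_pmf (\<lambda>v. u @ v) (coins b))"
proof -
  let ?A = "{r :: bool list. length r = a}" and ?B = "{r :: bool list. length r = b}"
  have "pair_pmf (coins a) (coins b) = pmf_of_set (?A \<times> ?B)"
  proof (rule pmf_eqI)
    fix z :: "bool list \<times> bool list"
    have "finite (?A \<times> ?B)" "?A \<times> ?B \<noteq> {}"
      using finite_bool_lists bool_lists_nonempty by auto
    then show "pmf (pair_pmf (coins a) (coins b)) z = pmf (pmf_of_set (?A \<times> ?B)) z"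
      by (cases z) (simp add: pmf_pair finite_bool_lists bool_lists_nonempty card_cartesian_product indicator_def)
  qed
  moreover have "map_pmf (\<lambda>(u, v). u @ v) (pmf_of_set (?A \<times> ?B)) = coins (a + b)"
  proof (rule map_pmf_of_set_bij_betw)
    show "bij_betw (\<lambda>(u, v). u @ v) (?A \<times> ?B) {r. length r = a + b}"
      by (rule bij_betwI[where g = "\<lambda>r. (take a r, drop a r)"]) auto
  qed (use finite_bool_lists bool_lists_nonempty in auto)
  ultimately have "coins (a + b) = map_pmf (\<lambda>(u, v). u @ v) (pair_pmf (coins a) (coins b))" by simp
  then show ?thesis
    by (simp add: pair_pmf_def map_bind_pmf map_pmf_def bind_assoc_pmf bind_return_pmf)
qed

text \<open>Allows surplus bits: the supply must be a polynomial in the input size, whereas the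
  number of bits actually needed only has such a bound.\<close>

lemma map_pmf_coins_prefix:
  assumes "a \<le> m" "\<And>u v. length u = a \<Longrightarrow> g (u @ v) = g u"
  shows "map_pmf g (coins m) = map_pmf g (coins a)"
proof -
  have "map_pmf g (coins (a + (m - a))) = bind_pmf (coins a) (\<lambda>u. map_pmf (\<lambda>v. g (u @ v)) (coins (m - a)))"
    by (simp add: coins_add map_bind_pmf pmf.map_comp o_def)
  also have "\<dots> = bind_pmf (coins a) (\<lambda>u. map_pmf (\<lambda>v. g u) (coins (m - a)))"
    using assms(2) by (intro bind_pmf_cong refl map_pmf_cong) auto
  finally show ?thesis using assms(1) by (simp add: map_pmf_const map_pmf_def)
qed

lemma bval_inject: "length r = length r' \<Longrightarrow> bval r = bval r' \<Longrightarrow> r = r'"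
proof (induction r arbitrary: r' rule: rev_induct)
  case (snoc c r)
  then obtain s d where "r' = s @ [d]" by (cases r' rule: rev_exhaust) auto
  with snoc show ?case by (auto split: if_splits) presburger+
qed simp

lemma map_pmf_bval: "map_pmf bval (coins m) = pmf_of_set {..<2 ^ m}"
proof (rule map_pmf_of_set_bij_betw[OF _ bool_lists_nonempty finite_bool_lists])
  have inj: "inj_on bval {r. length r = m}" by (auto intro!: inj_onI bval_inject)
  moreover have "bval ` {r. length r = m} = {..<2 ^ m}"
    by (rule card_subset_eq) (use bval_less in \<open>auto simp: card_image[OF inj] card_bool_lists\<close>)
  ultimately show "bij_betw bval {r. length r = m} {..<2 ^ m}" by (simp add: bij_betw_def)
qed

lemma map_pmf_bval_less:
  assumes "\<theta> \<le> 2 ^ m"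
  shows "map_pmf (\<lambda>r. bval r < \<theta>) (coins m) = bernoulli_pmf (real \<theta> / 2 ^ m)"
proof -
  have "map_pmf (\<lambda>u. u < \<theta>) (pmf_of_set {..<2 ^ m}) = bernoulli_pmf (real \<theta> / 2 ^ m)"
  proof (rule pmf_eqI)
    fix c :: bool
    have "real \<theta> \<le> 2 ^ m" using assms by (metis of_nat_le_iff of_nat_numeral of_nat_power)
    then have p: "0 \<le> real \<theta> / 2 ^ m" "real \<theta> / 2 ^ m \<le> 1" by simp_all
    have ne: "{..<(2 :: nat) ^ m} \<noteq> {}" by (simp add: lessThan_empty_iff)
    show "pmf (map_pmf (\<lambda>u. u < \<theta>) (pmf_of_set {..<2 ^ m})) c = pmf (bernoulli_pmf (real \<theta> / 2 ^ m)) c"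
    proof (cases c)
      case True
      have "{..<2 ^ m} \<inter> {u. u < \<theta>} = {..<\<theta>}" using assms by auto
      then show ?thesis using True ne p by (simp add: pmf_map vimage_def measure_pmf_of_set)
    next
      case False
      have "{..<2 ^ m} \<inter> {u. \<not> u < \<theta>} = {\<theta>..<2 ^ m}" using assms by auto
      then show ?thesis using False ne p assms
        by (simp add: pmf_map vimage_def measure_pmf_of_set of_nat_diff diff_divide_distrib)
    qed
  qed
  then show ?thesis unfolding map_pmf_bval[symmetric] by (simp add: pmf.map_comp o_def)
qed

section \<open>Distribution of the samples and of the weights\<close>

definition rounded :: "nat \<Rightarrow> (nat \<Rightarrow> rat) \<Rightarrow> nat \<Rightarrow> real" where
  "rounded l x j = real (num (x j) * 2 ^ l div den (x j)) / 2 ^ l"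

lemma sample_append: "n * l \<le> length u \<Longrightarrow> sample l n x (u @ v) = sample l n x u"
proof -
  assume len: "n * l \<le> length u"
  have "take l (drop (j * l) (u @ v)) = take l (drop (j * l) u)" if "j < n" for j
  proof -
    have "Suc j * l \<le> n * l" by (rule mult_right_mono) (use that in auto)
    then show ?thesis using len by simp
  qed
  then show ?thesis
    unfolding sample_def by (intro Collect_cong conj_cong refl) (simp only:)
qed

lemma map_pmf_sample:
  assumes "\<And>j. j < n \<Longrightarrow> num (x j) * 2 ^ l div den (x j) \<le> 2 ^ l"
  shows "map_pmf (sample l n x) (coins (n * l)) = random_subset {..<n} (rounded l x)"
  using assms
proof (induction n)
  case 0
  have "sample l 0 x = (\<lambda>_. {})" by (simp add: sample_def fun_eq_iff)
  then show ?case by (simp add: random_subset_empty map_pmf_const)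
next
  case (Suc n)
  let ?\<theta> = "num (x n) * 2 ^ l div den (x n)"
  have step: "sample l (Suc n) x (u @ v) = (if bval v < ?\<theta> then insert n (sample l n x u) else sample l n x u)"
    if "length u = n * l" "length v = l" for u v
  proof -
    have "sample l (Suc n) x (u @ v) = sample l n x (u @ v) \<union> (if bval v < ?\<theta> then {n} else {})"
      using that by (auto simp: sample_def less_Suc_eq)
    then show ?thesis using that by (simp add: sample_append)
  qed
  have "map_pmf (sample l (Suc n) x) (coins (n * l + l)) =
    bind_pmf (coins (n * l)) (\<lambda>u. map_pmf (\<lambda>v. sample l (Suc n) x (u @ v)) (coins l))"
    by (simp add: coins_add map_bind_pmf pmf.map_comp o_def)
  also have "\<dots> = bind_pmf (coins (n * l)) (\<lambda>u. map_pmf (\<lambda>v. if bval v < ?\<theta> then insert n (sample l n x u) else sample l n x u) (coins l))"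
    by (intro bind_pmf_cong refl map_pmf_cong) (simp add: step)
  \<comment> \<open>\<open>random_subset_insert\<close> draws the new element first, whereas its
    bits come last; independence permits the exchange.\<close>
  also have "\<dots> = bind_pmf (coins l) (\<lambda>v. bind_pmf (coins (n * l)) (\<lambda>u. return_pmf (if bval v < ?\<theta> then insert n (sample l n x u) else sample l n x u)))"
    unfolding map_pmf_def by (rule bind_commute_pmf)
  also have "\<dots> = bind_pmf (map_pmf (\<lambda>v. bval v < ?\<theta>) (coins l)) (\<lambda>c. map_pmf (\<lambda>R. if c then insert n R else R) (map_pmf (sample l n x) (coins (n * l))))"
    by (simp add: map_pmf_def bind_assoc_pmf bind_return_pmf)
  also have "map_pmf (sample l n x) (coins (n * l)) = random_subset {..<n} (rounded l x)"
    by (rule Suc.IH) (use Suc.prems in simp)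
  also have "bind_pmf (map_pmf (\<lambda>v. bval v < ?\<theta>) (coins l)) (\<lambda>c. map_pmf (\<lambda>R. if c then insert n R else R)
    (random_subset {..<n} (rounded l x))) = random_subset {..<Suc n} (rounded l x)"
    unfolding lessThan_Suc
    by (subst random_subset_insert) (simp_all add: map_pmf_bval_less Suc.prems rounded_def)
  finally show ?case by (simp add: add.commute)
qed

lemma iterate_append:
  "t * (n * precision k n) \<le> length u \<Longrightarrow> iterate f k n x (u @ v) t = iterate f k n x u t"
proof (induction t)
  case (Suc t)
  then have "n * precision k n \<le> length (drop (t * (n * precision k n)) u)"
    "t * (n * precision k n) \<le> length u" by simp_all
  with Suc.IH show ?case by (simp add: sample_append)
qed simp

text \<open>The law of the weights with the bits abstracted away: \<open>D\<close> is the law of one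
  sample, drawn afresh in each step, as \<open>multiplicative_weights\<close> expects.\<close>

primrec chain where
  "chain f k n x D 0 = return_pmf (\<lambda>_. 1)"
| "chain f k n x D (Suc t) = bind_pmf (chain f k n x D t) (\<lambda>\<omega>. map_pmf (update f k n x \<omega>) D)"

lemma map_pmf_iterate:
  assumes "t * (n * precision k n) \<le> m"
  shows "map_pmf (\<lambda>r. iterate f k n x r t) (coins m) =
    chain f k n x (map_pmf (sample (precision k n) n x) (coins (n * precision k n))) t"
proof -
  let ?B = "n * precision k n"
  have "map_pmf (\<lambda>r. iterate f k n x r t) (coins (t * ?B)) =
    chain f k n x (map_pmf (sample (precision k n) n x) (coins ?B)) t"
  proof (induction t)
    case (Suc t)
    have "map_pmf (\<lambda>r. iterate f k n x r (Suc t)) (coins (t * ?B + ?B)) =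
      bind_pmf (coins (t * ?B)) (\<lambda>u. map_pmf (\<lambda>v. iterate f k n x (u @ v) (Suc t)) (coins ?B))"
      by (simp only: coins_add map_bind_pmf pmf.map_comp o_def)
    also have "\<dots> = bind_pmf (coins (t * ?B)) (\<lambda>u. map_pmf (\<lambda>v. update f k n x (iterate f k n x u t) (sample (precision k n) n x v)) (coins ?B))"
      by (intro bind_pmf_cong refl map_pmf_cong) (simp add: iterate_append)
    also have "\<dots> = chain f k n x (map_pmf (sample (precision k n) n x) (coins ?B)) (Suc t)"
      by (simp add: Suc[symmetric] bind_map_pmf pmf.map_comp o_def)
    finally show ?case by (simp add: add.commute)
  qed (simp add: map_pmf_const)
  moreover have "map_pmf (\<lambda>r. iterate f k n x r t) (coins m) = map_pmf (\<lambda>r. iterate f k n x r t) (coins (t * ?B))"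
    by (rule map_pmf_coins_prefix[OF assms]) (simp add: iterate_append)
  ultimately show ?thesis by simp
qed

lemma steps_length_le:
  assumes "length u = horizon_bits k n"
  shows "bval u * (n * precision k n) \<le> 2 ^ horizon_bits k n * (n * precision k n)"
  using bval_less[of u] assms by (intro mult_right_mono) auto

lemma final_weight_append:
  assumes "length u = bits_used k n"
  shows "final_weight f k n x (u @ v) = final_weight f k n x u"
proof -
  have "length (take (horizon_bits k n) u) = horizon_bits k n"
    using assms by (simp add: bits_used_def)
  from steps_length_le[OF this] show ?thesis
    using assms by (simp add: final_weight_def bits_used_def iterate_append)
qed

text \<open>The leading bits are exactly uniform on the rounds below \<open>T\<close> and
  independent of the bits that drive the chain, so the output averages over the rounds just as the
  regret bound does.\<close>

lemma expectation_final_weight: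
  fixes h :: "(nat \<Rightarrow> rat) \<Rightarrow> real" and k n :: nat
  defines "T \<equiv> 2 ^ horizon_bits k n" and "B \<equiv> n * precision k n"
  shows "measure_pmf.expectation (coins (bits_used k n)) (\<lambda>r. h (final_weight f k n x r)) =
    (\<Sum>t<T. measure_pmf.expectation (chain f k n x (map_pmf (sample (precision k n) n x) (coins B)) t)
       (\<lambda>\<omega>. h (weight n x \<omega>))) / T"
proof -
  let ?J = "horizon_bits k n"
  let ?D = "chain f k n x (map_pmf (sample (precision k n) n x) (coins B))"
  have "measure_pmf.expectation (coins (bits_used k n)) (\<lambda>r. h (final_weight f k n x r)) =
    measure_pmf.expectation (coins ?J) (\<lambda>u. measure_pmf.expectation (coins (T * B)) (\<lambda>v. h (final_weight f k n x (u @ v))))"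
    unfolding bits_used_def coins_add T_def B_def
    by (subst expectation_bind_finite) (simp_all add: finite_bool_lists)
  also have "\<dots> = measure_pmf.expectation (coins ?J) (\<lambda>u. measure_pmf.expectation (?D (bval u)) (\<lambda>\<omega>. h (weight n x \<omega>)))"
  proof (rule expectation_cong_pmf)
    fix u assume "u \<in> set_pmf (coins ?J)"
    then have u: "length u = ?J" by simp
    show "measure_pmf.expectation (coins (T * B)) (\<lambda>v. h (final_weight f k n x (u @ v))) =
      measure_pmf.expectation (?D (bval u)) (\<lambda>\<omega>. h (weight n x \<omega>))"
      using map_pmf_iterate[OF steps_length_le[OF u], of f x, symmetric]
      by (simp add: final_weight_def u T_def B_def)
  qed
  also have "\<dots> = measure_pmf.expectation (map_pmf bval (coins ?J)) (\<lambda>t. measure_pmf.expectation (?D t) (\<lambda>\<omega>. h (weight n x \<omega>)))"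
    by simp
  also have "\<dots> = (\<Sum>t<T. measure_pmf.expectation (?D t) (\<lambda>\<omega>. h (weight n x \<omega>))) / T"
    unfolding map_pmf_bval T_def by (subst integral_pmf_of_set) (simp_all add: lessThan_empty_iff)
  finally show ?thesis .
qed

section \<open>The guarantee of the algorithm\<close>

lemma den_pos: "0 < den q"
  using quotient_of_denom_pos'[of q] by (simp add: den_def)

lemma of_rat_num_den:
  assumes "0 \<le> q" shows "of_rat q = real (num q) / real (den q)"
proof -
  obtain a b where ab: "quotient_of q = (a, b)" by fastforce
  then have q: "q = of_int a / of_int b" and b: "b > 0"
    by (rule quotient_of_div, rule quotient_of_denom_pos)
  have "0 \<le> a" using assms b by (simp add: q zero_le_divide_iff)
  moreover have "of_rat q = real_of_int a / real_of_int b"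
    by (simp add: q of_rat_divide)
  ultimately show ?thesis using b by (simp add: num_def den_def ab)
qed

lemma rounded_bounds:
  assumes "0 \<le> x j" "x j \<le> 1"
  shows "num (x j) * 2 ^ l div den (x j) \<le> 2 ^ l" "rounded l x j \<in> {0..1}"
    "\<bar>rounded l x j - of_rat (x j)\<bar> \<le> 1 / 2 ^ l"
proof -
  let ?m = "num (x j)" and ?d = "den (x j)"
  have eq: "of_rat (x j) = real ?m / real ?d" by (rule of_rat_num_den[OF assms(1)])
  have "of_rat (x j) \<le> (1 :: real)" using assms(2) by simp
  then have "?m \<le> ?d" using den_pos[of "x j"] by (simp add: eq)
  then have "?m * 2 ^ l div ?d \<le> ?d * 2 ^ l div ?d" by (intro div_le_mono mult_right_mono) auto
  then show le: "?m * 2 ^ l div ?d \<le> 2 ^ l" using den_pos[of "x j"] by simp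
  then have "real (?m * 2 ^ l div ?d) \<le> 2 ^ l" by (metis of_nat_le_iff of_nat_numeral of_nat_power)
  then show "rounded l x j \<in> {0..1}" by (simp add: rounded_def)
  have "real (?m * 2 ^ l div ?d) = real_of_int \<lfloor>real (?m * 2 ^ l) / real ?d\<rfloor>"
    by (simp only: floor_divide_of_nat_eq of_int_of_nat_eq)
  then have "\<bar>real (?m * 2 ^ l div ?d) - real (?m * 2 ^ l) / real ?d\<bar> \<le> 1" by linarith
  then have "\<bar>real (?m * 2 ^ l div ?d) - real (?m * 2 ^ l) / real ?d\<bar> / 2 ^ l \<le> 1 / 2 ^ l"
    by (intro divide_right_mono) auto
  moreover have "rounded l x j - of_rat (x j) = (real (?m * 2 ^ l div ?d) - real (?m * 2 ^ l) / real ?d) / 2 ^ l"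
    by (simp add: rounded_def eq diff_divide_distrib)
  ultimately show "\<bar>rounded l x j - of_rat (x j)\<bar> \<le> 1 / 2 ^ l" by (simp only: abs_divide) simp
qed

lemma max_weight_subset_of_rat:
  "max_weight_subset \<I> y A S \<Longrightarrow> max_weight_subset \<I> (\<lambda>i. of_rat (y i) :: real) A S"
  by (auto simp: max_weight_subset_def of_rat_less_eq simp flip: of_rat_sum)

lemma support_eq:
  assumes "(\<lambda>i. of_rat (x i)) \<in> unit_cube {..<n}"
  shows "support n x = {i\<in>{..<n}. (of_rat (x i) :: real) > 0}"
proof -
  have "0 < num (x i) \<longleftrightarrow> (of_rat (x i) :: real) > 0" if "i < n" for i
    using assms that den_pos[of "x i"] of_rat_num_den[of "x i"] by (simp add: unit_cube_def zero_less_divide_iff)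
  then show ?thesis by (auto simp: support_def)
qed

text \<open>Up to a common factor the solver thus sees \<open>\<omega> i / x i\<close>. With
  truncated subtraction, \<open>num (x j) + (1 - num (x j))\<close> is the maximum of
  \<open>num (x j)\<close> and 1, so zero entries do not annihilate the product, and positive
  numerators divide it.\<close>

lemma weight_times:
  assumes "i < n" "0 \<le> x i" "0 < num (x i)"
  shows "of_rat (weight n x \<omega> i) * of_rat (x i) = real (\<omega> i) * real (\<Prod>j<n. num (x j) + (1 - num (x j)))"
proof -
  let ?M = "\<Prod>j<n. num (x j) + (1 - num (x j))"
  have "num (x i) + (1 - num (x i)) dvd ?M" using assms by (intro dvd_prodI) auto
  then have dvd: "num (x i) dvd ?M" using assms(3) by simp
  have "of_rat (weight n x \<omega> i) * of_rat (x i) =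
    real (\<omega> i * den (x i) * (?M div num (x i))) * (real (num (x i)) / real (den (x i)))"
    using assms by (simp add: weight_def of_rat_num_den del: of_nat_mult)
  also have "\<dots> = real (\<omega> i * (?M div num (x i) * num (x i)))"
    using den_pos[of "x i"] by simp
  also have "?M div num (x i) * num (x i) = ?M" using dvd by simp
  finally show ?thesis by (simp del: of_nat_prod)
qed

text \<open>The loss \<open>1 / k\<close> has three parts: rounding costs
  \<open>\<delta> \<le> 1 / (8 * k)\<close> twice, in \<open>best\<close> and in
  \<open>E_le\<close>; the factor \<open>1 + 1 / (4 * k)\<close> costs \<open>1 / (4 * k)\<close>,
  as payoffs are at most 1; the logarithmic term, divided by the horizon, costs
  \<open>1 / (2 * k)\<close>.\<close>

theorem final_weight_guarantee:
  fixes x :: "nat \<Rightarrow> rat" and f :: "(nat \<Rightarrow> rat) \<Rightarrow> nat set \<Rightarrow> nat set"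
  defines "x' \<equiv> \<lambda>i. of_rat (x i) :: real"
  assumes f: "\<And>y A. (\<And>i. 0 \<le> y i) \<Longrightarrow> A \<subseteq> {..<n} \<Longrightarrow> max_weight_subset \<I> y A (f y A)"
    and x: "x' \<in> unit_cube {..<n}" and gap: "gap_condition {..<n} \<I> x' c"
    and k: "k \<ge> 1" and i: "i < n" "x' i > 0"
  shows "c - 1 / k \<le> measure_pmf.expectation (coins (bits_used k n))
    (\<lambda>r. inclusion {..<n} x' (f (final_weight f k n x r)) i)"
proof -
  let ?N = "{..<n}" and ?l = "precision k n" and ?T = "2 ^ horizon_bits k n :: nat"
  let ?I = "{i\<in>{..<n}. x' i > 0}"
  let ?D = "map_pmf (sample ?l n x) (coins (n * ?l))"
  let ?h = "\<lambda>\<omega> R j. of_bool (j \<in> f (weight n x \<omega>) (insert j R)) :: real"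
  let ?inc = "\<lambda>\<omega> j. inclusion ?N x' (f (weight n x \<omega>)) j"
  have x01: "0 \<le> x j \<and> x j \<le> 1" if "j < n" for j
    using x that by (simp add: unit_cube_def x'_def)
  have D: "?D = random_subset ?N (rounded ?l x)"
    by (rule map_pmf_sample) (use rounded_bounds x01 in blast)
  have finD: "finite (set_pmf ?D)" unfolding D by (simp add: finite_set_random_subset)
  have fw: "max_weight_subset \<I> (weight n x \<omega>) A (f (weight n x \<omega>) A)" if "A \<subseteq> ?N" for \<omega> A
    using that by (intro f weight_nonneg)
  have sub: "f (weight n x \<omega>) A \<subseteq> A" if "A \<subseteq> ?N" for \<omega> A
    using fw[OF that] by (simp add: max_weight_subset_def)
  define \<delta> where "\<delta> = real n / 2 ^ ?l"
  have close: "\<bar>?inc \<omega> j - measure_pmf.expectation ?D (\<lambda>R. ?h \<omega> R j)\<bar> \<le> \<delta>" if j: "j \<in> ?I" for \<omega> j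
  proof -
    have "\<bar>measure_pmf.expectation (random_subset ?N x') (\<lambda>R. ?h \<omega> R j) -
        measure_pmf.expectation (random_subset ?N (rounded ?l x)) (\<lambda>R. ?h \<omega> R j)\<bar> \<le> (\<Sum>i\<in>?N. \<bar>x' i - rounded ?l x i\<bar>)"
      by (rule expectation_random_subset_perturb) (use x01 rounded_bounds(2) in \<open>auto simp: x'_def\<close>)
    also have "\<dots> \<le> (\<Sum>i\<in>?N. 1 / 2 ^ ?l)"
      by (rule sum_mono) (use x01 rounded_bounds(3) in \<open>simp add: x'_def abs_minus_commute\<close>)
    also have "\<dots> = \<delta>" by (simp add: \<delta>_def)
    also have "measure_pmf.expectation (random_subset ?N x') (\<lambda>R. ?h \<omega> R j) = ?inc \<omega> j"
      using j x sub by (intro inclusion_eq[symmetric]) auto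
    finally show ?thesis unfolding D .
  qed
  \<comment> \<open>The gap condition holds for the exact \<open>x\<close>, but the payoffs are
    sampled from the rounded point; \<open>close\<close> translates between them.\<close>
  have best: "(c - \<delta>) * (\<Sum>j\<in>?I. real (\<omega> j)) \<le> (\<Sum>j\<in>?I. real (\<omega> j) * measure_pmf.expectation ?D (\<lambda>R. ?h \<omega> R j))" for \<omega>
  proof -
    let ?y = "\<lambda>j. of_rat (weight n x \<omega> j) :: real"
    define M where "M = real (\<Prod>j<n. num (x j) + (1 - num (x j)))"
    have "0 < (\<Prod>j<n. num (x j) + (1 - num (x j)))" by (intro prod_pos) auto
    then have M: "M > 0" unfolding M_def by (simp only: of_nat_0_less_iff)
    have yx: "?y j * x' j = real (\<omega> j) * M" if "j \<in> ?I" for j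
    proof -
      have "0 < num (x j)" using that support_eq[of x n] x by (auto simp: x'_def support_def)
      then show ?thesis unfolding M_def x'_def using that x01 by (intro weight_times) auto
    qed
    have "c * (\<Sum>j\<in>?I. real (\<omega> j) * M) = c * (\<Sum>j\<in>?N. ?y j * x' j)"
      unfolding sum_positive_part[OF finite_lessThan x] by (simp add: yx)
    also have "\<dots> \<le> measure_pmf.expectation (random_subset ?N x') (\<lambda>R. Max {\<Sum>i\<in>S. ?y i | S. S \<subseteq> R \<and> S \<in> \<I>})"
      using gap weight_nonneg unfolding gap_condition_def by simp
    also have "\<dots> = (\<Sum>j\<in>?I. ?y j * x' j * ?inc \<omega> j)"
      using x by (intro expectation_max_weight max_weight_subset_of_rat fw) auto
    also have "\<dots> = (\<Sum>j\<in>?I. real (\<omega> j) * M * ?inc \<omega> j)" by (simp add: yx)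
    finally have "c * (\<Sum>j\<in>?I. real (\<omega> j)) * M \<le> (\<Sum>j\<in>?I. real (\<omega> j) * ?inc \<omega> j) * M"
      by (simp add: sum_distrib_left sum_distrib_right mult_ac)
    then have "c * (\<Sum>j\<in>?I. real (\<omega> j)) \<le> (\<Sum>j\<in>?I. real (\<omega> j) * ?inc \<omega> j)" using M by simp
    also have "\<dots> \<le> (\<Sum>j\<in>?I. real (\<omega> j) * (measure_pmf.expectation ?D (\<lambda>R. ?h \<omega> R j) + \<delta>))"
    proof (intro sum_mono mult_left_mono)
      fix j assume "j \<in> ?I"
      from close[OF this, of \<omega>] show "?inc \<omega> j \<le> measure_pmf.expectation ?D (\<lambda>R. ?h \<omega> R j) + \<delta>" by linarith
    qed auto
    finally show ?thesis by (simp add: algebra_simps sum.distrib sum_subtractf sum_distrib_left)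
  qed
  let ?\<Omega> = "chain f k n x ?D"
  let ?E = "\<lambda>t. measure_pmf.expectation (?\<Omega> t) (\<lambda>\<omega>. measure_pmf.expectation ?D (\<lambda>R. ?h \<omega> R i))"
  have fin\<Omega>: "finite (set_pmf (?\<Omega> t))" for t
    by (induction t) (use finD in auto)
  have iI: "i \<in> ?I" using i by simp
  have mw: "(c - \<delta>) * real ?T \<le> (1 + 1 / (4 * real k)) * (\<Sum>t<?T. ?E t) + (4 * real k + 1) * ln (card ?I)"
  proof (rule multiplicative_weights[where \<Omega> = ?\<Omega> and D = ?D and wt = "\<lambda>\<omega> j. real (\<omega> j)" and s = "\<lambda>_. 1" and up = "update f k n x" and h = ?h and I = ?I and i = i and K = "4 * real k" and c = "c - \<delta>" and T = ?T])
    show "real (update f k n x \<omega> R j) = real (\<omega> j) * (4 * real k + 1 - ?h \<omega> R j)" for \<omega> R j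
      by (simp add: update_def of_nat_diff)
  qed (use finD k iI best in auto)
  have E_le_1: "?E t \<le> 1" for t
  proof -
    have "?E t \<le> measure_pmf.expectation (?\<Omega> t) (\<lambda>_. 1)"
      using expectation_between_0_1[OF finD, of "\<lambda>R. ?h _ R i"] by (intro expectation_mono_finite fin\<Omega>) auto
    then show ?thesis by simp
  qed
  have E_le: "?E t \<le> measure_pmf.expectation (?\<Omega> t) (\<lambda>\<omega>. ?inc \<omega> i) + \<delta>" for t
  proof -
    have "?E t \<le> measure_pmf.expectation (?\<Omega> t) (\<lambda>\<omega>. ?inc \<omega> i + \<delta>)"
    proof (intro expectation_mono_finite fin\<Omega>)
      fix \<omega>
      from close[OF iI, of \<omega>] show "measure_pmf.expectation ?D (\<lambda>R. ?h \<omega> R i) \<le> ?inc \<omega> i + \<delta>" by linarith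
    qed
    then show ?thesis by (simp add: integrable_measure_pmf_finite fin\<Omega>)
  qed
  define S where "S = (\<Sum>t<?T. measure_pmf.expectation (?\<Omega> t) (\<lambda>\<omega>. ?inc \<omega> i))"
  have "(\<Sum>t<?T. ?E t) \<le> (\<Sum>t<?T. measure_pmf.expectation (?\<Omega> t) (\<lambda>\<omega>. ?inc \<omega> i) + \<delta>)"
    by (rule sum_mono) (rule E_le)
  then have sumE: "(\<Sum>t<?T. ?E t) \<le> S + ?T * \<delta>" by (simp add: sum.distrib S_def)
  have "(\<Sum>t<?T. ?E t) \<le> (\<Sum>t<?T. 1)" by (rule sum_mono) (rule E_le_1)
  then have "(\<Sum>t<?T. ?E t) \<le> ?T" by simp
  then have sumE': "(\<Sum>t<?T. ?E t) / (4 * k) \<le> ?T / (4 * k)" by (rule divide_right_mono) simp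
  have ln: "(4 * k + 1) * ln (card ?I) \<le> ?T / (2 * k)"
  proof -
    have card: "0 < card ?I" "card ?I \<le> n"
      using iI card_mono[of ?N ?I] by (auto simp: card_gt_0_iff)
    \<comment> \<open>Bounding the logarithm by \<open>n\<close> lengthens the horizon but lets it
      be computed with integers alone.\<close>
    have "ln (real (card ?I)) < real (card ?I)" by (rule ln_less_self) (simp only: of_nat_0_less_iff card)
    also have "\<dots> \<le> real n" by (simp only: of_nat_le_iff card)
    finally have "ln (card ?I) \<le> n" by simp
    then have "real (4 * k + 1) * ln (card ?I) \<le> real (4 * k + 1) * real n" by (rule mult_left_mono) simp
    moreover have "(4 * k + 1) * n * (2 * k) \<le> ?T"
    proof -
      \<comment> \<open>Using \<open>4 * k + 1 \<le> 5 * k\<close>; the constant 10 of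
        \<open>horizon_bits\<close> arises here.\<close>
      have "(4 * k + 1) * n * (2 * k) \<le> (5 * k) * n * (2 * k)"
        using k by (intro mult_right_mono) auto
      also have "\<dots> = 10 * k * k * n" by simp
      also have "\<dots> \<le> ?T" unfolding horizon_bits_def by (rule less_imp_le[OF less_two_power_floorlog])
      finally show ?thesis .
    qed
    then have "real ((4 * k + 1) * n * (2 * k)) \<le> real ?T" by (simp only: of_nat_le_iff)
    then have "real (4 * k + 1) * real n \<le> ?T / (2 * k)" using k by (simp add: field_simps)
    ultimately show ?thesis by linarith
  qed
  have \<delta>: "\<delta> \<le> 1 / (8 * k)"
  proof -
    \<comment> \<open>The summands of \<open>precision\<close> in turn: \<open>2 ^ n\<close> and
      \<open>2 ^ k\<close> dominate \<open>n\<close> and \<open>k\<close>, and \<open>2 ^ 3\<close>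
      is the factor 8.\<close>
    have "n * k \<le> 2 ^ n * 2 ^ k" by (rule mult_mono) (auto intro: less_imp_le)
    then have "n * (8 * k) \<le> 8 * (2 ^ n * 2 ^ k)" by simp
    also have "\<dots> = 2 ^ ?l" by (simp add: precision_def power_add)
    finally have "real (n * (8 * k)) \<le> real (2 ^ ?l)" by (simp only: of_nat_le_iff)
    then have "real n * (8 * real k) \<le> 2 ^ ?l" by simp
    then show ?thesis using k by (simp add: \<delta>_def divide_le_eq le_divide_eq)
  qed
  have "(c - \<delta>) * ?T \<le> S + ?T * \<delta> + ?T / (4 * k) + ?T / (2 * k)"
    using mw sumE sumE' ln by (simp add: distrib_right)
  also have "\<dots> = S + ?T * (\<delta> + 1 / (4 * k) + 1 / (2 * k))"
    by (simp add: distrib_left)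
  finally have "(c - \<delta>) * ?T - ?T * (\<delta> + 1 / (4 * k) + 1 / (2 * k)) \<le> S" by simp
  then have "(c - (2 * \<delta> + 1 / (4 * k) + 1 / (2 * k))) * ?T \<le> S" by (simp add: algebra_simps)
  moreover have "2 * \<delta> + 1 / (4 * k) + 1 / (2 * k) \<le> 1 / k"
    using \<delta> k by (simp add: field_simps)
  then have "(c - 1 / k) * ?T \<le> (c - (2 * \<delta> + 1 / (4 * k) + 1 / (2 * k))) * ?T"
    by (intro mult_right_mono) auto
  ultimately have "(c - 1 / k) * ?T \<le> S" by linarith
  then have "c - 1 / k \<le> S / ?T" by (simp add: field_simps)
  also have "S / ?T = measure_pmf.expectation (coins (bits_used k n))
    (\<lambda>r. inclusion {..<n} x' (f (final_weight f k n x r)) i)"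
    unfolding S_def using expectation_final_weight[of k n "\<lambda>y. inclusion ?N x' (f y) i" f x] by simp
  finally show ?thesis .
qed

text \<open>Gives the scheme at the irrational points of \<open>bP\<close>, which the algorithm never receives as input.\<close>

lemma rational_weights_mixture:
  fixes f :: "('a \<Rightarrow> rat) \<Rightarrow> 'a set \<Rightarrow> 'a set"
  assumes N: "finite N"
    and f: "\<And>y A. (\<And>i. 0 \<le> y i) \<Longrightarrow> A \<subseteq> N \<Longrightarrow> max_weight_subset \<I> y A (f y A)"
    and x: "x \<in> unit_cube N" and gap: "gap_condition N \<I> x c" and c: "c \<in> {0..1}" and \<epsilon>: "\<epsilon> > 0"
  shows "\<exists>q. finite (set_pmf q) \<and> set_pmf q \<subseteq> {y. \<forall>i. 0 \<le> y i} \<and>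
    (\<forall>i\<in>{i\<in>N. x i > 0}. c - \<epsilon> \<le> measure_pmf.expectation q (\<lambda>y. inclusion N x (f y) i))"
proof -
  let ?J = "{i\<in>N. x i > 0}" and ?F = "{y :: 'a \<Rightarrow> rat. \<forall>i. 0 \<le> y i}"
  have sub: "f y A \<subseteq> A" if "y \<in> ?F" "A \<subseteq> N" for y A
    using f[of y A] that by (simp add: max_weight_subset_def)
  have inc: "0 \<le> inclusion N x (f y) i \<and> inclusion N x (f y) i \<le> 1" if "y \<in> ?F" "i \<in> ?J" for y i
    using that sub by (intro inclusion_between_0_1 N x) auto
  \<comment> \<open>Pure strategies are rational weight vectors, so each is a use of the solver. One
    half of \<open>\<epsilon>\<close> is for the approximate minimax theorem, the other for making
    the weights rational.\<close>
  have "\<exists>q. finite (set_pmf q) \<and> set_pmf q \<subseteq> ?F \<and>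
    (\<forall>i\<in>?J. (c - \<epsilon> / 2) - \<epsilon> / 2 \<le> measure_pmf.expectation q (\<lambda>y. inclusion N x (f y) i))"
  proof (rule minimax_approx)
    have "(\<lambda>_. 0) \<in> ?F" by simp
    then show "?F \<noteq> {}" by blast
    fix y :: "'a \<Rightarrow> real" assume y: "\<And>i. i \<in> ?J \<Longrightarrow> 0 < y i"
    \<comment> \<open>The real weights \<open>y i / x i\<close> are approximated from above within
      this factor. As \<open>c \<le> 1\<close>, \<open>(c - \<epsilon> / 2) * ?d \<le> c\<close>, so
      the loss is at most \<open>\<epsilon> / 2\<close>.\<close>
    let ?d = "1 + \<epsilon> / 2"
    have "\<exists>q. y i / x i < of_rat q \<and> of_rat q < ?d * (y i / x i)" if "i \<in> ?J" for i
    proof (rule of_rat_dense)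
      have "0 < y i / x i" using y[OF that] that by simp
      then have "1 * (y i / x i) < ?d * (y i / x i)"
        using \<epsilon> by (intro mult_strict_right_mono) auto
      then show "y i / x i < ?d * (y i / x i)" by (simp only: mult_1_left)
    qed
    then obtain z where z: "\<And>i. i \<in> ?J \<Longrightarrow> y i / x i < of_rat (z i) \<and> of_rat (z i) < ?d * (y i / x i)"
      by metis
    define y' where "y' i = (if i \<in> ?J then z i else 0)" for i
    have y'x: "y i \<le> of_rat (y' i) * x i" "of_rat (y' i) * x i \<le> ?d * y i" if "i \<in> ?J" for i
      using z[OF that] that by (auto simp: y'_def field_simps)
    have y'F: "y' \<in> ?F"
    proof -
      have "0 \<le> z i" if i: "i \<in> ?J" for i
      proof -
        have "0 < y i / x i" using y[OF i] i by simp
        then have "(0 :: real) < of_rat (z i)" using z[OF i] by linarith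
        then show ?thesis by simp
      qed
      then show ?thesis by (simp add: y'_def)
    qed
    have "(c - \<epsilon> / 2) * (\<Sum>i\<in>?J. y i) * ?d \<le> c * (\<Sum>i\<in>?J. y i)"
    proof -
      have "(c - \<epsilon> / 2) * ?d \<le> c"
      proof -
        have "\<epsilon> * c \<le> \<epsilon> * 1" using c \<epsilon> by (intro mult_left_mono) auto
        moreover have "0 \<le> \<epsilon> * \<epsilon>" by simp
        moreover have "(c - \<epsilon> / 2) * ?d = c + \<epsilon> * c / 2 - \<epsilon> / 2 - \<epsilon> * \<epsilon> / 4" by (simp add: field_simps)
        ultimately show ?thesis by linarith
      qed
      moreover have "0 \<le> (\<Sum>i\<in>?J. y i)" using y by (intro sum_nonneg) (auto intro: less_imp_le)
      ultimately show ?thesis using mult_right_mono by (fastforce simp: mult_ac)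
    qed
    also have "\<dots> \<le> c * (\<Sum>i\<in>?J. of_rat (y' i) * x i)"
      using c y'x by (intro mult_left_mono sum_mono) auto
    also have "\<dots> = c * (\<Sum>i\<in>N. of_rat (y' i) * x i)"
      by (simp only: sum_positive_part[OF N x])
    also have "\<dots> \<le> measure_pmf.expectation (random_subset N x) (\<lambda>R. Max {\<Sum>i\<in>S. of_rat (y' i) | S. S \<subseteq> R \<and> S \<in> \<I>})"
      using gap y'F unfolding gap_condition_def by simp
    also have "\<dots> = (\<Sum>i\<in>?J. of_rat (y' i) * x i * inclusion N x (f y') i)"
      using y'F by (intro expectation_max_weight N x max_weight_subset_of_rat f) auto
    also have "\<dots> \<le> (\<Sum>i\<in>?J. ?d * y i * inclusion N x (f y') i)"
      using y'x inc[OF y'F] by (intro sum_mono mult_right_mono) auto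
    also have "\<dots> = (\<Sum>i\<in>?J. y i * inclusion N x (f y') i) * ?d"
      unfolding sum_distrib_right by (intro sum.cong refl) (simp add: mult_ac)
    finally have "(c - \<epsilon> / 2) * (\<Sum>i\<in>?J. y i) \<le> (\<Sum>i\<in>?J. y i * inclusion N x (f y') i)"
      using \<epsilon> by (simp add: mult_le_cancel_right)
    then show "\<exists>f'\<in>?F. (c - \<epsilon> / 2) * (\<Sum>i\<in>?J. y i) \<le> (\<Sum>i\<in>?J. y i * inclusion N x (f f') i)"
      using y'F by blast
  qed (use N inc \<epsilon> in auto)
  then show ?thesis by simp
qed

section \<open>The program and its supply of random bits\<close>

lemma ex_bits_used_poly: "\<exists>q. \<forall>k n s. k \<le> s \<and> n \<le> s \<longrightarrow> bits_used k n \<le> poly q s"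
proof -
  let ?X = "{(k, n, s). k \<le> s \<and> n \<le> (s :: nat)}" and ?\<sigma> = "\<lambda>z. snd (snd z)"
  let ?T = "\<lambda>z. 20 * fst z * fst z * fst (snd z) + 1 :: nat"
  have k: "pbd ?X ?\<sigma> fst" and n: "pbd ?X ?\<sigma> (\<lambda>z. fst (snd z))"
    by (rule pbd_mono[OF pbd_size], force)+
  have "pbd ?X ?\<sigma> (\<lambda>z. ?T z + ?T z * (fst (snd z) * (fst (snd z) + fst z + 3)))"
    by (intro pbd_arith k n)
  then have "pbd ?X ?\<sigma> (\<lambda>z. bits_used (fst z) (fst (snd z)))"
  proof (rule pbd_mono)
    fix z :: "nat \<times> nat \<times> nat"
    note le = two_power_horizon_bits_le[of "fst z" "fst (snd z)"]
    have "horizon_bits (fst z) (fst (snd z)) \<le> ?T z"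
      using le less_exp[of "horizon_bits (fst z) (fst (snd z))"] by linarith
    then show "bits_used (fst z) (fst (snd z)) \<le> ?T z + ?T z * (fst (snd z) * (fst (snd z) + fst z + 3))"
      unfolding bits_used_def precision_def by (intro add_mono mult_right_mono le) auto
  qed
  then show ?thesis by (fastforce simp: pbd_def)
qed

lemma ptime_query_input:
  fixes X :: "(data \<times> nat \<times> (nat \<Rightarrow> rat) \<times> nat set \<times> bool list) set" and n :: "data \<Rightarrow> nat"
  defines "v \<equiv> \<lambda>z. query (n (fst z)) (fst z) (fst (snd (snd z))) (fst (snd (snd (snd z))))"
  defines "\<sigma> \<equiv> \<lambda>z. dsize (v z) + fst (snd z)"
  defines "e \<equiv> \<lambda>z. Cell (Atom (fst (snd z))) (Cell (v z) (enc_bits (snd (snd (snd (snd z))))))"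
  assumes len: "pbd X \<sigma> (\<lambda>z. length (snd (snd (snd (snd z)))))"
  shows "ptime X \<sigma> e e"
proof (rule ptime_id)
  have k: "pbd X \<sigma> (\<lambda>z. fst (snd z))" and v: "pbd X \<sigma> (\<lambda>z. dsize (v z))"
    by (rule pbd_mono[OF pbd_size], simp add: \<sigma>_def)+
  have "pbd X \<sigma> (\<lambda>z. 1 + (1 + fst (snd z)) + (1 + dsize (v z) + (1 + length (snd (snd (snd (snd z)))) * (1 + 2))))"
    by (intro pbd_arith k v len)
  then show "pbd X \<sigma> (\<lambda>z. dsize (e z))"
  proof (rule pbd_mono)
    fix z :: "data \<times> nat \<times> (nat \<Rightarrow> rat) \<times> nat set \<times> bool list"
    have "dsize (enc_bits (snd (snd (snd (snd z))))) \<le> 1 + length (snd (snd (snd (snd z)))) * (1 + 2)"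
      unfolding enc_bits_def by (rule order_trans[OF dsize_enc_list_le[of _ 2]]) (auto simp: floorlog_def)
    moreover have "floorlog 2 (fst (snd z)) \<le> fst (snd z)" by (simp add: floorlog2_le)
    ultimately show "dsize (e z) \<le> 1 + (1 + fst (snd z)) + (1 + dsize (v z) + (1 + length (snd (snd (snd (snd z)))) * (1 + 2)))"
      by (simp add: e_def)
  qed
qed

lemma ex_program:
  assumes solver: "poly_time_max_weight W n \<I> \<phi>"
  shows "\<exists>p bits time. (\<forall>k w x A. bits_used k (n w) \<le> poly bits (dsize (query (n w) w x A) + k)) \<and>
    (\<forall>w\<in>W. \<forall>k x A r. A \<subseteq> {..<n w} \<and> length r = poly bits (dsize (query (n w) w x A) + k) \<longrightarrow>
      (\<exists>t\<le>poly time (dsize (query (n w) w x A) + k). run p (Cell (Atom k) (Cell (query (n w) w x A) (enc_bits r))) t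
         (enc_set (n w) (\<phi> w (final_weight (\<phi> w) k (n w) x r) (A \<inter> support (n w) x)))))"
proof -
  obtain bits where bits: "\<And>k n s. k \<le> s \<Longrightarrow> n \<le> s \<Longrightarrow> bits_used k n \<le> poly bits s"
    using ex_bits_used_poly by blast
  have n_le: "n w \<le> dsize (query (n w) w x A) + k" for w x A and k :: nat
    using length_le_dsize[of "map (\<lambda>i. enc_rat (x i)) [0..<n w]"] by (simp add: query_def enc_vec_def)
  have bits': "bits_used k (n w) \<le> poly bits (dsize (query (n w) w x A) + k)" for k w x A
    by (intro bits n_le) simp
  define v where "v z = query (n (fst z)) (fst z) (fst (snd (snd z))) (fst (snd (snd (snd z))))"
    for z :: "data \<times> nat \<times> (nat \<Rightarrow> rat) \<times> nat set \<times> bool list"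
  define \<sigma> where "\<sigma> z = dsize (v z) + fst (snd z)" for z
  define e where "e z = Cell (Atom (fst (snd z))) (Cell (v z) (enc_bits (snd (snd (snd (snd z))))))" for z
  \<comment> \<open>The number of bits is prescribed by a polynomial in \<open>\<sigma>\<close>,
    which itself does not count them; hence the whole input, bits included, has polynomial
    size.\<close>
  define X where "X = {z. fst z \<in> W \<and> fst (snd (snd (snd z))) \<subseteq> {..<n (fst z)} \<and>
    length (snd (snd (snd (snd z)))) = poly bits (\<sigma> z)}"
  have id: "ptime X \<sigma> e e"
    unfolding \<sigma>_def e_def v_def
    by (rule ptime_query_input, rule pbd_mono[OF pbd_poly[of _ _ bits]]) (simp add: X_def \<sigma>_def v_def)
  note k = ptime_fst[OF id[unfolded e_def], folded e_def]
    and q = ptime_fst[OF ptime_snd[OF id[unfolded e_def]], folded e_def]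
    and r = ptime_snd[OF ptime_snd[OF id[unfolded e_def]], folded e_def]
  note w = ptime_fst[OF q[unfolded v_def query_def]]
    and x = ptime_fst[OF ptime_snd[OF q[unfolded v_def query_def]]]
    and A = ptime_snd[OF ptime_snd[OF q[unfolded v_def query_def]]]
  interpret solver_context W n \<I> \<phi> X \<sigma> e fst "\<lambda>z. fst (snd z)" "\<lambda>z. fst (snd (snd z))"
    "\<lambda>z. fst (snd (snd (snd z)))" "\<lambda>z. snd (snd (snd (snd z)))"
  proof
    show "pbd X \<sigma> (\<lambda>z. fst (snd z))" by (rule pbd_mono[OF pbd_size]) (simp add: \<sigma>_def)
    show "bits_used (fst (snd z)) (n (fst z)) \<le> length (snd (snd (snd (snd z))))" if "z \<in> X" for z
      using bits' that by (simp add: X_def \<sigma>_def v_def)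
  qed (use solver w x A k r in \<open>simp_all add: X_def\<close>)
  obtain p T where T: "pbd X \<sigma> T" and run: "\<And>z. z \<in> X \<Longrightarrow> run p (e z) (T z)
    (enc_set (n (fst z)) (\<phi> (fst z) (final_weight (\<phi> (fst z)) (fst (snd z)) (n (fst z)) (fst (snd (snd z))) (snd (snd (snd (snd z)))))
     (fst (snd (snd (snd z))) \<inter> support (n (fst z)) (fst (snd (snd z))))))"
    using ptime_output by (auto simp: ptime_def)
  obtain time where time: "\<And>z. z \<in> X \<Longrightarrow> T z \<le> poly time (\<sigma> z)"
    using T by (auto simp: pbd_def)
  show ?thesis
  proof (rule exI[of _ p], rule exI[of _ bits], rule exI[of _ time], intro conjI allI ballI impI)
    fix w k x A and r :: "bool list"
    assume "w \<in> W" "A \<subseteq> {..<n w} \<and> length r = poly bits (dsize (query (n w) w x A) + k)"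
    then have "(w, k, x, A, r) \<in> X" by (simp add: X_def \<sigma>_def v_def)
    from run[OF this] time[OF this]
    show "\<exists>t\<le>poly time (dsize (query (n w) w x A) + k). run p (Cell (Atom k) (Cell (query (n w) w x A) (enc_bits r))) t
         (enc_set (n w) (\<phi> w (final_weight (\<phi> w) k (n w) x r) (A \<inter> support (n w) x)))"
      by (auto simp: e_def v_def \<sigma>_def)
  qed (rule bits')
qed

text \<open>A coupling: both sets are answered with the same \<open>y\<close>, and the inclusion of
  events holds for each \<open>y\<close> separately. If \<open>x i\<close> is not positive,
  \<open>i\<close> is in neither answer.\<close>

lemma monotone_mixture:
  assumes "\<And>y A A' i. y \<in> set_pmf q \<Longrightarrow> A' \<subseteq> A \<Longrightarrow> A \<subseteq> N \<Longrightarrow> i \<in> A' \<Longrightarrow> i \<in> f y A \<Longrightarrow> i \<in> f y A'"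
    and sub: "\<And>y A. y \<in> set_pmf q \<Longrightarrow> A \<subseteq> N \<Longrightarrow> f y A \<subseteq> A"
    and "i \<in> A\<^sub>1" "A\<^sub>1 \<subseteq> A\<^sub>2" "A\<^sub>2 \<subseteq> N"
  shows "measure_pmf.prob (mixture N x q f A\<^sub>2) {S. i \<in> S} \<le> measure_pmf.prob (mixture N x q f A\<^sub>1) {S. i \<in> S}"
proof -
  let ?J = "{i\<in>N. x i > 0}"
  have "i \<in> f y (A\<^sub>1 \<inter> ?J)" if y: "y \<in> set_pmf q" and i: "i \<in> f y (A\<^sub>2 \<inter> ?J)" for y
  proof (rule assms(1)[OF y _ _ _ i])
    show "i \<in> A\<^sub>1 \<inter> ?J" using sub[OF y, of "A\<^sub>2 \<inter> ?J"] i assms(3,5) by auto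
  qed (use assms in auto)
  then show ?thesis
    unfolding mixture_def measure_map_pmf
    by (intro measure_pmf.finite_measure_mono_AE) (auto simp: AE_measure_pmf_iff)
qed

text \<open>Only the law of the weights depends on the kind of point: at rational points it is the
  law produced by the program, elsewhere one that merely exists. Balance and monotonicity are then
  proved uniformly.\<close>

lemma ex_implemented_scheme:
  fixes n :: nat and b \<epsilon> :: real
  assumes P: "relaxation {..<n} \<I> P" "b \<in> {0..1}" and \<epsilon>: "\<epsilon> > 0"
    and max: "\<forall>y A. (\<forall>i. 0 \<le> y i) \<and> A \<subseteq> {..<n} \<longrightarrow> max_weight_subset \<I> y A (f y A)"
  defines "k \<equiv> nat \<lceil>1 / \<epsilon>\<rceil>"
  shows "\<exists>c \<pi>. largest_balance {..<n} \<I> P b c \<and> balanced_crs {..<n} \<I> P b (c - \<epsilon>) \<pi> \<and>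
    (\<forall>x A. (\<lambda>i. of_rat (x i)) \<in> scaled b P \<and> A \<subseteq> {..<n} \<longrightarrow>
       \<pi> (\<lambda>i. of_rat (x i)) A = map_pmf (\<lambda>r. f (final_weight f k n x r) (A \<inter> support n x)) (coins (bits_used k n))) \<and>
    ((\<forall>y A A'. (\<forall>i. 0 \<le> y i) \<and> A' \<subseteq> A \<and> A \<subseteq> {..<n} \<longrightarrow> (\<forall>i\<in>A'. i \<in> f y A \<longrightarrow> i \<in> f y A')) \<longrightarrow>
       monotone_crs {..<n} P b \<pi>)"
proof -
  let ?N = "{..<n}"
  have f: "max_weight_subset \<I> y A (f y A)" if "\<And>i. 0 \<le> y i" "A \<subseteq> ?N" for y A
    using max that by blast
  \<comment> \<open>On the empty set the solver can only return the empty set, which is therefore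
    feasible.\<close>
  have "max_weight_subset \<I> (\<lambda>_. 0 :: rat) {} (f (\<lambda>_. 0) {})" by (rule f) auto
  then have \<I>: "{} \<in> \<I>" by (auto simp: max_weight_subset_def)
  have k: "k \<ge> 1" "1 / real k \<le> \<epsilon>"
  proof -
    have "0 < 1 / \<epsilon>" using \<epsilon> by simp
    then have pos: "0 < \<lceil>1 / \<epsilon>\<rceil>" by linarith
    then show "k \<ge> 1" using zero_less_nat_eq[of "\<lceil>1 / \<epsilon>\<rceil>"] unfolding k_def by linarith
    have "1 / \<epsilon> \<le> real k" using pos by (simp add: k_def)
    then show "1 / real k \<le> \<epsilon>" using \<epsilon> \<open>k \<ge> 1\<close> by (simp add: field_simps)
  qed
  obtain c where c: "largest_balance ?N \<I> P b c"
    using ex_largest_balance[OF _ \<I> P] by auto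
  then have c01: "c \<in> {0..1}" and gap: "\<And>x. x \<in> scaled b P \<Longrightarrow> gap_condition ?N \<I> x c"
    using balanced_iff_gap_condition[OF _ \<I> P, of c] by (auto simp: largest_balance_def)
  let ?good = "\<lambda>x q. finite (set_pmf q) \<and> set_pmf q \<subseteq> {y. \<forall>i. 0 \<le> y i} \<and>
    (\<forall>i\<in>{i\<in>?N. x i > 0}. c - \<epsilon> \<le> measure_pmf.expectation q (\<lambda>y. inclusion ?N x (f y) i)) \<and>
    (\<forall>z. x = (\<lambda>i. of_rat (z i)) \<longrightarrow> q = map_pmf (final_weight f k n z) (coins (bits_used k n)))"
  have "\<exists>q. ?good x q" if x: "x \<in> scaled b P" for x
  proof (cases "\<exists>z. x = (\<lambda>i. of_rat (z i))")
    case False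
    then show ?thesis
      using rational_weights_mixture[OF _ f scaled_in_unit_cube[OF P x] gap[OF x] c01 \<epsilon>] by auto
  next
    case True
    then obtain z where z: "x = (\<lambda>i. of_rat (z i))" by blast
    let ?q = "map_pmf (final_weight f k n z) (coins (bits_used k n))"
    \<comment> \<open>Injectivity of \<open>of_rat\<close> makes the last clause of
      \<open>?good\<close> a condition on a single law.\<close>
    have "z' = z" if "x = (\<lambda>i. of_rat (z' i))" for z'
      using that by (auto simp: z fun_eq_iff)
    moreover have "c - \<epsilon> \<le> measure_pmf.expectation ?q (\<lambda>y. inclusion ?N x (f y) i)" if "i \<in> {i\<in>?N. x i > 0}" for i
    proof -
      have "c - 1 / k \<le> measure_pmf.expectation (coins (bits_used k n)) (\<lambda>r. inclusion ?N x (f (final_weight f k n z r)) i)"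
        unfolding z by (rule final_weight_guarantee[OF f])
          (use scaled_in_unit_cube[OF P x] gap[OF x] k that in \<open>auto simp: z\<close>)
      then show ?thesis using k by simp
    qed
    moreover have "set_pmf ?q \<subseteq> {y. \<forall>i. 0 \<le> y i}"
      by (auto simp: final_weight_def weight_nonneg)
    ultimately show ?thesis
      by (intro exI[of _ ?q]) (auto simp: finite_bool_lists)
  qed
  then have "\<forall>x\<in>scaled b P. \<exists>q. ?good x q" by (rule ballI)
  from bchoice[OF this] obtain q where q: "\<forall>x\<in>scaled b P. ?good x (q x)" by (elim exE) (rule that)
  define \<pi> where "\<pi> x = mixture ?N x (q x) f" for x
  have fin: "finite (set_pmf (q x))" and nonneg: "\<And>y i. y \<in> set_pmf (q x) \<Longrightarrow> 0 \<le> y i"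
    and qc: "\<And>i. i < n \<Longrightarrow> x i > 0 \<Longrightarrow> c - \<epsilon> \<le> measure_pmf.expectation (q x) (\<lambda>y. inclusion ?N x (f y) i)"
    if "x \<in> scaled b P" for x
    using bspec[OF q that] by auto
  have fq: "f y A \<subseteq> A \<and> f y A \<in> \<I>" if "x \<in> scaled b P" "y \<in> set_pmf (q x)" "A \<subseteq> ?N" for x y A
    using f[of y A] nonneg[OF that(1,2)] that(3) by (simp add: max_weight_subset_def)
  have "balanced_crs ?N \<I> P b (c - \<epsilon>) \<pi>"
    unfolding \<pi>_def by (rule balanced_mixture[OF _ P]) (use fin fq qc in auto)
  moreover have "\<pi> (\<lambda>i. of_rat (x i)) A = map_pmf (\<lambda>r. f (final_weight f k n x r) (A \<inter> support n x)) (coins (bits_used k n))"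
    if x: "(\<lambda>i. of_rat (x i)) \<in> scaled b P" for x A
  proof -
    have "q (\<lambda>i. of_rat (x i)) = map_pmf (final_weight f k n x) (coins (bits_used k n))"
      using bspec[OF q x] by blast
    then show ?thesis
      using support_eq[OF scaled_in_unit_cube[OF P x]] by (simp add: \<pi>_def mixture_def pmf.map_comp o_def)
  qed
  moreover have "monotone_crs ?N P b \<pi>"
    if mono: "\<forall>y A A'. (\<forall>i. 0 \<le> y i) \<and> A' \<subseteq> A \<and> A \<subseteq> ?N \<longrightarrow> (\<forall>i\<in>A'. i \<in> f y A \<longrightarrow> i \<in> f y A')"
    unfolding monotone_crs_def \<pi>_def
  proof (intro ballI allI impI)
    fix x A\<^sub>1 A\<^sub>2 i assume x: "x \<in> scaled b P" and A: "i \<in> A\<^sub>1" "A\<^sub>1 \<subseteq> A\<^sub>2 \<and> A\<^sub>2 \<subseteq> ?N"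
    show "measure_pmf.prob (mixture ?N x (q x) f A\<^sub>2) {S. i \<in> S} \<le> measure_pmf.prob (mixture ?N x (q x) f A\<^sub>1) {S. i \<in> S}"
    proof (rule monotone_mixture[OF _ _ A(1)])
      show "i \<in> f y A'" if "y \<in> set_pmf (q x)" "A' \<subseteq> A" "A \<subseteq> ?N" "i \<in> A'" "i \<in> f y A" for y A A' i
        using mono nonneg[OF x that(1)] that by blast
    qed (use A fq[OF x] in auto)
  qed
  ultimately show ?thesis using c by blast
qed

theorem theorem4p3:
  shows
    "(\<forall>(N :: 'a set) \<I> P b c.
        finite N \<and> \<I> \<subseteq> Pow N \<and> {} \<in> \<I> \<and> relaxation N \<I> P \<and> b \<in> {0..1} \<and> c \<in> {0..1} \<longrightarrow>
        ((\<exists>\<pi>. balanced_crs N \<I> P b c \<pi>) \<longleftrightarrow>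
         (\<forall>x\<in>scaled b P. \<forall>y. (\<forall>i\<in>N. 0 \<le> y i) \<longrightarrow>
            measure_pmf.expectation (random_subset N x)
              (\<lambda>R. Max {\<Sum>i\<in>S. y i | S. S \<subseteq> R \<and> S \<in> \<I>})
            \<ge> c * (\<Sum>i\<in>N. y i * x i))))
     \<and>
     (\<forall>(W :: data set) (n :: data \<Rightarrow> nat) \<I> P \<phi>.
        (\<forall>w\<in>W. \<I> w \<subseteq> Pow {..<n w} \<and> relaxation {..<n w} (\<I> w) (P w)) \<and>
        poly_time_max_weight W n \<I> \<phi> \<longrightarrow>
        (\<exists>p bits time. \<forall>w\<in>W. \<forall>b\<in>{0..1}. \<forall>\<epsilon>>0. \<exists>c\<^sub>m\<^sub>a\<^sub>x \<pi>.
           largest_balance {..<n w} (\<I> w) (P w) b c\<^sub>m\<^sub>a\<^sub>x \<and>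
           balanced_crs {..<n w} (\<I> w) (P w) b (c\<^sub>m\<^sub>a\<^sub>x - \<epsilon>) \<pi> \<and>
           implements_crs p bits time (nat \<lceil>1 / \<epsilon>\<rceil>) w (n w) (P w) b \<pi> \<and>
           (monotone_algorithm W n \<phi> \<longrightarrow> monotone_crs {..<n w} (P w) b \<pi>)))"
proof (rule conjI, goal_cases)
  case 1
  show ?case
  proof (intro allI impI, elim conjE)
    fix N :: "'a set" and \<I> P and b c :: real
    assume "finite N" "{} \<in> \<I>" "relaxation N \<I> P" "b \<in> {0..1}"
    from balanced_iff_gap_condition[OF this, of c, unfolded gap_condition_def]
    show "(\<exists>\<pi>. balanced_crs N \<I> P b c \<pi>) \<longleftrightarrow>
      (\<forall>x\<in>scaled b P. \<forall>y. (\<forall>i\<in>N. 0 \<le> y i) \<longrightarrow>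
         measure_pmf.expectation (random_subset N x) (\<lambda>R. Max {\<Sum>i\<in>S. y i | S. S \<subseteq> R \<and> S \<in> \<I>})
         \<ge> c * (\<Sum>i\<in>N. y i * x i))" .
  qed
next
  case 2
  show ?case
  proof (intro allI impI, elim conjE)
    fix W :: "data set" and n :: "data \<Rightarrow> nat" and \<I> P \<phi>
    assume rel: "\<forall>w\<in>W. \<I> w \<subseteq> Pow {..<n w} \<and> relaxation {..<n w} (\<I> w) (P w)"
      and solver: "poly_time_max_weight W n \<I> \<phi>"
    obtain p bits time where
      bits: "\<forall>k w x A. bits_used k (n w) \<le> poly bits (dsize (query (n w) w x A) + k)" and
      run: "\<forall>w\<in>W. \<forall>k x A r. A \<subseteq> {..<n w} \<and> length r = poly bits (dsize (query (n w) w x A) + k) \<longrightarrow>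
      (\<exists>t\<le>poly time (dsize (query (n w) w x A) + k). run p (Cell (Atom k) (Cell (query (n w) w x A) (enc_bits r))) t
         (enc_set (n w) (\<phi> w (final_weight (\<phi> w) k (n w) x r) (A \<inter> support (n w) x))))"
      using ex_program[OF solver] by (elim exE conjE) (rule that)
    show "\<exists>p bits time. \<forall>w\<in>W. \<forall>b\<in>{0..1}. \<forall>\<epsilon>>0. \<exists>c\<^sub>m\<^sub>a\<^sub>x \<pi>.
           largest_balance {..<n w} (\<I> w) (P w) b c\<^sub>m\<^sub>a\<^sub>x \<and>
           balanced_crs {..<n w} (\<I> w) (P w) b (c\<^sub>m\<^sub>a\<^sub>x - \<epsilon>) \<pi> \<and>
           implements_crs p bits time (nat \<lceil>1 / \<epsilon>\<rceil>) w (n w) (P w) b \<pi> \<and>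
           (monotone_algorithm W n \<phi> \<longrightarrow> monotone_crs {..<n w} (P w) b \<pi>)"
    proof (rule exI[of _ p], rule exI[of _ bits], rule exI[of _ time], intro ballI allI impI)
      fix w and b \<epsilon> :: real assume w: "w \<in> W" and b: "b \<in> {0..1}" and \<epsilon>: "0 < \<epsilon>"
      let ?k = "nat \<lceil>1 / \<epsilon>\<rceil>"
      have P: "relaxation {..<n w} (\<I> w) (P w)" using rel w by blast
      have max: "\<forall>y A. (\<forall>i. 0 \<le> y i) \<and> A \<subseteq> {..<n w} \<longrightarrow> max_weight_subset (\<I> w) y A (\<phi> w y A)"
        using solver w by (simp add: poly_time_max_weight_def)
      obtain c \<pi> where c: "largest_balance {..<n w} (\<I> w) (P w) b c"
        and \<pi>: "balanced_crs {..<n w} (\<I> w) (P w) b (c - \<epsilon>) \<pi>"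
        and dist: "\<forall>x A. (\<lambda>i. of_rat (x i)) \<in> scaled b (P w) \<and> A \<subseteq> {..<n w} \<longrightarrow>
          \<pi> (\<lambda>i. of_rat (x i)) A = map_pmf (\<lambda>r. \<phi> w (final_weight (\<phi> w) ?k (n w) x r) (A \<inter> support (n w) x)) (coins (bits_used ?k (n w)))"
        and mono: "(\<forall>y A A'. (\<forall>i. 0 \<le> y i) \<and> A' \<subseteq> A \<and> A \<subseteq> {..<n w} \<longrightarrow>
            (\<forall>i\<in>A'. i \<in> \<phi> w y A \<longrightarrow> i \<in> \<phi> w y A')) \<longrightarrow> monotone_crs {..<n w} (P w) b \<pi>"
        using ex_implemented_scheme[OF P b \<epsilon> max] by (elim exE conjE) (rule that)
      have "implements_crs p bits time ?k w (n w) (P w) b \<pi>"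
        unfolding implements_crs_def outputs_distribution_def
      proof (intro allI impI, elim conjE)
        fix x A assume x: "(\<lambda>i. of_rat (x i)) \<in> scaled b (P w)" and A: "A \<subseteq> {..<n w}"
        let ?m = "poly bits (dsize (query (n w) w x A) + ?k)"
        let ?out = "\<lambda>r. enc_set (n w) (\<phi> w (final_weight (\<phi> w) ?k (n w) x r) (A \<inter> support (n w) x))"
        have "map_pmf (enc_set (n w)) (\<pi> (\<lambda>i. of_rat (x i)) A) = map_pmf ?out (coins (bits_used ?k (n w)))"
          using dist x A by (simp add: pmf.map_comp o_def)
        \<comment> \<open>Padding: the output depends only on the first \<open>bits_used\<close> of
          the supplied bits.\<close>
        also have "\<dots> = map_pmf ?out (coins ?m)"
          by (rule map_pmf_coins_prefix[symmetric]) (simp_all add: bits final_weight_append)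
        finally have eq: "map_pmf (enc_set (n w)) (\<pi> (\<lambda>i. of_rat (x i)) A) = map_pmf ?out (coins ?m)" .
        have run': "\<exists>t\<le>poly time (dsize (query (n w) w x A) + ?k).
          run p (Cell (Atom ?k) (Cell (query (n w) w x A) (enc_bits r))) t (?out r)" if "length r = ?m" for r
          using run w A that by blast
        show "\<exists>out. (\<forall>r. length r = ?m \<longrightarrow> (\<exists>t\<le>poly time (dsize (query (n w) w x A) + ?k).
            run p (Cell (Atom ?k) (Cell (query (n w) w x A) (enc_bits r))) t (out r))) \<and>
          map_pmf (enc_set (n w)) (\<pi> (\<lambda>i. of_rat (x i)) A) = map_pmf out (coins ?m)"
          by (rule exI[of _ ?out]) (intro conjI allI impI run' eq)
      qed
      moreover have "monotone_crs {..<n w} (P w) b \<pi>" if "monotone_algorithm W n \<phi>"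
      proof (rule mono[THEN mp], intro allI impI)
        fix y :: "nat \<Rightarrow> rat" and A A' assume "(\<forall>i. 0 \<le> y i) \<and> A' \<subseteq> A \<and> A \<subseteq> {..<n w}"
        then show "\<forall>i\<in>A'. i \<in> \<phi> w y A \<longrightarrow> i \<in> \<phi> w y A'"
          using bspec[OF that[unfolded monotone_algorithm_def] w] by blast
      qed
      ultimately show "\<exists>c\<^sub>m\<^sub>a\<^sub>x \<pi>.
           largest_balance {..<n w} (\<I> w) (P w) b c\<^sub>m\<^sub>a\<^sub>x \<and>
           balanced_crs {..<n w} (\<I> w) (P w) b (c\<^sub>m\<^sub>a\<^sub>x - \<epsilon>) \<pi> \<and>
           implements_crs p bits time (nat \<lceil>1 / \<epsilon>\<rceil>) w (n w) (P w) b \<pi> \<and>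
           (monotone_algorithm W n \<phi> \<longrightarrow> monotone_crs {..<n w} (P w) b \<pi>)"
        using c \<pi> by blast
    qed
  qed
qed

end
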